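(* For $\mathbb{K}=\mathbb{R},\mathbb{C},\mathbb{H}$ and $\mathbb{O}$ there are isomorphisms of real Lie algebras $$L_3(\mathbb{K},\mathbb{R})\cong\mathrm{Der}\,H_3(\mathbb{K}),\qquad L_3(\mathbb{K},\tilde{\mathbb{C}})\cong\mathrm{Str}'H_3(\mathbb{K}),\qquad L_3(\mathbb{K},\tilde{\mathbb{H}})\cong\mathrm{Con}\,H_3(\mathbb{K}).$$
   Context: $\dot{+}$ denotes direct sum of vector spaces. A real composition algebra $\mathbb{K}$ is a unital (not necessarily associative) real algebra with a non-degenerate quadratic form $x\mapsto|x|^2$ satisfying $|xy|^2=|x|^2|y|^2$. $\mathbb{R}\subset\mathbb{K}$ is the span of the identity, $\mathbb{K}'$ its orthogonal complement; conjugation $x\mapsto\bar x$ is $+1$ on $\mathbb{R}$ and $-1$ on $\mathbb{K}'$; $\mathrm{Re}$ is the projection on $\mathbb{R}$; $\langle x,y\rangle=\mathrm{Re}(x\bar y)$; $[x,y]=xy-yx$; $L_x(z)=xz$, $R_x(z)=zx$; $D_{x,y}=[L_x,L_y]+[L_x,R_y]+[R_x,R_y]\in\mathrm{Der}\,\mathbb{K}$. $\mathbb{R},\mathbb{C},\mathbb{H},\mathbb{O}$ are the positive definite composition algebras; $\tilde{\mathbb{C}},\tilde{\mathbb{H}}$ are the split forms of $\mathbb{C},\mathbb{H}$ (same dimension, quadratic form of neutral signature). $H_3(\mathbb{K})$ is the Jordan algebra of hermitian $3\times3$ matrices over $\mathbb{K}$ with product $A\cdot B=AB+BA$; $H_3'(\mathbb{K})$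 its traceless subspace. $L_3(\mathbb{K}_1,\mathbb{K}_2)=\mathrm{Der}\,H_3(\mathbb{K}_1)\,\dot{+}\,H_3'(\mathbb{K}_1)\otimes\mathbb{K}_2'\,\dot{+}\,\mathrm{Der}\,\mathbb{K}_2$ is the Lie algebra in which $\mathrm{Der}\,H_3(\mathbb{K}_1)$ and $\mathrm{Der}\,\mathbb{K}_2$ are Lie subalgebras and $[D,A\otimes x]=D(A)\otimes x$, $[E,A\otimes x]=A\otimes E(x)$, $[D,E]=0$, $[A\otimes x,B\otimes y]=\frac16\langle A,B\rangle D_{x,y}+(A\ast B)\otimes\frac12[x,y]-\langle x,y\rangle[L_A,L_B]$, for $D\in\mathrm{Der}\,H_3(\mathbb{K}_1)$, $E\in\mathrm{Der}\,\mathbb{K}_2$, $A,B\in H_3'(\mathbb{K}_1)$, $x,y\in\mathbb{K}_2'$, where $\langle A,B\rangle=\mathrm{Re}\,\mathrm{tr}(A\cdot B)$, $A\ast B=A\cdot B-\frac13\mathrm{tr}(A\cdot B)I$, and $L_A$ is multiplication by $A$ in the Jordan algebra $H_3(\mathbb{K}_1)$. For a Jordan algebra $\mathbb{J}$: $\mathrm{Der}\,\mathbb{J}$ is its derivation algebra; $\mathrm{Str}\,\mathbb{J}=\mathrm{Der}\,\mathbb{J}\,\dot{+}\,L(\mathbb{J})$, where $L(\mathbb{J})=\{L_a:a\in\mathbb{J}\}$, is the structure algebra, a Lie algebra of linear endomorphisms of $\mathbb{J}$ under commutator; $\mathrm{Str}'\mathbb{J}$ is $\mathrm{Str}\,\mathbb{J}$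 with its centre factored out. The conformal algebra is $\mathrm{Con}\,\mathbb{J}=\mathrm{Str}\,\mathbb{J}\,\dot{+}\,\mathbb{J}^2$ with $\mathrm{Str}\,\mathbb{J}$ a Lie subalgebra and, for $T\in\mathrm{Str}\,\mathbb{J}$, $X,Y\in\mathbb{J}$, $[T,(X,Y)]=(TX,T^*Y)$, $[(X,0),(Y,0)]=[(0,X),(0,Y)]=0$, $[(X,0),(0,Y)]=2L_{X\cdot Y}+2[L_X,L_Y]$, where $T\mapsto T^*$ is the involutive automorphism of $\mathrm{Str}\,\mathbb{J}$ equal to $+1$ on $\mathrm{Der}\,\mathbb{J}$ and $-1$ on $L(\mathbb{J})$. *)

theory Defs
  imports "HOL-Analysis.Analysis" "HOL-Analysis.Finite_Function_Topology"
    "HOL-Library.Function_Algebras"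
begin

section \<open>Composition algebras\<close>

class real_nonassoc_algebra = real_vector + times +
  assumes alg_add_left: "(x + y) * z = x * z + y * z"
    and alg_add_right: "x * (y + z) = x * y + x * z"
    and alg_scale_left: "(r *\<^sub>R x) * y = r *\<^sub>R (x * y)"
    and alg_scale_right: "x * (r *\<^sub>R y) = r *\<^sub>R (x * y)"

text \<open>
  \<open>qf x\<close> is the quadratic form usually written $|x|^2$; the term
  \<open>qf (x + y) - qf x - qf y\<close> is twice its polar form.
\<close>

class composition_algebra = real_nonassoc_algebra + one +
  fixes qf :: "'a \<Rightarrow> real"
  assumes alg_one_neq_zero: "1 \<noteq> 0"
    and alg_one_left: "1 * x = x"
    and alg_one_right: "x * 1 = x"
    and qf_scale: "qf (r *\<^sub>R x) = r\<^sup>2 * qf x"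
    and qf_polar_add: "qf ((x + y) + z) - qf (x + y) - qf z
          = (qf (x + z) - qf x - qf z) + (qf (y + z) - qf y - qf z)"
    and qf_polar_scale: "qf (r *\<^sub>R x + z) - qf (r *\<^sub>R x) - qf z
          = r * (qf (x + z) - qf x - qf z)"
    and qf_nondegenerate: "(\<And>y. qf (x + y) - qf x - qf y = 0) \<Longrightarrow> x = 0"
    and qf_mult: "qf (x * y) = qf x * qf y"

class assoc_composition_algebra = composition_algebra + semigroup_mult

class comm_assoc_composition_algebra = assoc_composition_algebra + ab_semigroup_mult

definition polar :: "'a::composition_algebra \<Rightarrow> 'a \<Rightarrow> real" where
  "polar x y = (qf (x + y) - qf x - qf y) / 2"

text \<open>
  Multiplicativity and non-degeneracy force \<open>qf 1 = 1\<close>, so \<open>polar x 1\<close> is the coefficient of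
  the orthogonal projection of \<open>x\<close> onto the line spanned by \<open>1\<close>; that line is identified
  with the real numbers.
\<close>

definition alg_re :: "'a::composition_algebra \<Rightarrow> real" where
  "alg_re x = polar x 1"

definition imag_part :: "'a::composition_algebra set" where
  "imag_part = {x. polar x 1 = 0}"

definition alg_conj :: "'a::composition_algebra \<Rightarrow> 'a" where
  "alg_conj x = alg_re x *\<^sub>R 1 - (x - alg_re x *\<^sub>R 1)"

definition alg_ip :: "'a::composition_algebra \<Rightarrow> 'a \<Rightarrow> real" where
  "alg_ip x y = alg_re (x * alg_conj y)"

lemma polar_sym: "polar x y = polar y x"
  by (simp add: polar_def add.commute)

lemma polar_add_left: "polar (x + y) z = polar x z + polar y z"
  using qf_polar_add[of x y z] by (simp add: polar_def field_simps)

lemma polar_scale_left: "polar (r *\<^sub>R x) z = r * polar x z"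
  using qf_polar_scale[of r x z] by (simp add: polar_def)

lemma polar_add_right: "polar z (x + y) = polar z x + polar z y"
  by (simp add: polar_add_left polar_sym[of z])

lemma polar_scale_right: "polar z (r *\<^sub>R x) = r * polar z x"
  by (simp add: polar_scale_left polar_sym[of z])

lemma polar_minus_left: "polar (- x) z = - polar x z"
  using polar_scale_left[of "-1" x z] by simp

lemma polar_minus_right: "polar z (- x) = - polar z x"
  by (simp add: polar_minus_left polar_sym[of z])

lemma polar_diff_left: "polar (x - y) z = polar x z - polar y z"
  by (simp only: diff_conv_add_uminus polar_add_left polar_minus_left)

lemma polar_diff_right: "polar z (x - y) = polar z x - polar z y"
  by (simp add: polar_diff_left polar_sym[of z])

lemmas polar_simps = polar_add_left polar_add_right polar_scale_left polar_scale_right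
  polar_minus_left polar_minus_right polar_diff_left polar_diff_right

lemma qf_zero: "qf (0::'a::composition_algebra) = 0"
  using qf_scale[of 0 "0::'a"] by simp

lemma qf_minus: "qf (- x) = qf (x::'a::composition_algebra)"
  using qf_scale[of "-1" x] by simp

lemma qf_add: "qf (x + y) = qf x + qf y + 2 * polar x y"
  by (simp add: polar_def field_simps)

lemma qf_diff: "qf (x - y) = qf x + qf y - 2 * polar x y"
  using qf_add[of x "- y"] by (simp add: qf_minus polar_simps)

lemma polar_self: "polar x x = qf x"
  using qf_scale[of 2 x] by (simp add: polar_def scaleR_2)

lemma polar_eqI: "(\<And>z. polar x z = polar y z) \<Longrightarrow> x = y"
proof -
  assume "\<And>z. polar x z = polar y z"
  then have "polar (x - y) z = 0" for z
    by (simp add: polar_simps)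
  then show "x = y"
    using qf_nondegenerate[of "x - y"] by (simp add: polar_def)
qed

lemma qf_one: "qf (1::'a::composition_algebra) = 1"
proof (rule ccontr)
  assume a: "qf (1::'a) \<noteq> 1"
  have "qf (1::'a) * qf (1::'a) = qf (1::'a)"
    using qf_mult[of "1::'a" 1] by (simp add: alg_one_left)
  with a have "qf (1::'a) = 0" by simp
  then have "qf x = 0" for x :: 'a
    using qf_mult[of x 1] by (simp add: alg_one_right)
  then show False
    using qf_nondegenerate[of "1::'a"] alg_one_neq_zero by auto
qed

lemma alg_conj_eq: "alg_conj x = (2 * alg_re x) *\<^sub>R 1 - x"
  by (simp add: alg_conj_def scaleR_add_left[symmetric])

lemma alg_re_conj: "alg_re (alg_conj x) = alg_re x"
  by (simp add: alg_conj_eq alg_re_def polar_simps polar_self qf_one)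

lemma alg_conj_conj: "alg_conj (alg_conj x) = x"
  by (simp add: alg_conj_eq[of "alg_conj x"] alg_re_conj) (simp add: alg_conj_eq)

lemma alg_conj_add: "alg_conj (x + y) = alg_conj x + alg_conj y"
  by (simp add: alg_conj_eq alg_re_def polar_simps algebra_simps)

lemma alg_conj_scale: "alg_conj (r *\<^sub>R x) = r *\<^sub>R alg_conj x"
  by (simp add: alg_conj_eq alg_re_def polar_simps algebra_simps)

lemma alg_conj_minus: "alg_conj (- x) = - alg_conj x"
  using alg_conj_scale[of "-1" x] by simp

lemma alg_conj_zero: "alg_conj 0 = 0"
  using alg_conj_scale[of 0 0] by simp

lemma alg_conj_one: "alg_conj 1 = 1"
  by (simp add: alg_conj_eq alg_re_def polar_self qf_one) (simp add: scaleR_2)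

lemma alg_minus_left: "(- x) * y = - (x * (y::'a::real_nonassoc_algebra))"
  using alg_scale_left[of "-1" x y] by simp

lemma alg_minus_right: "x * (- y) = - (x * (y::'a::real_nonassoc_algebra))"
  using alg_scale_right[of x "-1" y] by simp

lemma alg_zero_left: "0 * y = (0::'a::real_nonassoc_algebra)"
  using alg_scale_left[of 0 0 y] by simp

lemma alg_zero_right: "y * 0 = (0::'a::real_nonassoc_algebra)"
  using alg_scale_right[of y 0 0] by simp

lemma alg_diff_left: "(x - y) * z = x * z - y * (z::'a::real_nonassoc_algebra)"
  using alg_add_left[of x "- y" z] by (simp add: alg_minus_left)

lemma alg_diff_right: "z * (x - y) = z * x - z * (y::'a::real_nonassoc_algebra)"
  using alg_add_right[of z x "- y"] by (simp add: alg_minus_right)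

lemmas alg_bilinear_simps = alg_add_left alg_add_right alg_scale_left alg_scale_right
  alg_minus_left alg_minus_right alg_diff_left alg_diff_right alg_zero_left alg_zero_right

lemma polar_mult_same: "polar (x * y) (x * z) = qf x * polar y z"
proof -
  have "2 * polar (x * y) (x * z) = 2 * (qf x * polar y z)"
    using qf_mult[of x "y + z"] by (simp add: alg_add_right qf_add qf_mult algebra_simps)
  then show ?thesis by simp
qed

lemma polar_mult_cross: "polar (x * y) (z * w) + polar (x * w) (z * y) = 2 * polar x z * polar y w"
  using polar_mult_same[of "x + z" y w]
  by (simp add: alg_add_left polar_simps polar_mult_same qf_add algebra_simps polar_sym[of "z * y"])

lemma polar_adjoint_right: "polar (x * y) z = polar x (z * alg_conj y)"
  using polar_mult_cross[of x y z 1]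
  by (simp add: alg_one_right alg_conj_eq alg_re_def polar_simps alg_bilinear_simps algebra_simps)

lemma polar_adjoint_left: "polar (x * y) z = polar y (alg_conj x * z)"
  using polar_mult_cross[of x y 1 z]
  by (simp add: alg_one_left alg_conj_eq alg_re_def polar_simps alg_bilinear_simps algebra_simps
      polar_sym[of "x * z"])

lemma polar_conj: "polar (alg_conj x) y = polar x (alg_conj y)"
  by (simp add: alg_conj_eq alg_re_def polar_simps polar_sym[of 1])

lemma qf_conj: "qf (alg_conj x) = qf x"
  by (simp add: polar_self[symmetric] polar_conj alg_conj_conj)

lemma alg_conj_mult: "alg_conj (x * y) = alg_conj y * alg_conj x"
proof (rule polar_eqI)
  fix z
  have "polar (alg_conj y * alg_conj x) z = polar (alg_conj x) (y * z)"
    by (simp add: polar_adjoint_left alg_conj_conj)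
  also have "\<dots> = polar (alg_conj x * alg_conj z) y"
    by (simp add: polar_adjoint_right alg_conj_conj)
  also have "\<dots> = polar (alg_conj z) (x * y)"
    by (simp add: polar_adjoint_left alg_conj_conj)
  also have "\<dots> = polar (alg_conj (x * y)) z"
    by (simp add: polar_conj polar_sym)
  finally show "polar (alg_conj (x * y)) z = polar (alg_conj y * alg_conj x) z" by simp
qed

subsection \<open>The algebras R, C, H, O and the split forms of C, H\<close>

instantiation real :: comm_assoc_composition_algebra
begin

definition qf_real :: "real \<Rightarrow> real" where
  "qf_real x = x\<^sup>2"

instance
proof
  fix x :: real
  assume "\<And>y. qf (x + y) - qf x - qf y = 0"
  from this[of x] show "x = 0" by (simp add: qf_real_def power2_eq_square algebra_simps)
qed (auto simp: qf_real_def power2_eq_square algebra_simps)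

end

instantiation complex :: comm_assoc_composition_algebra
begin

definition qf_complex :: "complex \<Rightarrow> real" where
  "qf_complex z = (cmod z)\<^sup>2"

instance
proof
  fix x :: complex
  assume "\<And>y. qf (x + y) - qf x - qf y = 0"
  from this[of x] have "(cmod (2 *\<^sub>R x))\<^sup>2 = 2 * (cmod x)\<^sup>2"
    by (simp add: qf_complex_def scaleR_2)
  then show "x = 0" by (simp add: power_mult_distrib)
next
  fix x y :: complex
  show "qf (x * y) = qf x * qf y"
    by (simp add: qf_complex_def norm_mult power_mult_distrib)
qed (unfold qf_complex_def cmod_power2, auto simp: power2_eq_square algebra_simps)

end

text \<open>
  The two Cayley--Dickson doubles of an algebra: pairs with product
  $(a, b)(c, d) = (ac + \varepsilon \bar d b, da + b \bar c)$ and quadratic form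
  $|a|^2 - \varepsilon |b|^2$, where $\varepsilon = -1$ for \<open>cd\<close> and
  $\varepsilon = 1$ for \<open>scd\<close>.
\<close>

datatype 'a cd = CD (cd_fst: 'a) (cd_snd: 'a)

instantiation cd :: (real_vector) real_vector
begin
definition "0 = CD 0 0"
definition "x + y = CD (cd_fst x + cd_fst y) (cd_snd x + cd_snd y)"
definition "x - y = CD (cd_fst x - cd_fst y) (cd_snd x - cd_snd y)"
definition "- x = CD (- cd_fst x) (- cd_snd x)"
definition "r *\<^sub>R x = CD (r *\<^sub>R cd_fst x) (r *\<^sub>R cd_snd x)"
instance
  by standard
    (simp_all add: zero_cd_def plus_cd_def minus_cd_def uminus_cd_def scaleR_cd_def algebra_simps)
end

lemmas cd_defs = zero_cd_def plus_cd_def minus_cd_def uminus_cd_def scaleR_cd_def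

instantiation cd :: (assoc_composition_algebra) composition_algebra
begin

definition one_cd :: "'a cd" where
  "1 = CD 1 0"

definition times_cd :: "'a cd \<Rightarrow> 'a cd \<Rightarrow> 'a cd" where
  "x * y = CD (cd_fst x * cd_fst y - alg_conj (cd_snd y) * cd_snd x)
              (cd_snd y * cd_fst x + cd_snd x * alg_conj (cd_fst y))"

definition qf_cd :: "'a cd \<Rightarrow> real" where
  "qf x = qf (cd_fst x) + qf (cd_snd x)"

instance
proof
  fix x y z :: "'a cd" and r :: real
  show "(x + y) * z = x * z + y * z"
    by (simp add: times_cd_def cd_defs alg_bilinear_simps)
  show "x * (y + z) = x * y + x * z"
    by (simp add: times_cd_def cd_defs alg_bilinear_simps alg_conj_add)
  show "(r *\<^sub>R x) * y = r *\<^sub>R (x * y)"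
    by (simp add: times_cd_def cd_defs alg_bilinear_simps algebra_simps)
  show "x * (r *\<^sub>R y) = r *\<^sub>R (x * y)"
    by (simp add: times_cd_def cd_defs alg_bilinear_simps alg_conj_scale algebra_simps)
  show "1 \<noteq> (0::'a cd)"
    by (simp add: one_cd_def cd_defs alg_one_neq_zero)
  show "1 * x = x"
    by (simp add: one_cd_def times_cd_def alg_bilinear_simps alg_one_left alg_one_right)
  show "x * 1 = x"
    by (simp add: one_cd_def times_cd_def alg_bilinear_simps alg_one_left alg_one_right
        alg_conj_zero alg_conj_one)
  show "qf (r *\<^sub>R x) = r\<^sup>2 * qf x"
    by (simp add: qf_cd_def cd_defs qf_scale algebra_simps)
  show "qf ((x + y) + z) - qf (x + y) - qf z
          = (qf (x + z) - qf x - qf z) + (qf (y + z) - qf y - qf z)"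
    by (simp add: qf_cd_def cd_defs qf_add polar_simps)
  show "qf (r *\<^sub>R x + z) - qf (r *\<^sub>R x) - qf z = r * (qf (x + z) - qf x - qf z)"
    by (simp add: qf_cd_def cd_defs qf_add polar_simps distrib_left right_diff_distrib)
  show "qf (x * y) = qf x * qf y"
  proof -
    obtain a b c d where xy: "x = CD a b" "y = CD c d" by (metis cd.exhaust)
    have "polar (a * c) (alg_conj d * b) = polar (d * a) (b * alg_conj c)"
      by (metis polar_adjoint_left polar_adjoint_right alg_conj_conj polar_sym mult.assoc)
    then show ?thesis
      by (simp add: xy qf_cd_def times_cd_def qf_add qf_diff qf_mult qf_conj algebra_simps)
  qed
next
  fix x :: "'a cd"
  assume h: "\<And>y. qf (x + y) - qf x - qf y = 0"
  have "polar (cd_fst x) u = polar 0 u" "polar (cd_snd x) u = polar 0 u" for u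
    using h[of "CD u 0"] h[of "CD 0 u"]
    by (simp_all add: qf_cd_def cd_defs polar_def qf_zero)
  then have "cd_fst x = 0" "cd_snd x = 0" by (blast intro: polar_eqI)+
  then show "x = 0" by (cases x) (simp add: cd_defs)
qed

end

instance cd :: (comm_assoc_composition_algebra) assoc_composition_algebra
proof
  fix x y z :: "'a cd"
  show "x * y * z = x * (y * z)"
    by (simp add: times_cd_def alg_bilinear_simps alg_conj_mult alg_conj_conj alg_conj_add
        alg_conj_minus diff_conv_add_uminus mult_ac add_ac del: add_uminus_conv_diff uminus_add_conv_diff)
qed

datatype 'a scd = SCD (scd_fst: 'a) (scd_snd: 'a)

instantiation scd :: (real_vector) real_vector
begin
definition "0 = SCD 0 0"
definition "x + y = SCD (scd_fst x + scd_fst y) (scd_snd x + scd_snd y)"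
definition "x - y = SCD (scd_fst x - scd_fst y) (scd_snd x - scd_snd y)"
definition "- x = SCD (- scd_fst x) (- scd_snd x)"
definition "r *\<^sub>R x = SCD (r *\<^sub>R scd_fst x) (r *\<^sub>R scd_snd x)"
instance
  by standard
    (simp_all add: zero_scd_def plus_scd_def minus_scd_def uminus_scd_def scaleR_scd_def
      algebra_simps)
end

lemmas scd_defs = zero_scd_def plus_scd_def minus_scd_def uminus_scd_def scaleR_scd_def

instantiation scd :: (assoc_composition_algebra) composition_algebra
begin

definition one_scd :: "'a scd" where
  "1 = SCD 1 0"

definition times_scd :: "'a scd \<Rightarrow> 'a scd \<Rightarrow> 'a scd" where
  "x * y = SCD (scd_fst x * scd_fst y + alg_conj (scd_snd y) * scd_snd x)
               (scd_snd y * scd_fst x + scd_snd x * alg_conj (scd_fst y))"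

definition qf_scd :: "'a scd \<Rightarrow> real" where
  "qf x = qf (scd_fst x) - qf (scd_snd x)"

instance
proof
  fix x y z :: "'a scd" and r :: real
  show "(x + y) * z = x * z + y * z"
    by (simp add: times_scd_def scd_defs alg_bilinear_simps)
  show "x * (y + z) = x * y + x * z"
    by (simp add: times_scd_def scd_defs alg_bilinear_simps alg_conj_add)
  show "(r *\<^sub>R x) * y = r *\<^sub>R (x * y)"
    by (simp add: times_scd_def scd_defs alg_bilinear_simps algebra_simps)
  show "x * (r *\<^sub>R y) = r *\<^sub>R (x * y)"
    by (simp add: times_scd_def scd_defs alg_bilinear_simps alg_conj_scale algebra_simps)
  show "1 \<noteq> (0::'a scd)"
    by (simp add: one_scd_def scd_defs alg_one_neq_zero)
  show "1 * x = x"
    by (simp add: one_scd_def times_scd_def alg_bilinear_simps alg_one_left alg_one_right)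
  show "x * 1 = x"
    by (simp add: one_scd_def times_scd_def alg_bilinear_simps alg_one_left alg_one_right
        alg_conj_zero alg_conj_one)
  show "qf (r *\<^sub>R x) = r\<^sup>2 * qf x"
    by (simp add: qf_scd_def scd_defs qf_scale algebra_simps)
  show "qf ((x + y) + z) - qf (x + y) - qf z
          = (qf (x + z) - qf x - qf z) + (qf (y + z) - qf y - qf z)"
    by (simp add: qf_scd_def scd_defs qf_add polar_simps)
  show "qf (r *\<^sub>R x + z) - qf (r *\<^sub>R x) - qf z = r * (qf (x + z) - qf x - qf z)"
    by (simp add: qf_scd_def scd_defs qf_add polar_simps distrib_left right_diff_distrib)
  show "qf (x * y) = qf x * qf y"
  proof -
    obtain a b c d where xy: "x = SCD a b" "y = SCD c d" by (metis scd.exhaust)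
    have "polar (a * c) (alg_conj d * b) = polar (d * a) (b * alg_conj c)"
      by (metis polar_adjoint_left polar_adjoint_right alg_conj_conj polar_sym mult.assoc)
    then show ?thesis
      by (simp add: xy qf_scd_def times_scd_def qf_add qf_diff qf_mult qf_conj algebra_simps)
  qed
next
  fix x :: "'a scd"
  assume h: "\<And>y. qf (x + y) - qf x - qf y = 0"
  have "polar (scd_fst x) u = polar 0 u" "polar (scd_snd x) u = polar 0 u" for u
    using h[of "SCD u 0"] h[of "SCD 0 u"]
    by (simp_all add: qf_scd_def scd_defs polar_def qf_zero)
  then have "scd_fst x = 0" "scd_snd x = 0" by (blast intro: polar_eqI)+
  then show "x = 0" by (cases x) (simp add: scd_defs)
qed

end

type_synonym quaternion = "complex cd"
type_synonym octonion = "complex cd cd"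
type_synonym split_complex = "real scd"
type_synonym split_quaternion = "complex scd"

section \<open>Hermitian matrices\<close>

definition nmat_mult :: "'a::real_nonassoc_algebra^3^3 \<Rightarrow> 'a^3^3 \<Rightarrow> 'a^3^3" where
  "nmat_mult A B = (\<chi> i j. \<Sum>k\<in>UNIV. A $ i $ k * B $ k $ j)"

lemma alg_conj_sum: "alg_conj (sum f S) = (\<Sum>i\<in>S. alg_conj (f i))"
  by (induction S rule: infinite_finite_induct) (simp_all add: alg_conj_zero alg_conj_add)

lemma jordan_hermitian:
  fixes A B :: "'a::composition_algebra^3^3"
  assumes A: "\<And>i j. alg_conj (A $ i $ j) = A $ j $ i"
    and B: "\<And>i j. alg_conj (B $ i $ j) = B $ j $ i"
  shows "alg_conj ((nmat_mult A B + nmat_mult B A) $ i $ j)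
    = (nmat_mult A B + nmat_mult B A) $ j $ i"
proof -
  have "alg_conj (A $ i $ k * B $ k $ j) = B $ j $ k * A $ k $ i"
    "alg_conj (B $ i $ k * A $ k $ j) = A $ j $ k * B $ k $ i" for k
    by (simp_all add: alg_conj_mult A B)
  then show "alg_conj ((nmat_mult A B + nmat_mult B A) $ i $ j)
    = (nmat_mult A B + nmat_mult B A) $ j $ i"
    by (simp add: nmat_mult_def alg_conj_add alg_conj_sum add.commute)
qed

typedef (overloaded) ('a::composition_algebra) herm3 =
    "{A::'a^3^3. \<forall>i j. alg_conj (A $ i $ j) = A $ j $ i}"
  morphisms mat_of Herm3
  by (rule exI[of _ 0]) (simp add: alg_conj_zero)

setup_lifting type_definition_herm3

instantiation herm3 :: (composition_algebra) real_nonassoc_algebra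
begin

lift_definition zero_herm3 :: "'a herm3" is 0
  by (simp add: alg_conj_zero)
lift_definition plus_herm3 :: "'a herm3 \<Rightarrow> 'a herm3 \<Rightarrow> 'a herm3" is "(+)"
  by (simp add: alg_conj_add)
lift_definition uminus_herm3 :: "'a herm3 \<Rightarrow> 'a herm3" is uminus
  by (simp add: alg_conj_minus)
definition minus_herm3 :: "'a herm3 \<Rightarrow> 'a herm3 \<Rightarrow> 'a herm3" where
  "minus_herm3 A B = A + - B"
lift_definition scaleR_herm3 :: "real \<Rightarrow> 'a herm3 \<Rightarrow> 'a herm3" is scaleR
  by (simp add: alg_conj_scale)

lift_definition times_herm3 :: "'a herm3 \<Rightarrow> 'a herm3 \<Rightarrow> 'a herm3"
  is "\<lambda>A B. nmat_mult A B + nmat_mult B A"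
  by (rule jordan_hermitian)

instance
proof
  fix x y z :: "'a herm3" and r :: real
  show "(x + y) * z = x * z + y * z" "x * (y + z) = x * y + x * z"
    by (transfer; simp add: nmat_mult_def vec_eq_iff alg_bilinear_simps sum.distrib)+
  show "(r *\<^sub>R x) * y = r *\<^sub>R (x * y)" "x * (r *\<^sub>R y) = r *\<^sub>R (x * y)"
    by (transfer; simp add: nmat_mult_def vec_eq_iff alg_bilinear_simps scaleR_sum_right
        scaleR_add_right)+
  show "x + y + z = x + (y + z)" by transfer (simp add: add.assoc)
  show "x + y = y + x" by transfer (simp add: add.commute)
  show "0 + x = x" by transfer simp
  show "- x + x = 0" by transfer simp
  show "x - y = x + - y" by (simp add: minus_herm3_def)
  fix s :: real
  show "r *\<^sub>R (x + y) = r *\<^sub>R x + r *\<^sub>R y" by transfer (simp add: scaleR_add_right)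
  show "(r + s) *\<^sub>R x = r *\<^sub>R x + s *\<^sub>R x" by transfer (simp add: scaleR_add_left)
  show "r *\<^sub>R s *\<^sub>R x = (r * s) *\<^sub>R x" by transfer simp
  show "1 *\<^sub>R x = x" by transfer simp
qed

end


text \<open>The diagonal entries of a hermitian matrix are real, hence so is its trace.\<close>

definition herm_trace :: "'a::composition_algebra herm3 \<Rightarrow> real" where
  "herm_trace A = alg_re (\<Sum>i\<in>UNIV. mat_of A $ i $ i)"

lift_definition herm_id :: "'a::composition_algebra herm3" is "mat 1"
  by (simp add: mat_def alg_conj_one alg_conj_zero)

definition herm_traceless :: "'a::composition_algebra herm3 set" where
  "herm_traceless = {A. herm_trace A = 0}"

definition herm_ip :: "'a::composition_algebra herm3 \<Rightarrow> 'a herm3 \<Rightarrow> real" where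
  "herm_ip A B = herm_trace (A * B)"

definition herm_star :: "'a::composition_algebra herm3 \<Rightarrow> 'a herm3 \<Rightarrow> 'a herm3" where
  "herm_star A B = A * B - (1/3 * herm_trace (A * B)) *\<^sub>R herm_id"

section \<open>Endomorphisms and derivations\<close>

instantiation "fun" :: (type, real_vector) real_vector
begin
definition scaleR_fun :: "real \<Rightarrow> ('a \<Rightarrow> 'b) \<Rightarrow> 'a \<Rightarrow> 'b" where
  "scaleR_fun r f = (\<lambda>x. r *\<^sub>R f x)"
instance
  by standard (simp_all add: scaleR_fun_def fun_eq_iff scaleR_add_right scaleR_add_left)
end

definition commutator :: "('a::real_vector \<Rightarrow> 'a) \<Rightarrow> ('a \<Rightarrow> 'a) \<Rightarrow> 'a \<Rightarrow> 'a" where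
  "commutator S T = (\<lambda>x. S (T x) - T (S x))"

definition lmul :: "'a::real_nonassoc_algebra \<Rightarrow> 'a \<Rightarrow> 'a" where
  "lmul x = (\<lambda>z. x * z)"

definition rmul :: "'a::real_nonassoc_algebra \<Rightarrow> 'a \<Rightarrow> 'a" where
  "rmul x = (\<lambda>z. z * x)"

definition derivations :: "('a::real_nonassoc_algebra \<Rightarrow> 'a) set" where
  "derivations = {D. linear D \<and> (\<forall>x y. D (x * y) = D x * y + x * D y)}"

definition inner_der :: "'a::composition_algebra \<Rightarrow> 'a \<Rightarrow> 'a \<Rightarrow> 'a" where
  "inner_der x y = commutator (lmul x) (lmul y) + commutator (lmul x) (rmul y)
                 + commutator (rmul x) (rmul y)"

section \<open>Tensor products of real vector spaces\<close>

definition tensor_relations ::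
    "('a::real_vector \<times> 'b::real_vector, real) poly_mapping set" where
  "tensor_relations =
     {Poly_Mapping.single (a + a', b) 1 - Poly_Mapping.single (a, b) 1
        - Poly_Mapping.single (a', b) 1 | a a' b. True}
   \<union> {Poly_Mapping.single (a, b + b') 1 - Poly_Mapping.single (a, b) 1
        - Poly_Mapping.single (a, b') 1 | a b b'. True}
   \<union> {Poly_Mapping.single (r *\<^sub>R a, b) 1 - r *\<^sub>R Poly_Mapping.single (a, b) 1 | r a b. True}
   \<union> {Poly_Mapping.single (a, r *\<^sub>R b) 1 - r *\<^sub>R Poly_Mapping.single (a, b) 1 | r a b. True}"

quotient_type (overloaded) ('a, 'b) tensor = "('a::real_vector \<times> 'b::real_vector, real) poly_mapping" /
    "\<lambda>f g. f - g \<in> span tensor_relations"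
proof (rule equivpI)
  show "reflp (\<lambda>f g. f - g \<in> span (tensor_relations :: ('a \<times> 'b, real) poly_mapping set))"
    by (rule reflpI) (simp add: span_zero)
  show "symp (\<lambda>f g. f - g \<in> span (tensor_relations :: ('a \<times> 'b, real) poly_mapping set))"
    by (rule sympI) (drule span_neg, simp)
  show "transp (\<lambda>f g. f - g \<in> span (tensor_relations :: ('a \<times> 'b, real) poly_mapping set))"
    by (rule transpI) (drule (1) span_add, simp)
qed

instantiation tensor :: (real_vector, real_vector) real_vector
begin
lift_definition zero_tensor :: "('a, 'b) tensor" is 0 .
lift_definition plus_tensor :: "('a, 'b) tensor \<Rightarrow> ('a, 'b) tensor \<Rightarrow> ('a, 'b) tensor" is "(+)"
  by (drule (1) span_add) (simp only: add_diff_add)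
lift_definition uminus_tensor :: "('a, 'b) tensor \<Rightarrow> ('a, 'b) tensor" is uminus
  by (drule span_neg) (simp only: minus_diff_minus)
definition minus_tensor :: "('a, 'b) tensor \<Rightarrow> ('a, 'b) tensor \<Rightarrow> ('a, 'b) tensor" where
  "minus_tensor s t = s + - t"
lift_definition scaleR_tensor :: "real \<Rightarrow> ('a, 'b) tensor \<Rightarrow> ('a, 'b) tensor" is scaleR
  by (simp only: scaleR_right_diff_distrib[symmetric] span_scale)
instance
proof
  fix x y z :: "('a, 'b) tensor" and r s :: real
  show "x + y + z = x + (y + z)" by transfer (simp add: add.assoc span_zero)
  show "x + y = y + x" by transfer (simp add: add.commute span_zero)
  show "0 + x = x" by transfer (simp add: span_zero)
  show "- x + x = 0" by transfer (simp add: span_zero)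
  show "x - y = x + - y" by (simp add: minus_tensor_def)
  show "r *\<^sub>R (x + y) = r *\<^sub>R x + r *\<^sub>R y" by transfer (simp add: scaleR_add_right span_zero)
  show "(r + s) *\<^sub>R x = r *\<^sub>R x + s *\<^sub>R x" by transfer (simp add: scaleR_add_left span_zero)
  show "r *\<^sub>R s *\<^sub>R x = (r * s) *\<^sub>R x" by transfer (simp add: span_zero)
  show "1 *\<^sub>R x = x" by transfer (simp add: span_zero)
qed
end

lift_definition pure_tensor :: "'a::real_vector \<Rightarrow> 'b::real_vector \<Rightarrow> ('a, 'b) tensor"
  (infixl "\<otimes>" 80) is "\<lambda>a b. Poly_Mapping.single (a, b) 1" .

text \<open>
  The linear map induced by a bilinear map \<open>f\<close>; existence and uniqueness are shown below.
\<close>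

definition tensor_lift ::
    "('a::real_vector \<Rightarrow> 'b::real_vector \<Rightarrow> 'c::real_vector) \<Rightarrow> ('a, 'b) tensor \<Rightarrow> 'c" where
  "tensor_lift f = (THE g. linear g \<and> (\<forall>a b. g (a \<otimes> b) = f a b))"

lemma lookup_scaleR_pm: "Poly_Mapping.lookup (r *\<^sub>R h) k = r *\<^sub>R Poly_Mapping.lookup h k"
proof -
  have "finite {i. r *\<^sub>R Poly_Mapping.lookup h i \<noteq> 0}"
    by (rule finite_subset[OF _ finite_lookup[of h]]) auto
  then show ?thesis by (simp add: scaleR_poly_mapping_def)
qed

lemma tensor_linear_eqI:
  fixes g g' :: "('a::real_vector, 'b::real_vector) tensor \<Rightarrow> 'c::real_vector"
  assumes "linear g" "linear g'" and eq: "\<And>a b. g (a \<otimes> b) = g' (a \<otimes> b)"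
  shows "g = g'"
proof
  fix t :: "('a, 'b) tensor"
  define h where "h = rep_tensor t"
  have t: "t = abs_tensor h"
    unfolding h_def by (rule Quotient3_abs_rep[OF Quotient3_tensor, symmetric])
  have abs_sum: "abs_tensor (\<Sum>k\<in>S. c k *\<^sub>R Poly_Mapping.single k 1)
      = (\<Sum>k\<in>S. c k *\<^sub>R (fst k \<otimes> snd k))" for c and S :: "('a \<times> 'b) set"
    by (induction S rule: infinite_finite_induct)
      (simp_all add: zero_tensor.abs_eq[symmetric] plus_tensor.abs_eq[symmetric]
        scaleR_tensor.abs_eq[symmetric] pure_tensor.abs_eq)
  define s where
    "s = (\<Sum>k\<in>Poly_Mapping.keys h. Poly_Mapping.lookup h k *\<^sub>R Poly_Mapping.single k (1::real))"
  have "Poly_Mapping.lookup s k = Poly_Mapping.lookup h k" for k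
  proof -
    have "Poly_Mapping.lookup s k = (\<Sum>j\<in>Poly_Mapping.keys h.
        if j = k then Poly_Mapping.lookup h k else 0)"
      unfolding s_def lookup_sum lookup_scaleR_pm lookup_single
      by (intro sum.cong) (auto simp: when_def)
    then show ?thesis by (simp add: in_keys_iff)
  qed
  then have "s = h" by (rule poly_mapping_eqI)
  have "abs_tensor s = (\<Sum>k\<in>Poly_Mapping.keys h. Poly_Mapping.lookup h k *\<^sub>R (fst k \<otimes> snd k))"
    unfolding s_def using abs_sum[of "Poly_Mapping.lookup h" "Poly_Mapping.keys h"] .
  then have "t = (\<Sum>k\<in>Poly_Mapping.keys h. Poly_Mapping.lookup h k *\<^sub>R (fst k \<otimes> snd k))"
    unfolding \<open>s = h\<close> t .
  then show "g t = g' t"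
    using assms by (simp add: linear_sum linear_scale)
qed

lemma tensor_lift:
  fixes f :: "'a::real_vector \<Rightarrow> 'b::real_vector \<Rightarrow> 'c::real_vector"
  assumes f: "bilinear f"
  shows "linear (tensor_lift f)" and "tensor_lift f (a \<otimes> b) = f a b"
proof -
  define F where "F h = (\<Sum>k\<in>Poly_Mapping.keys h. Poly_Mapping.lookup h k *\<^sub>R f (fst k) (snd k))"
    for h :: "('a \<times> 'b, real) poly_mapping"
  have F_sum: "F h = (\<Sum>k\<in>S. Poly_Mapping.lookup h k *\<^sub>R f (fst k) (snd k))"
    if "finite S" "Poly_Mapping.keys h \<subseteq> S"
    for h :: "('a \<times> 'b, real) poly_mapping" and S
    unfolding F_def using that by (intro sum.mono_neutral_left) (auto simp: in_keys_iff)
  have lin: "linear F"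
  proof (rule linearI)
    fix h h' :: "('a \<times> 'b, real) poly_mapping" and r :: real
    let ?S = "Poly_Mapping.keys h \<union> Poly_Mapping.keys h'"
    have "Poly_Mapping.keys (h + h') \<subseteq> ?S" by (rule keys_add)
    then show "F (h + h') = F h + F h'"
      by (simp add: F_sum[of ?S] lookup_add scaleR_add_left sum.distrib)
    have "Poly_Mapping.keys (r *\<^sub>R h) \<subseteq> Poly_Mapping.keys h"
      by (auto simp: in_keys_iff lookup_scaleR_pm)
    then show "F (r *\<^sub>R h) = r *\<^sub>R F h"
      by (simp add: F_sum[of "Poly_Mapping.keys h"] lookup_scaleR_pm scaleR_sum_right)
  qed
  have single: "F (Poly_Mapping.single (a, b) 1) = f a b" for a b
    by (simp add: F_def)
  have zero: "F h = 0" if "h \<in> span tensor_relations" for h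
  proof (rule linear_eq_0_on_span[OF lin _ that])
    show "F x = 0" if "x \<in> tensor_relations" for x
      using that by (auto simp: tensor_relations_def single linear_diff[OF lin] linear_scale[OF lin]
          bilinear_ladd[OF f] bilinear_radd[OF f] bilinear_lmul[OF f] bilinear_rmul[OF f])
  qed
  define g where "g t = F (rep_tensor t)" for t
  have g_abs: "g (abs_tensor h) = F h" for h
  proof -
    have "rep_tensor (abs_tensor h) - h \<in> span tensor_relations"
      by (rule rep_abs_rsp_left[OF Quotient3_tensor]) (simp add: span_zero)
    then have "F (rep_tensor (abs_tensor h) - h) = 0" by (rule zero)
    then show ?thesis by (simp add: g_def linear_diff[OF lin])
  qed
  have abs_rep: "abs_tensor (rep_tensor t) = t" for t :: "('a, 'b) tensor"
    by (rule Quotient3_abs_rep[OF Quotient3_tensor])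
  have "linear g"
  proof (rule linearI)
    fix s t and r :: real
    show "g (s + t) = g s + g t"
      using g_abs[of "rep_tensor s + rep_tensor t"]
      by (simp add: plus_tensor.abs_eq[symmetric] abs_rep linear_add[OF lin] g_def)
    show "g (r *\<^sub>R s) = r *\<^sub>R g s"
      using g_abs[of "r *\<^sub>R rep_tensor s"]
      by (simp add: scaleR_tensor.abs_eq[symmetric] abs_rep linear_scale[OF lin] g_def)
  qed
  moreover have "g (a \<otimes> b) = f a b" for a b
    by (simp add: pure_tensor.abs_eq g_abs single)
  ultimately have ex: "linear g \<and> (\<forall>a b. g (a \<otimes> b) = f a b)" by blast
  have "linear (tensor_lift f) \<and> (\<forall>a b. tensor_lift f (a \<otimes> b) = f a b)"
    unfolding tensor_lift_def
  proof (rule theI[where a = g])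
    show "linear g \<and> (\<forall>a b. g (a \<otimes> b) = f a b)" by (rule ex)
    show "g' = g" if "linear g' \<and> (\<forall>a b. g' (a \<otimes> b) = f a b)" for g'
      using that ex by (intro tensor_linear_eqI) auto
  qed
  then show "linear (tensor_lift f)" and "tensor_lift f (a \<otimes> b) = f a b" by blast+
qed

section \<open>Real Lie algebras\<close>

record 'a lie_struct =
  lcarrier :: "'a set"
  ladd :: "'a \<Rightarrow> 'a \<Rightarrow> 'a"
  lzero :: "'a"
  lscale :: "real \<Rightarrow> 'a \<Rightarrow> 'a"
  lbracket :: "'a \<Rightarrow> 'a \<Rightarrow> 'a"

locale real_lie_algebra =
  fixes L :: "'a lie_struct"
  assumes zero_closed: "lzero L \<in> lcarrier L"
    and add_closed: "\<lbrakk>x \<in> lcarrier L; y \<in> lcarrier L\<rbrakk> \<Longrightarrow> ladd L x y \<in> lcarrier L"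
    and scale_closed: "x \<in> lcarrier L \<Longrightarrow> lscale L r x \<in> lcarrier L"
    and bracket_closed: "\<lbrakk>x \<in> lcarrier L; y \<in> lcarrier L\<rbrakk> \<Longrightarrow> lbracket L x y \<in> lcarrier L"
    and add_assoc: "\<lbrakk>x \<in> lcarrier L; y \<in> lcarrier L; z \<in> lcarrier L\<rbrakk>
      \<Longrightarrow> ladd L (ladd L x y) z = ladd L x (ladd L y z)"
    and add_comm: "\<lbrakk>x \<in> lcarrier L; y \<in> lcarrier L\<rbrakk> \<Longrightarrow> ladd L x y = ladd L y x"
    and add_zero: "x \<in> lcarrier L \<Longrightarrow> ladd L (lzero L) x = x"
    and add_inverse: "x \<in> lcarrier L \<Longrightarrow> \<exists>y\<in>lcarrier L. ladd L y x = lzero L"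
    and scale_add: "\<lbrakk>x \<in> lcarrier L; y \<in> lcarrier L\<rbrakk>
      \<Longrightarrow> lscale L r (ladd L x y) = ladd L (lscale L r x) (lscale L r y)"
    and add_scale: "x \<in> lcarrier L \<Longrightarrow> lscale L (r + s) x = ladd L (lscale L r x) (lscale L s x)"
    and scale_scale: "x \<in> lcarrier L \<Longrightarrow> lscale L r (lscale L s x) = lscale L (r * s) x"
    and scale_one: "x \<in> lcarrier L \<Longrightarrow> lscale L 1 x = x"
    and bracket_add_left: "\<lbrakk>x \<in> lcarrier L; y \<in> lcarrier L; z \<in> lcarrier L\<rbrakk>
      \<Longrightarrow> lbracket L (ladd L x y) z = ladd L (lbracket L x z) (lbracket L y z)"
    and bracket_add_right: "\<lbrakk>x \<in> lcarrier L; y \<in> lcarrier L; z \<in> lcarrier L\<rbrakk>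
      \<Longrightarrow> lbracket L z (ladd L x y) = ladd L (lbracket L z x) (lbracket L z y)"
    and bracket_scale_left: "\<lbrakk>x \<in> lcarrier L; y \<in> lcarrier L\<rbrakk>
      \<Longrightarrow> lbracket L (lscale L r x) y = lscale L r (lbracket L x y)"
    and bracket_scale_right: "\<lbrakk>x \<in> lcarrier L; y \<in> lcarrier L\<rbrakk>
      \<Longrightarrow> lbracket L x (lscale L r y) = lscale L r (lbracket L x y)"
    and bracket_self: "x \<in> lcarrier L \<Longrightarrow> lbracket L x x = lzero L"
    and jacobi: "\<lbrakk>x \<in> lcarrier L; y \<in> lcarrier L; z \<in> lcarrier L\<rbrakk>
      \<Longrightarrow> ladd L (ladd L (lbracket L x (lbracket L y z)) (lbracket L y (lbracket L z x)))
            (lbracket L z (lbracket L x y)) = lzero L"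

definition lie_iso :: "'a lie_struct \<Rightarrow> 'b lie_struct \<Rightarrow> ('a \<Rightarrow> 'b) \<Rightarrow> bool" where
  "lie_iso L M f \<longleftrightarrow> bij_betw f (lcarrier L) (lcarrier M)
     \<and> (\<forall>x\<in>lcarrier L. \<forall>y\<in>lcarrier L. f (ladd L x y) = ladd M (f x) (f y))
     \<and> (\<forall>r. \<forall>x\<in>lcarrier L. f (lscale L r x) = lscale M r (f x))
     \<and> (\<forall>x\<in>lcarrier L. \<forall>y\<in>lcarrier L. f (lbracket L x y) = lbracket M (f x) (f y))"

definition lie_isomorphic :: "'a lie_struct \<Rightarrow> 'b lie_struct \<Rightarrow> bool" (infix "\<cong>" 50) where
  "L \<cong> M \<longleftrightarrow> real_lie_algebra L \<and> real_lie_algebra M \<and> (\<exists>f. lie_iso L M f)"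

definition lie_on :: "'a::real_vector set \<Rightarrow> ('a \<Rightarrow> 'a \<Rightarrow> 'a) \<Rightarrow> 'a lie_struct" where
  "lie_on S br = \<lparr>lcarrier = S, ladd = (+), lzero = 0, lscale = scaleR, lbracket = br\<rparr>"

definition lie_centre :: "'a lie_struct \<Rightarrow> 'a set" where
  "lie_centre L = {x \<in> lcarrier L. \<forall>y\<in>lcarrier L. lbracket L x y = lzero L}"

text \<open>The quotient by an ideal \<open>I\<close>; its elements are the cosets of \<open>I\<close>.\<close>

definition lie_coset :: "'a lie_struct \<Rightarrow> 'a set \<Rightarrow> 'a \<Rightarrow> 'a set" where
  "lie_coset L I x = {ladd L x i | i. i \<in> I}"

definition lie_quotient :: "'a lie_struct \<Rightarrow> 'a set \<Rightarrow> 'a set lie_struct" where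
  "lie_quotient L I =
     \<lparr>lcarrier = lie_coset L I ` lcarrier L,
      ladd = (\<lambda>X Y. \<Union>x\<in>X. \<Union>y\<in>Y. lie_coset L I (ladd L x y)),
      lzero = lie_coset L I (lzero L),
      lscale = (\<lambda>r X. \<Union>x\<in>X. lie_coset L I (lscale L r x)),
      lbracket = (\<lambda>X Y. \<Union>x\<in>X. \<Union>y\<in>Y. lie_coset L I (lbracket L x y))\<rparr>"

section \<open>Derivation, structure and conformal algebras\<close>

definition Der :: "'j::real_nonassoc_algebra itself \<Rightarrow> ('j \<Rightarrow> 'j) lie_struct" where
  "Der J = lie_on derivations commutator"

definition structure_maps :: "('j::real_nonassoc_algebra \<Rightarrow> 'j) set" where
  "structure_maps = {D + lmul a | D a. D \<in> derivations}"

definition Str :: "'j::real_nonassoc_algebra itself \<Rightarrow> ('j \<Rightarrow> 'j) lie_struct" where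
  "Str J = lie_on structure_maps commutator"

definition Str' :: "'j::real_nonassoc_algebra itself \<Rightarrow> ('j \<Rightarrow> 'j) set lie_struct" where
  "Str' J = lie_quotient (Str J) (lie_centre (Str J))"

definition str_involution :: "('j::real_nonassoc_algebra \<Rightarrow> 'j) \<Rightarrow> 'j \<Rightarrow> 'j" where
  "str_involution T = (THE S. \<exists>D\<in>derivations. \<exists>a. T = D + lmul a \<and> S = D - lmul a)"

definition con_pairing :: "'j::real_nonassoc_algebra \<Rightarrow> 'j \<Rightarrow> 'j \<Rightarrow> 'j" where
  "con_pairing X Y = 2 *\<^sub>R lmul (X * Y) + 2 *\<^sub>R commutator (lmul X) (lmul Y)"

definition con_bracket :: "('j::real_nonassoc_algebra \<Rightarrow> 'j) \<times> 'j \<times> 'j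
    \<Rightarrow> ('j \<Rightarrow> 'j) \<times> 'j \<times> 'j \<Rightarrow> ('j \<Rightarrow> 'j) \<times> 'j \<times> 'j" where
  "con_bracket = (\<lambda>(S, X, Y) (T, Z, W).
     (commutator S T + con_pairing X W - con_pairing Z Y,
      S Z - T X,
      str_involution S W - str_involution T Y))"

definition Con :: "'j::real_nonassoc_algebra itself \<Rightarrow> (('j \<Rightarrow> 'j) \<times> 'j \<times> 'j) lie_struct" where
  "Con J = lie_on (structure_maps \<times> UNIV \<times> UNIV) con_bracket"

section \<open>The algebra \<open>L3\<close>\<close>

text \<open>
  The three components of an element of \<open>L3\<close> are its parts in the derivations of the hermitian
  matrices, in the tensor product, and in the derivations of the second composition algebra.
  The tensor product of the subspaces of traceless matrices and of imaginary elements is taken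
  inside the tensor product of the ambient spaces; over a field this inclusion is injective.
  All the maps extended below by
  \<open>tensor_lift\<close> are bilinear on the ambient spaces.
\<close>

type_synonym ('a, 'b) L3_space =
  "('a herm3 \<Rightarrow> 'a herm3) \<times> ('a herm3, 'b) tensor \<times> ('b \<Rightarrow> 'b)"

definition L3_tensors :: "('a::composition_algebra herm3, 'b::composition_algebra) tensor set" where
  "L3_tensors = span {A \<otimes> x | A x. A \<in> herm_traceless \<and> x \<in> imag_part}"

definition L3_pure_bracket :: "'a::composition_algebra herm3 \<Rightarrow> 'b::composition_algebra
    \<Rightarrow> 'a herm3 \<Rightarrow> 'b \<Rightarrow> ('a, 'b) L3_space" where
  "L3_pure_bracket A x B y =
     (- (alg_ip x y *\<^sub>R commutator (lmul A) (lmul B)),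
      herm_star A B \<otimes> ((1/2) *\<^sub>R (x * y - y * x)),
      (1/6 * herm_ip A B) *\<^sub>R inner_der x y)"

definition L3_tensor_bracket :: "('a::composition_algebra herm3, 'b::composition_algebra) tensor
    \<Rightarrow> ('a herm3, 'b) tensor \<Rightarrow> ('a, 'b) L3_space" where
  "L3_tensor_bracket s t =
     tensor_lift (\<lambda>A x. tensor_lift (\<lambda>B y. L3_pure_bracket A x B y) t) s"

definition L3_action :: "('a::composition_algebra herm3 \<Rightarrow> 'a herm3)
    \<Rightarrow> ('b::composition_algebra \<Rightarrow> 'b) \<Rightarrow> ('a herm3, 'b) tensor \<Rightarrow> ('a herm3, 'b) tensor" where
  "L3_action D E = tensor_lift (\<lambda>A x. D A \<otimes> x + A \<otimes> E x)"

definition L3_bracket ::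
    "('a::composition_algebra, 'b::composition_algebra) L3_space \<Rightarrow> ('a, 'b) L3_space
      \<Rightarrow> ('a, 'b) L3_space" where
  "L3_bracket = (\<lambda>(D, s, E) (D', t, E').
     (commutator D D', L3_action D E t - L3_action D' E' s, commutator E E')
     + L3_tensor_bracket s t)"

definition L3 :: "'a::composition_algebra itself \<Rightarrow> 'b::composition_algebra itself
    \<Rightarrow> ('a, 'b) L3_space lie_struct" where
  "L3 K1 K2 = lie_on (derivations \<times> L3_tensors \<times> derivations) L3_bracket"

end

theory Submission
  imports Defs
begin

text \<open>
  Let \<open>J = H\<^sub>3(K)\<close>, with any composition algebra \<open>K\<close>. When the second algebra is real, the last two
  summands of \<open>L3\<close> vanish. For the split complex numbers with unit \<open>u\<close>, \<open>u\<^sup>2 = 1\<close>, the map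
  \<open>D + A \<otimes> u \<mapsto> D + L\<^sub>A\<close> is a homomorphism onto a complement of the centre of \<open>Str J\<close>, which consists of
  the \<open>L\<^sub>A\<close> with \<open>A\<close> scalar. For the split quaternions all derivations are inner, and reading \<open>ad u\<close> as
  \<open>I \<otimes> u\<close> identifies \<open>L3\<close> with \<open>Der J + J \<otimes> sl\<^sub>2\<close>, which is the Tits-Kantor-Koecher construction of
  \<open>Con J\<close>. The Jacobi identities are transported from \<open>Der J\<close>, \<open>Str J\<close> and \<open>Con J\<close>, where they follow
  from the Jordan identity. The latter is derived from the adjoint identity
  \<open>A\<^sup>#\<^sup># = N(A) A\<close> of the cubic norm, used in its linearized form \<open>sharp_cross\<close>.
\<close>

section \<open>Lie algebras\<close>

text \<open>The constants of the bracket encode the trace. Write A . B for the Jordan product. As I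
  . A = 2A, the action of ad u, which sends A (x) v to A (x) [u, v], equals (I . A) (x) [u, v]/2,
  the rule to be expected of I (x) u. In an associative second algebra D_{x,y} = ad [x, y], so <A,
  B> D_{x,y} / 6 stands for (<A, B>/3) I (x) [x, y]/2, exactly the multiple of I that A * B
  subtracts from A . B. Over the split quaternions the bracket therefore becomes A . B (x) [x, y]/2
  - <x, y> [L_A, L_B] for matrices of any trace. Transport along an injective map requires closure
  and compatibility with single brackets only, never a nested bracket in L3. Closure is not free:
  every derivation of H_3(K) must take traceless values, which is shown with idempotents. For
  octonion entries the Jordan identity cannot be inherited from an associative algebra; the Moufang
  identity for the entries takes its place.\<close>

lemma lie_on_simps [simp]:
  "lcarrier (lie_on S br) = S" "ladd (lie_on S br) = (+)" "lzero (lie_on S br) = 0"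
  "lscale (lie_on S br) = scaleR" "lbracket (lie_on S br) = br"
  by (simp_all add: lie_on_def)

lemma real_lie_algebra_lie_onI:
  fixes br :: "'a::real_vector \<Rightarrow> 'a \<Rightarrow> 'a"
  assumes S: "subspace S"
    and closed: "\<And>x y. x \<in> S \<Longrightarrow> y \<in> S \<Longrightarrow> br x y \<in> S"
    and anti: "\<And>x y. x \<in> S \<Longrightarrow> y \<in> S \<Longrightarrow> br x y = - br y x"
    and add: "\<And>x y z. x \<in> S \<Longrightarrow> y \<in> S \<Longrightarrow> z \<in> S \<Longrightarrow> br (x + y) z = br x z + br y z"
    and scale: "\<And>r x y. x \<in> S \<Longrightarrow> y \<in> S \<Longrightarrow> br (r *\<^sub>R x) y = r *\<^sub>R br x y"
    and jac: "\<And>x y z. x \<in> S \<Longrightarrow> y \<in> S \<Longrightarrow> z \<in> S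
      \<Longrightarrow> br x (br y z) + br y (br z x) + br z (br x y) = 0"
  shows "real_lie_algebra (lie_on S br)"
proof (unfold_locales, simp_all add: closed jac add scale)
  show "0 \<in> S" by (rule subspace_0[OF S])
  fix x y z assume xyz: "x \<in> S" "y \<in> S"
  show "x + y \<in> S" using xyz by (rule subspace_add[OF S])
  show "br x (r *\<^sub>R y) = r *\<^sub>R br x y" for r
    using anti[of x "r *\<^sub>R y"] anti[of x y] scale[of y x r] xyz
    by (simp add: subspace_scale[OF S])
  assume z: "z \<in> S"
  show "br z (x + y) = br z x + br z y"
    using anti[of z "x + y"] anti[of z x] anti[of z y] add[of x y z] xyz z
    by (simp add: subspace_add[OF S])
next
  fix x assume x: "x \<in> S"
  show "r *\<^sub>R x \<in> S" for r using x by (rule subspace_scale[OF S])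
  show "\<exists>y\<in>S. y + x = 0" using x subspace_neg[OF S] by (intro bexI[of _ "- x"]) auto
  show "br x x = 0"
  proof -
    have "br x x + br x x = 0" using anti[OF x x] by (metis add.left_inverse)
    then have "2 *\<^sub>R br x x = 0" by (simp only: scaleR_2)
    then show ?thesis by simp
  qed
qed (simp_all add: algebra_simps)

text \<open>Each axiom is an equation between elements of \<open>S\<close>, so injectivity of
  \<open>f\<close> reduces it to the same axiom in \<open>T\<close>. The map need not be onto: over
  the split complex numbers the image is a proper subspace of \<open>Str\<close>.\<close>

lemma real_lie_algebra_inj:
  assumes M: "real_lie_algebra (lie_on T br')"
    and S: "subspace S"
    and closed: "\<And>x y. x \<in> S \<Longrightarrow> y \<in> S \<Longrightarrow> br x y \<in> S"
    and inj: "inj_on f S" and fST: "f ` S \<subseteq> T"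
    and add: "\<And>x y. x \<in> S \<Longrightarrow> y \<in> S \<Longrightarrow> f (x + y) = f x + f y"
    and scale: "\<And>r x. x \<in> S \<Longrightarrow> f (r *\<^sub>R x) = r *\<^sub>R f x"
    and br: "\<And>x y. x \<in> S \<Longrightarrow> y \<in> S \<Longrightarrow> f (br x y) = br' (f x) (f y)"
  shows "real_lie_algebra (lie_on S br)"
proof -
  interpret M: real_lie_algebra "lie_on T br'" by (rule M)
  have fT: "f x \<in> T" if "x \<in> S" for x using fST that by blast
  have neg: "- x \<in> S" if "x \<in> S" for x using subspace_neg[OF S that] .
  have fneg: "f (- x) = - f x" if "x \<in> S" for x using scale[of x "- 1"] that by simp
  have f0: "f 0 = 0" using scale[of 0 0] subspace_0[OF S] by simp
  note cl = closed neg subspace_add[OF S] subspace_scale[OF S] subspace_0[OF S]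
  have Manti: "br' x y = - br' y x" if "x \<in> T" "y \<in> T" for x y
  proof -
    have "x + y \<in> T" using M.add_closed[of x y] that by simp
    then have "br' (x + y) (x + y) = 0" using M.bracket_self by simp
    then have "br' x y + br' y x = 0"
      using M.bracket_add_left[of x y "x + y"] M.bracket_add_right[of x y x]
        M.bracket_add_right[of x y y] M.bracket_self[of x] M.bracket_self[of y] that \<open>x + y \<in> T\<close>
      by simp
    then show ?thesis by (simp add: eq_neg_iff_add_eq_0)
  qed
  show ?thesis
  proof (rule real_lie_algebra_lie_onI[OF S closed])
    fix x y assume xy: "x \<in> S" "y \<in> S"
    show "br x y = - br y x"
      by (rule inj_onD[OF inj]) (use xy Manti[of "f x" "f y"] in \<open>simp_all add: cl fneg br fT\<close>)
    show "br (r *\<^sub>R x) y = r *\<^sub>R br x y" for r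
      by (rule inj_onD[OF inj])
        (use xy M.bracket_scale_left[of "f x" "f y" r] in \<open>simp_all add: cl br scale fT\<close>)
    fix z assume z: "z \<in> S"
    show "br (x + y) z = br x z + br y z"
      by (rule inj_onD[OF inj])
        (use xy z M.bracket_add_left[of "f x" "f y" "f z"] in \<open>simp_all add: cl br add fT\<close>)
    show "br x (br y z) + br y (br z x) + br z (br x y) = 0"
      by (rule inj_onD[OF inj])
        (use xy z M.jacobi[of "f x" "f y" "f z"] in \<open>simp_all add: cl br add fT f0\<close>)
  qed
qed

lemma lie_isomorphic_lie_onI:
  assumes M: "real_lie_algebra (lie_on T br')"
    and S: "subspace S"
    and closed: "\<And>x y. x \<in> S \<Longrightarrow> y \<in> S \<Longrightarrow> br x y \<in> S"
    and bij: "bij_betw f S T"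
    and add: "\<And>x y. x \<in> S \<Longrightarrow> y \<in> S \<Longrightarrow> f (x + y) = f x + f y"
    and scale: "\<And>r x. x \<in> S \<Longrightarrow> f (r *\<^sub>R x) = r *\<^sub>R f x"
    and br: "\<And>x y. x \<in> S \<Longrightarrow> y \<in> S \<Longrightarrow> f (br x y) = br' (f x) (f y)"
  shows "lie_on S br \<cong> lie_on T br'"
proof -
  have "real_lie_algebra (lie_on S br)"
    using bij by (intro real_lie_algebra_inj[OF M S closed, where f = f])
      (auto simp: bij_betw_def add scale br)
  moreover have "lie_iso (lie_on S br) (lie_on T br') f"
    using bij by (simp add: lie_iso_def add scale br)
  ultimately show ?thesis using M unfolding lie_isomorphic_def by blast
qed

lemma UN_eqI: "(\<And>x. x \<in> X \<Longrightarrow> F x = C) \<Longrightarrow> a \<in> X \<Longrightarrow> (\<Union>x\<in>X. F x) = C"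
  by blast

text \<open>The operations of \<open>lie_quotient\<close> are unions over all representatives. Such
  a union collapses to one coset once the result is independent of the representatives and the
  cosets are nonempty.\<close>

lemma UN_UN_eqI:
  assumes "\<And>x y. x \<in> X \<Longrightarrow> y \<in> Y \<Longrightarrow> F x y = C" "a \<in> X" "b \<in> Y"
  shows "(\<Union>x\<in>X. \<Union>y\<in>Y. F x y) = C"
  by (rule UN_eqI[OF UN_eqI[OF assms(1) assms(3)] assms(2)])

section \<open>Quotients by an ideal, with cosets as elements\<close>

locale lie_ideal =
  fixes S I :: "'a::real_vector set" and br :: "'a \<Rightarrow> 'a \<Rightarrow> 'a"
  assumes lie: "real_lie_algebra (lie_on S br)"
    and I: "subspace I" and IS: "I \<subseteq> S"
    and ideal_right: "\<And>x i. x \<in> S \<Longrightarrow> i \<in> I \<Longrightarrow> br x i \<in> I"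
    and ideal_left: "\<And>x i. x \<in> S \<Longrightarrow> i \<in> I \<Longrightarrow> br i x \<in> I"
begin

abbreviation "proj \<equiv> lie_coset (lie_on S br) I"
abbreviation "Q \<equiv> lie_quotient (lie_on S br) I"

sublocale real_lie_algebra "lie_on S br" by (rule lie)

lemma mem_proj: "x' \<in> proj x \<longleftrightarrow> x' - x \<in> I"
  by (auto simp: lie_coset_def) (metis add.commute diff_add_cancel)

lemma proj_eq_iff: "proj x = proj y \<longleftrightarrow> x - y \<in> I"
proof
  assume "proj x = proj y"
  moreover have "x \<in> proj x" by (simp add: mem_proj subspace_0[OF I])
  ultimately show "x - y \<in> I" by (metis mem_proj)
next
  assume xy: "x - y \<in> I"
  have "z \<in> proj x \<longleftrightarrow> z \<in> proj y" for z
    using subspace_add[OF I xy, of "z - x"] subspace_diff[OF I _ xy, of "z - y"]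
    by (auto simp: mem_proj)
  then show "proj x = proj y" by blast
qed

lemma rep_mem: "x \<in> S \<Longrightarrow> x' \<in> proj x \<Longrightarrow> x' \<in> S"
  using add_closed[of x "x' - x"] IS by (auto simp: mem_proj)

lemma proj_self: "x \<in> proj x"
  by (simp add: mem_proj subspace_0[OF I])

lemma proj_add:
  assumes "x \<in> S" "y \<in> S"
  shows "ladd Q (proj x) (proj y) = proj (x + y)"
proof -
  have "proj (x' + y') = proj (x + y)" if "x' \<in> proj x" "y' \<in> proj y" for x' y'
    using subspace_add[OF I, of "x' - x" "y' - y"] that
    by (simp add: proj_eq_iff mem_proj add_diff_add)
  from UN_UN_eqI[OF this proj_self proj_self] show ?thesis
    by (simp add: lie_quotient_def)
qed

lemma proj_scale:
  assumes "x \<in> S"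
  shows "lscale Q r (proj x) = proj (r *\<^sub>R x)"
proof -
  have "proj (r *\<^sub>R x') = proj (r *\<^sub>R x)" if "x' \<in> proj x" for x'
    using subspace_scale[OF I, of "x' - x" r] that
    by (simp add: proj_eq_iff mem_proj scaleR_diff_right)
  from UN_eqI[OF this proj_self] show ?thesis
    by (simp add: lie_quotient_def)
qed

lemma proj_bracket:
  assumes x: "x \<in> S" and y: "y \<in> S"
  shows "lbracket Q (proj x) (proj y) = proj (br x y)"
proof -
  have "proj (br x' y') = proj (br x y)" if x': "x' \<in> proj x" and y': "y' \<in> proj y" for x' y'
  proof -
    have i: "x' - x \<in> I" and j: "y' - y \<in> I" using x' y' by (simp_all add: mem_proj)
    have y'S: "y' \<in> S" using rep_mem[OF y y'] .
    have "br x' y' = br (x' - x) y' + br x y'"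
      using bracket_add_left[of "x' - x" x y'] i IS x y'S by auto
    also have "br x y' = br x (y' - y) + br x y"
      using bracket_add_right[of "y' - y" y x] j IS x y by auto
    finally have "br x' y' - br x y = br (x' - x) y' + br x (y' - y)" by simp
    also have "\<dots> \<in> I"
      by (intro subspace_add[OF I] ideal_left ideal_right i j y'S x)
    finally show ?thesis by (simp add: proj_eq_iff)
  qed
  from UN_UN_eqI[OF this proj_self proj_self] show ?thesis
    by (simp add: lie_quotient_def)
qed

text \<open>Every element is \<open>proj x\<close> with \<open>x\<close> in \<open>S\<close>;
  choosing such representatives turns each axiom into the image under \<open>proj\<close> of the
  axiom in \<open>S\<close>.\<close>

lemma real_lie_algebra_quotient: "real_lie_algebra Q"
proof -
  have car: "lcarrier Q = proj ` S" and zero: "lzero Q = proj 0"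
    by (simp_all add: lie_quotient_def)
  have [simp]: "0 \<in> S" "\<And>x y. x \<in> S \<Longrightarrow> y \<in> S \<Longrightarrow> x + y \<in> S" "\<And>r x. x \<in> S \<Longrightarrow> r *\<^sub>R x \<in> S"
    "\<And>x y. x \<in> S \<Longrightarrow> y \<in> S \<Longrightarrow> br x y \<in> S"
    using zero_closed add_closed scale_closed bracket_closed by simp_all
  have neg: "- x \<in> S" if "x \<in> S" for x using scale_closed[of x "- 1"] that by simp
  note [simp] = proj_add proj_scale proj_bracket
  show ?thesis
  proof (unfold_locales; unfold car zero; (elim imageE)?; hypsubst?)
    fix x assume "x \<in> S"
    then show "\<exists>y\<in>proj ` S. ladd Q y (proj x) = proj 0"
      by (intro bexI[of _ "proj (- x)"]) (auto simp: neg)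
  qed (use add_comm bracket_add_left bracket_add_right bracket_scale_left bracket_scale_right
        bracket_self jacobi in \<open>simp_all add: algebra_simps\<close>)
qed

end

section \<open>Derivations\<close>

lemma commutator_apply: "commutator S T x = S (T x) - T (S x)"
  by (simp add: commutator_def)

lemma scaleR_fun_apply: "(r *\<^sub>R f) x = r *\<^sub>R f x"
  by (simp add: scaleR_fun_def)

lemmas fun_simps = fun_eq_iff scaleR_fun_apply plus_fun_apply minus_apply uminus_apply
  zero_fun_apply

lemma linear_lmul: "linear (lmul (a::'a::real_nonassoc_algebra))"
  by (rule linearI) (simp_all add: lmul_def alg_bilinear_simps)

lemma lmul_add: "lmul (a + b) = lmul a + lmul (b::'a::real_nonassoc_algebra)"
  by (simp add: lmul_def fun_simps alg_bilinear_simps)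

lemma lmul_scale: "lmul (r *\<^sub>R a) = r *\<^sub>R lmul (a::'a::real_nonassoc_algebra)"
  by (simp add: lmul_def fun_simps alg_bilinear_simps)

lemma lmul_diff: "lmul (a - b) = lmul a - lmul (b::'a::real_nonassoc_algebra)"
  by (simp add: lmul_def fun_simps alg_bilinear_simps)

lemma lmul_zero: "lmul (0::'a::real_nonassoc_algebra) = 0"
  by (simp add: lmul_def fun_simps alg_bilinear_simps)

lemma lmul_apply: "lmul a b = a * b"
  by (simp add: lmul_def)

lemma derivation_linear: "D \<in> derivations \<Longrightarrow> linear D"
  by (simp add: derivations_def)

lemma derivation_mult: "D \<in> derivations \<Longrightarrow> D (x * y) = D x * y + x * D y"
  by (simp add: derivations_def)

lemma linear_commutator: "linear S \<Longrightarrow> linear T \<Longrightarrow> linear (commutator S T)"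
  by (rule linearI) (simp_all add: commutator_apply linear_add linear_scale algebra_simps)

lemma linear_plus_fun: "linear S \<Longrightarrow> linear T \<Longrightarrow> linear (S + T)"
  by (rule linearI) (simp_all add: linear_add linear_scale algebra_simps)

lemma linear_scaleR_fun: "linear S \<Longrightarrow> linear (r *\<^sub>R S)"
  by (rule linearI) (simp_all add: scaleR_fun_apply linear_add linear_scale algebra_simps)

lemma derivations_commutator:
  "D \<in> derivations \<Longrightarrow> E \<in> derivations \<Longrightarrow> commutator D E \<in> derivations"
  by (auto simp: derivations_def linear_commutator)
    (auto simp: commutator_apply linear_add alg_bilinear_simps algebra_simps)

lemma subspace_derivations: "subspace derivations"
proof (rule subspaceI)
  show "0 \<in> (derivations :: ('a \<Rightarrow> 'a) set)"
    by (auto simp: derivations_def linear_iff alg_bilinear_simps)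
  fix D E :: "'a \<Rightarrow> 'a" and r assume "D \<in> derivations" "E \<in> derivations"
  then show "D + E \<in> derivations" "r *\<^sub>R D \<in> derivations"
    by (simp_all add: derivations_def linear_plus_fun linear_scaleR_fun)
      (simp_all add: alg_bilinear_simps scaleR_fun_apply algebra_simps)
qed

lemma commutator_anti: "commutator S T = - commutator T S"
  by (simp add: fun_simps commutator_apply)

lemma commutator_add_left: "linear T \<Longrightarrow> commutator (R + S) T = commutator R T + commutator S T"
  by (simp add: fun_simps commutator_apply linear_add algebra_simps)

lemma commutator_scale_left: "linear T \<Longrightarrow> commutator (r *\<^sub>R S) T = r *\<^sub>R commutator S T"
  by (simp add: fun_simps commutator_apply linear_scale algebra_simps)

lemma commutator_add_right: "linear T \<Longrightarrow> commutator T (R + S) = commutator T R + commutator T S"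
  by (simp add: fun_simps commutator_apply linear_add algebra_simps)

lemma commutator_jacobi:
  assumes "linear R" "linear S" "linear T"
  shows "commutator R (commutator S T) + commutator S (commutator T R)
    + commutator T (commutator R S) = 0"
  using assms by (simp add: fun_simps commutator_apply linear_diff algebra_simps)

lemma real_lie_algebra_commutator:
  assumes "subspace S" "\<And>T. T \<in> S \<Longrightarrow> linear T"
    and "\<And>T U. T \<in> S \<Longrightarrow> U \<in> S \<Longrightarrow> commutator T U \<in> S"
  shows "real_lie_algebra (lie_on S commutator)"
  by (rule real_lie_algebra_lie_onI)
    (auto simp: assms commutator_add_left commutator_scale_left commutator_jacobi
      intro: commutator_anti)

lemma real_lie_algebra_Der: "real_lie_algebra (Der TYPE('j::real_nonassoc_algebra))"
  unfolding Der_def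
  by (rule real_lie_algebra_commutator)
    (auto simp: subspace_derivations derivation_linear derivations_commutator)

section \<open>Unital Jordan algebras\<close>

text \<open>The unit is only asserted to exist: for the product AB + BA it is half of the identity
  matrix, so \<open>herm_id\<close> itself acts as multiplication by 2.\<close>

class unital_jordan_algebra = real_nonassoc_algebra +
  assumes jordan_comm: "x * y = y * x"
    and jordan_identity: "(x * y) * (x * x) = x * (y * (x * x))"
    and jordan_unit: "\<exists>e. \<forall>x. e * x = x"

section \<open>The polarized Jordan identity and inner derivations\<close>

definition lmul_comm :: "'a::real_nonassoc_algebra \<Rightarrow> 'a \<Rightarrow> 'a \<Rightarrow> 'a" where
  "lmul_comm x y z = x * (y * z) - y * (x * z)"

lemma commutator_lmul: "commutator (lmul x) (lmul y) z = lmul_comm x y z"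
  by (simp add: commutator_apply lmul_def lmul_comm_def)

lemma lmul_comm_add:
  "lmul_comm (x + y) z w = lmul_comm x z w + lmul_comm y z w"
  "lmul_comm z (x + y) w = lmul_comm z x w + lmul_comm z y w"
  by (simp_all add: lmul_comm_def alg_bilinear_simps algebra_simps)

lemma lmul_comm_diff:
  "lmul_comm (x - y) z w = lmul_comm x z w - lmul_comm y z w"
  "lmul_comm z (x - y) w = lmul_comm z x w - lmul_comm z y w"
  by (simp_all add: lmul_comm_def alg_bilinear_simps algebra_simps)

text \<open>The Jordan identity says that L_a commutes with L_{aa}. Adding its instances at a + b
  and a - b isolates the part quadratic in b; polarizing that part in b gives the trilinear
  form.\<close>

lemma jordan_polarized:
  fixes a b c d :: "'a::unital_jordan_algebra"
  shows "lmul_comm a (b * c) d + lmul_comm b (c * a) d + lmul_comm c (a * b) d = 0"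
proof -
  have cube: "lmul_comm a (a * a) d = 0" for a :: 'a
    using jordan_identity[of a d] by (simp add: lmul_comm_def jordan_comm)
  have quad: "lmul_comm a (b * b) d + 2 *\<^sub>R lmul_comm b (a * b) d = 0" for a b :: 'a
  proof -
    have "lmul_comm (a + b) ((a + b) * (a + b)) d + lmul_comm (a - b) ((a - b) * (a - b)) d
      = 2 *\<^sub>R (lmul_comm a (b * b) d + 2 *\<^sub>R lmul_comm b (a * b) d) + 2 *\<^sub>R lmul_comm a (a * a) d"
      by (simp add: alg_bilinear_simps lmul_comm_add lmul_comm_diff scaleR_2 jordan_comm[of b a]
          scaleR_add_right)
    then show ?thesis by (simp add: cube)
  qed
  have "2 *\<^sub>R (lmul_comm a (b * c) d + lmul_comm b (c * a) d + lmul_comm c (a * b) d)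
    = (lmul_comm a ((b + c) * (b + c)) d + 2 *\<^sub>R lmul_comm (b + c) (a * (b + c)) d)
      - (lmul_comm a (b * b) d + 2 *\<^sub>R lmul_comm b (a * b) d)
      - (lmul_comm a (c * c) d + 2 *\<^sub>R lmul_comm c (a * c) d)"
    by (simp add: alg_bilinear_simps lmul_comm_add scaleR_2 jordan_comm[of c b] jordan_comm[of c a]
        scaleR_add_right)
  then show ?thesis by (simp add: quad)
qed

text \<open>The defect of the Leibniz rule is the polarized identity for a, x, y evaluated at b
  minus the one for b, x, y evaluated at a.\<close>

lemma lmul_comm_derivation:
  fixes a b :: "'a::unital_jordan_algebra"
  shows "lmul_comm a b (x * y) = lmul_comm a b x * y + x * lmul_comm a b y"
proof -
  have "lmul_comm a b (x * y) - (lmul_comm a b x * y + x * lmul_comm a b y)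
    = (lmul_comm a (x * y) b + lmul_comm x (y * a) b + lmul_comm y (a * x) b)
      - (lmul_comm b (x * y) a + lmul_comm x (y * b) a + lmul_comm y (b * x) a)"
    by (simp add: lmul_comm_def alg_bilinear_simps jordan_comm)
  also have "\<dots> = 0"
    by (simp only: jordan_polarized diff_self)
  finally show ?thesis by simp
qed

lemma commutator_lmul_derivation:
  "commutator (lmul a) (lmul b) \<in> derivations" for a :: "'a::unital_jordan_algebra"
  by (simp add: derivations_def linear_commutator linear_lmul)
    (simp add: commutator_lmul lmul_comm_derivation)

lemma commutator_diff_right: "linear T \<Longrightarrow> commutator T (R - S) = commutator T R - commutator T S"
  by (simp add: fun_simps commutator_apply linear_diff algebra_simps)

lemma derivation_unit:
  assumes "D \<in> derivations" and e: "\<forall>x. e * x = (x::'a::unital_jordan_algebra)"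
  shows "D e = 0"
  using derivation_mult[OF assms(1), of e e] e jordan_comm[of "D e" e] by simp

section \<open>The structure algebra and its involution\<close>

lemma structure_mapsI: "D \<in> derivations \<Longrightarrow> D + lmul a \<in> structure_maps"
  by (auto simp: structure_maps_def)

text \<open>Evaluation at the unit kills the derivation and returns the multiplier. Hence the sum of
  Der J and L(J) is direct, which makes the description in \<open>str_involution\<close>
  meaningful.\<close>

lemma structure_map_eqD:
  fixes a b :: "'a::unital_jordan_algebra"
  assumes "D \<in> derivations" "E \<in> derivations" "D + lmul a = E + lmul b"
  shows "D = E" "a = b"
proof -
  obtain e :: 'a where e: "\<forall>x. e * x = x" using jordan_unit by blast
  have "(D + lmul a) e = a" "(E + lmul b) e = b"
    using derivation_unit[OF assms(1) e] derivation_unit[OF assms(2) e] e jordan_comm[of _ e]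
    by (simp_all add: lmul_def)
  with assms(3) show "a = b" by simp
  with assms(3) show "D = E" by simp
qed

lemma str_involution_eq:
  fixes a :: "'a::unital_jordan_algebra"
  assumes "D \<in> derivations"
  shows "str_involution (D + lmul a) = D - lmul a"
  unfolding str_involution_def
proof (rule the_equality)
  show "\<exists>D'\<in>derivations. \<exists>a'. D + lmul a = D' + lmul a' \<and> D - lmul a = D' - lmul a'"
    using assms by blast
  show "S = D - lmul a"
    if "\<exists>D'\<in>derivations. \<exists>a'. D + lmul a = D' + lmul a' \<and> S = D' - lmul a'" for S
    using that structure_map_eqD[OF assms] by blast
qed

lemma commutator_structure_map:
  fixes a b :: "'a::unital_jordan_algebra"
  assumes "D \<in> derivations" "E \<in> derivations"
  shows "commutator (D + lmul a) (E + lmul b)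
    = (commutator D E + commutator (lmul a) (lmul b)) + lmul (D b - E a)"
  using assms
  by (simp add: fun_simps commutator_apply lmul_def derivation_mult alg_bilinear_simps linear_add
      derivation_linear)

text \<open>The companion of \<open>commutator_structure_map\<close> on the image of the involution:
  [-L_a, -L_b] = [L_a, L_b], so only the sign of the multiplication part changes. The two together
  show that the involution is an automorphism.\<close>

lemma commutator_structure_map':
  fixes a b :: "'a::unital_jordan_algebra"
  assumes "D \<in> derivations" "E \<in> derivations"
  shows "commutator (D - lmul a) (E - lmul b)
    = (commutator D E + commutator (lmul a) (lmul b)) - lmul (D b - E a)"
  using assms
  by (simp add: fun_simps commutator_apply lmul_def derivation_mult alg_bilinear_simps linear_diff
      derivation_linear)

lemma structure_maps_linear: "T \<in> structure_maps \<Longrightarrow> linear T"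
  by (auto simp: structure_maps_def intro: linear_plus_fun derivation_linear linear_lmul)

lemma subspace_structure_maps: "subspace structure_maps"
proof (rule subspaceI)
  have "0 + lmul 0 \<in> (structure_maps :: ('a \<Rightarrow> 'a) set)"
    by (intro structure_mapsI subspace_0 subspace_derivations)
  then show "0 \<in> (structure_maps :: ('a \<Rightarrow> 'a) set)" by (simp add: lmul_zero)
  fix S T :: "'a \<Rightarrow> 'a" and r assume S: "S \<in> structure_maps" and T: "T \<in> structure_maps"
  obtain D a where D: "S = D + lmul a" "D \<in> derivations" using S by (auto simp: structure_maps_def)
  obtain E b where E: "T = E + lmul b" "E \<in> derivations" using T by (auto simp: structure_maps_def)
  have "(D + E) + lmul (a + b) \<in> structure_maps"
    by (rule structure_mapsI[OF subspace_add[OF subspace_derivations D(2) E(2)]])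
  moreover have "r *\<^sub>R D + lmul (r *\<^sub>R a) \<in> structure_maps"
    by (rule structure_mapsI[OF subspace_scale[OF subspace_derivations D(2)]])
  ultimately show "S + T \<in> structure_maps" "r *\<^sub>R S \<in> structure_maps"
    by (simp_all add: D(1) E(1) lmul_add lmul_scale scaleR_add_right add_ac)
qed

lemma structure_maps_commutator:
  fixes S :: "'a::unital_jordan_algebra \<Rightarrow> 'a"
  assumes "S \<in> structure_maps" "T \<in> structure_maps"
  shows "commutator S T \<in> structure_maps"
proof -
  obtain D a where D: "S = D + lmul a" "D \<in> derivations"
    using assms by (auto simp: structure_maps_def)
  obtain E b where E: "T = E + lmul b" "E \<in> derivations"
    using assms by (auto simp: structure_maps_def)
  show ?thesis
    unfolding D(1) E(1) commutator_structure_map[OF D(2) E(2)]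
    by (intro structure_mapsI subspace_add subspace_derivations derivations_commutator
        commutator_lmul_derivation D E)
qed

lemma real_lie_algebra_Str: "real_lie_algebra (Str TYPE('j::unital_jordan_algebra))"
  unfolding Str_def
  by (rule real_lie_algebra_commutator)
    (auto simp: subspace_structure_maps structure_maps_linear structure_maps_commutator)

lemma str_involution_mem:
  fixes S :: "'a::unital_jordan_algebra \<Rightarrow> 'a"
  assumes "S \<in> structure_maps"
  shows "str_involution S \<in> structure_maps"
proof -
  obtain D a where D: "S = D + lmul a" "D \<in> derivations"
    using assms by (auto simp: structure_maps_def)
  have "D + lmul (- a) \<in> structure_maps" using D by (intro structure_mapsI)
  moreover have "D + lmul (- a) = D - lmul a" by (simp add: fun_simps lmul_def alg_bilinear_simps)
  ultimately show ?thesis using D by (simp add: str_involution_eq)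
qed

lemma str_involution_add:
  fixes S :: "'a::unital_jordan_algebra \<Rightarrow> 'a"
  assumes "S \<in> structure_maps" "T \<in> structure_maps"
  shows "str_involution (S + T) = str_involution S + str_involution T"
proof -
  obtain D a where D: "S = D + lmul a" "D \<in> derivations"
    using assms by (auto simp: structure_maps_def)
  obtain E b where E: "T = E + lmul b" "E \<in> derivations"
    using assms by (auto simp: structure_maps_def)
  have "S + T = (D + E) + lmul (a + b)" by (simp add: D E lmul_add)
  then have "str_involution (S + T) = (D + E) - lmul (a + b)"
    using str_involution_eq[OF subspace_add[OF subspace_derivations D(2) E(2)]] by metis
  then show ?thesis using D E by (simp add: str_involution_eq lmul_add)
qed

lemma str_involution_scale:
  fixes S :: "'a::unital_jordan_algebra \<Rightarrow> 'a"
  assumes "S \<in> structure_maps"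
  shows "str_involution (r *\<^sub>R S) = r *\<^sub>R str_involution S"
proof -
  obtain D a where D: "S = D + lmul a" "D \<in> derivations"
    using assms by (auto simp: structure_maps_def)
  have "r *\<^sub>R S = r *\<^sub>R D + lmul (r *\<^sub>R a)" by (simp add: D lmul_scale scaleR_add_right)
  then have "str_involution (r *\<^sub>R S) = r *\<^sub>R D - lmul (r *\<^sub>R a)"
    using str_involution_eq[OF subspace_scale[OF subspace_derivations D(2)]] by metis
  then show ?thesis using D by (simp add: str_involution_eq lmul_scale scaleR_diff_right)
qed

lemma str_involution_minus:
  fixes S :: "'a::unital_jordan_algebra \<Rightarrow> 'a"
  assumes "S \<in> structure_maps"
  shows "str_involution (- S) = - str_involution S"
  using str_involution_scale[OF assms, of "- 1"] by simp

lemma str_involution_diff: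
  fixes S :: "'a::unital_jordan_algebra \<Rightarrow> 'a"
  assumes "S \<in> structure_maps" "T \<in> structure_maps"
  shows "str_involution (S - T) = str_involution S - str_involution T"
  using str_involution_add[OF assms(1) subspace_neg[OF subspace_structure_maps assms(2)]] assms(2)
  by (simp add: str_involution_minus)

lemma str_involution_commutator:
  fixes S :: "'a::unital_jordan_algebra \<Rightarrow> 'a"
  assumes "S \<in> structure_maps" "T \<in> structure_maps"
  shows "str_involution (commutator S T) = commutator (str_involution S) (str_involution T)"
proof -
  obtain D a where D: "S = D + lmul a" "D \<in> derivations"
    using assms by (auto simp: structure_maps_def)
  obtain E b where E: "T = E + lmul b" "E \<in> derivations"
    using assms by (auto simp: structure_maps_def)
  have "commutator D E + commutator (lmul a) (lmul b) \<in> derivations"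
    using D E by (simp add: subspace_add subspace_derivations derivations_commutator
        commutator_lmul_derivation)
  then show ?thesis
    using D E by (simp add: str_involution_eq commutator_structure_map commutator_structure_map')
qed

section \<open>The conformal algebra and its Jacobi identity\<close>

lemma con_pairing_eq:
  fixes x y :: "'a::unital_jordan_algebra"
  shows "con_pairing x y = 2 *\<^sub>R commutator (lmul x) (lmul y) + lmul (2 *\<^sub>R (x * y))"
  by (simp add: con_pairing_def lmul_scale)

lemma con_pairing_mem:
  fixes x y :: "'a::unital_jordan_algebra"
  shows "con_pairing x y \<in> structure_maps"
  unfolding con_pairing_eq
  by (intro structure_mapsI subspace_scale subspace_derivations commutator_lmul_derivation)

text \<open>The commutator part is antisymmetric in x and y and the multiplication part symmetric.
  Reversing the sign of the latter therefore amounts to exchanging x and y with a minus sign, which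
  is how the involution interchanges the two copies of J.\<close>

lemma str_involution_con_pairing:
  fixes x y :: "'a::unital_jordan_algebra"
  shows "str_involution (con_pairing x y) = - con_pairing y x"
proof -
  have "str_involution (con_pairing x y)
    = 2 *\<^sub>R commutator (lmul x) (lmul y) - lmul (2 *\<^sub>R (x * y))"
    unfolding con_pairing_eq
    by (intro str_involution_eq subspace_scale subspace_derivations commutator_lmul_derivation)
  then show ?thesis
    by (simp add: con_pairing_eq commutator_anti[of "lmul x"] jordan_comm)
qed

lemma con_pairing_apply:
  "con_pairing x y z = 2 *\<^sub>R ((x * y) * z + x * (y * z) - y * (x * z))"
  by (simp add: con_pairing_def scaleR_fun_apply commutator_apply lmul_def scaleR_add_right
      scaleR_diff_right)

text \<open>Up to a constant factor \<open>con_pairing x y z\<close> is the Jordan triple product,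
  which is symmetric in its outer arguments.\<close>

lemma con_pairing_sym:
  fixes x y :: "'a::unital_jordan_algebra"
  shows "con_pairing x y z = con_pairing z y x"
  by (simp add: con_pairing_apply jordan_comm)

lemma con_pairing_add:
  "con_pairing (x + y) z = con_pairing x z + con_pairing y z"
  "con_pairing z (x + y) = con_pairing z x + con_pairing z y"
  by (simp_all add: fun_simps con_pairing_apply alg_bilinear_simps algebra_simps)

lemma con_pairing_diff:
  "con_pairing (x - y) z = con_pairing x z - con_pairing y z"
  "con_pairing z (x - y) = con_pairing z x - con_pairing z y"
  by (simp_all add: fun_simps con_pairing_apply alg_bilinear_simps algebra_simps)

lemma con_pairing_scale:
  "con_pairing (r *\<^sub>R x) y = r *\<^sub>R con_pairing x y"
  "con_pairing x (r *\<^sub>R y) = r *\<^sub>R con_pairing x y"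
  by (simp_all add: fun_simps con_pairing_apply alg_bilinear_simps algebra_simps)

text \<open>Structure maps act on the triple product by a Leibniz rule, with the involution applied
  in the middle slot. For a derivation this is the ordinary Leibniz rule. For L_a, the derivation
  property of [L_x, L_y] leaves [L_a, L_{xy}] and the product of [L_x, L_y] a with z; the polarized
  identity rewrites the former.\<close>

lemma commutator_con_pairing:
  fixes x y :: "'a::unital_jordan_algebra"
  assumes "T \<in> structure_maps"
  shows "commutator T (con_pairing x y) = con_pairing (T x) y + con_pairing x (str_involution T y)"
proof
  fix z
  obtain D a where T: "T = D + lmul a" and D: "D \<in> derivations"
    using assms by (auto simp: structure_maps_def)
  note lin = derivation_linear[OF D]
  have 1: "commutator D (con_pairing x y) z = con_pairing (D x) y z + con_pairing x (D y) z"
    by (simp add: commutator_apply con_pairing_apply linear_add[OF lin] linear_diff[OF lin]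
        linear_scale[OF lin] derivation_mult[OF D] alg_bilinear_simps algebra_simps)
  have "commutator (lmul a) (con_pairing x y) z
      = 2 *\<^sub>R (lmul_comm a (x * y) z + a * lmul_comm x y z - lmul_comm x y (a * z))"
    by (simp add: commutator_apply con_pairing_apply lmul_comm_def lmul_def alg_bilinear_simps
        algebra_simps)
  also have "\<dots> = 2 *\<^sub>R (lmul_comm a (x * y) z - lmul_comm x y a * z)"
    by (simp add: lmul_comm_derivation)
  also have "lmul_comm a (x * y) z = lmul_comm (a * x) y z - lmul_comm x (a * y) z"
    using jordan_polarized[of a x y z]
    by (simp add: lmul_comm_def jordan_comm[of y a] algebra_simps eq_neg_iff_add_eq_0)
  also have "2 *\<^sub>R (lmul_comm (a * x) y z - lmul_comm x (a * y) z - lmul_comm x y a * z)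
      = con_pairing (a * x) y z - con_pairing x (a * y) z"
    by (simp add: con_pairing_apply lmul_comm_def jordan_comm[of y a] jordan_comm[of x a]
      jordan_comm[of y "a * x"] alg_bilinear_simps algebra_simps)
  finally have 2: "commutator (lmul a) (con_pairing x y) z
      = con_pairing (a * x) y z - con_pairing x (a * y) z" .
  have "commutator T (con_pairing x y) z
    = commutator D (con_pairing x y) z + commutator (lmul a) (con_pairing x y) z"
    using structure_maps_linear[OF con_pairing_mem[of x y]]
    by (simp add: T commutator_apply linear_add)
  then show "commutator T (con_pairing x y) z
    = (con_pairing (T x) y + con_pairing x (str_involution T y)) z"
    by (simp add: 1 2 T str_involution_eq[OF D] con_pairing_add con_pairing_diff lmul_apply)
qed

lemma con_bracket_simps:
  "con_bracket (S, x, y) (T, z, w) = (commutator S T + con_pairing x w - con_pairing z y,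
     S z - T x, str_involution S w - str_involution T y)"
  by (simp add: con_bracket_def)

text \<open>Bookkeeping for the operator component of the Jacobi identity in \<open>Con\<close>,
  stated for arbitrary group elements so that the operators remain opaque: the a's are nested
  commutators, the b's pairings, each b occurring with both signs. The next two lemmas serve the two
  components in J.\<close>

lemma jacobi_cancel1:
  fixes a1 :: "'a::ab_group_add"
  assumes "a1 + a2 + a3 = 0"
  shows "a1 + (b1 + b2) - (b3 + b4) + (b5 - b6) - (b7 - b8)
    + (a2 + (b7 + b9) - (b10 + b5) + (b11 - b2) - (b12 - b3))
    + (a3 + (b12 + b6) - (b8 + b11) + (b4 - b9) - (b1 - b10)) = 0"
proof -
  have "a1 = - (a2 + a3)" using assms by (metis add.assoc eq_neg_iff_add_eq_0)
  then show ?thesis by simp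
qed

lemma jacobi_cancel2:
  fixes u :: "'a::ab_group_add"
  shows "c1 - c2 - c3 + c4 - u + v + (c3 - c5 - c6 + c2 - w + u) + (c6 - c4 - c1 + c5 - v + w) = 0"
  by simp

lemma jacobi_cancel3:
  fixes u :: "'a::ab_group_add"
  shows "c1 - c2 - c3 + c4 + u - v + (c3 - c5 - c6 + c2 + v - w) + (c6 - c4 - c1 + c5 + w - u) = 0"
  by simp

lemma real_lie_algebra_Con: "real_lie_algebra (Con TYPE('j::unital_jordan_algebra))"
  unfolding Con_def
proof (rule real_lie_algebra_lie_onI)
  let ?S = "structure_maps \<times> UNIV \<times> UNIV :: (('j \<Rightarrow> 'j) \<times> 'j \<times> 'j) set"
  note sub = subspace_structure_maps
  note inv = str_involution_mem str_involution_add str_involution_scale str_involution_minus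
    str_involution_commutator str_involution_con_pairing
  show "subspace ?S"
    by (intro subspace_Times sub subspace_UNIV)
  fix p q r :: "('j \<Rightarrow> 'j) \<times> 'j \<times> 'j" assume "p \<in> ?S" "q \<in> ?S"
  then obtain T1 x1 y1 T2 x2 y2 where
    p: "p = (T1, x1, y1)" "T1 \<in> structure_maps" and q: "q = (T2, x2, y2)" "T2 \<in> structure_maps"
    by (cases p, cases q) auto
  show "con_bracket p q \<in> ?S"
    by (simp add: p q con_bracket_simps structure_maps_commutator subspace_add[OF sub]
        subspace_diff[OF sub] con_pairing_mem)
  show "con_bracket p q = - con_bracket q p"
    by (simp add: p q con_bracket_simps commutator_anti[of T1])
  show "con_bracket (t *\<^sub>R p) q = t *\<^sub>R con_bracket p q" for t
    using p(2) q(2)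
    by (simp add: p q con_bracket_simps commutator_scale_left structure_maps_linear linear_scale
        con_pairing_scale inv scaleR_fun_apply scaleR_diff_right scaleR_add_right)
  assume "r \<in> ?S"
  then obtain T3 x3 y3 where r: "r = (T3, x3, y3)" "T3 \<in> structure_maps" by (cases r) auto
  note mem = p(2) q(2) r(2)
  note lin = structure_maps_linear[OF r(2)] structure_maps_linear[OF str_involution_mem[OF r(2)]]
  have "con_bracket (p + q) r = (commutator T1 T3 + commutator T2 T3
      + (con_pairing x1 y3 + con_pairing x2 y3) - (con_pairing x3 y1 + con_pairing x3 y2),
      T1 x3 + T2 x3 - (T3 x1 + T3 x2),
      str_involution T1 y3 + str_involution T2 y3 - (str_involution T3 y1 + str_involution T3 y2))"
    by (simp only: p(1) q(1) r(1) add_Pair con_bracket_simps commutator_add_left[OF lin(1)]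
        lin[THEN linear_add] con_pairing_add str_involution_add[OF p(2) q(2)] plus_fun_apply)
  also have "\<dots> = con_bracket p r + con_bracket q r"
    by (simp only: p(1) q(1) r(1) add_Pair con_bracket_simps) (simp only: prod.inject diff_conv_add_uminus minus_add_distrib add_ac simp_thms)
  finally show "con_bracket (p + q) r = con_bracket p r + con_bracket q r" .
  show "con_bracket p (con_bracket q r) + con_bracket q (con_bracket r p)
    + con_bracket r (con_bracket p q) = 0"
  proof -
    \<comment> \<open>One summand of each component of the cyclic sum is expanded here for arbitrary
      arguments, so that three instances give the whole sum.\<close>
    have 1: "commutator T1 (commutator T2 T3 + con_pairing x2 y3 - con_pairing x3 y2)
          + con_pairing x1 (str_involution T2 y3 - str_involution T3 y2)
          - con_pairing (T2 x3 - T3 x2) y1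
        = commutator T1 (commutator T2 T3)
          + (con_pairing (T1 x2) y3 + con_pairing x2 (str_involution T1 y3))
          - (con_pairing (T1 x3) y2 + con_pairing x3 (str_involution T1 y2))
          + (con_pairing x1 (str_involution T2 y3) - con_pairing x1 (str_involution T3 y2))
          - (con_pairing (T2 x3) y1 - con_pairing (T3 x2) y1)"
      if "T1 \<in> structure_maps" for T1 T2 T3 :: "'j \<Rightarrow> 'j" and x1 y1 x2 y2 x3 y3 :: 'j
      using that
      by (simp only: commutator_add_right[OF structure_maps_linear[OF that]]
          commutator_diff_right[OF structure_maps_linear[OF that]]
          commutator_con_pairing[OF that] con_pairing_diff)
    have 2: "T1 (T2 x3 - T3 x2) - (commutator T2 T3 + con_pairing x2 y3 - con_pairing x3 y2) x1
        = T1 (T2 x3) - T1 (T3 x2) - T2 (T3 x1) + T3 (T2 x1) - con_pairing x2 y3 x1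
          + con_pairing x3 y2 x1"
      if "T1 \<in> structure_maps" for T1 T2 T3 :: "'j \<Rightarrow> 'j" and x1 y1 x2 y2 x3 y3 :: 'j
      using that by (simp add: structure_maps_linear linear_diff commutator_apply)
    have 3: "str_involution T1 (str_involution T2 y3 - str_involution T3 y2)
        - str_involution (commutator T2 T3 + con_pairing x2 y3 - con_pairing x3 y2) y1
        = str_involution T1 (str_involution T2 y3) - str_involution T1 (str_involution T3 y2)
          - str_involution T2 (str_involution T3 y1) + str_involution T3 (str_involution T2 y1)
          + con_pairing y3 x2 y1 - con_pairing y2 x3 y1"
      if "T1 \<in> structure_maps" "T2 \<in> structure_maps" "T3 \<in> structure_maps"
      for T1 T2 T3 :: "'j \<Rightarrow> 'j" and x1 y1 x2 y2 x3 y3 :: 'j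
      using that
      by (simp add: inv str_involution_diff structure_maps_linear linear_diff structure_maps_commutator
          con_pairing_mem subspace_add[OF sub] commutator_apply)
    note lin = mem[THEN structure_maps_linear]
    show ?thesis
      \<comment> \<open>Only selected instances of the outer symmetry are used: they orient the
        pairings in both J components so that equal terms coincide.\<close>
      unfolding p(1) q(1) r(1) con_bracket_simps 1[OF p(2)] 1[OF q(2)] 1[OF r(2)]
        2[OF p(2)] 2[OF q(2)] 2[OF r(2)] 3[OF mem] 3[OF q(2) r(2) p(2)] 3[OF r(2) p(2) q(2)]
        add_Pair zero_prod_def prod.inject con_pairing_sym[of x1] con_pairing_sym[of x2 y1 x3]
        con_pairing_sym[of y1] con_pairing_sym[of y2 x1 y3]
      by (intro conjI jacobi_cancel1[OF commutator_jacobi[OF lin]] jacobi_cancel2 jacobi_cancel3)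
  qed
qed

section \<open>Composition algebras\<close>

text \<open>Left multiplication by the conjugate of x is adjoint to left multiplication by x, and
  the latter scales the form by \<open>qf x\<close>. Non-degeneracy turns this into an identity of
  elements, without any associativity.\<close>

lemma conj_mult_mult: "alg_conj x * (x * y) = qf x *\<^sub>R y"
  by (rule polar_eqI) (simp add: polar_adjoint_left alg_conj_conj polar_scale_left
      flip: polar_mult_same[of x])

lemma polar_mult_same_right: "polar (y * x) (z * x) = qf x * polar y z"
  using polar_mult_cross[of y x z x] by (simp add: polar_self)

lemma mult_mult_conj: "(y * x) * alg_conj x = qf x *\<^sub>R y"
  by (rule polar_eqI) (simp add: polar_adjoint_right alg_conj_conj polar_scale_left
      flip: polar_mult_same_right[of _ x])

lemma mult_conj_mult: "x * (alg_conj x * y) = qf x *\<^sub>R y"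
  using conj_mult_mult[of "alg_conj x" y] by (simp add: alg_conj_conj qf_conj)

lemma mult_conj_polar: "x * alg_conj y + y * alg_conj x = (2 * polar x y) *\<^sub>R 1"
proof (rule polar_eqI)
  fix w
  show "polar (x * alg_conj y + y * alg_conj x) w = polar ((2 * polar x y) *\<^sub>R 1) w"
    using polar_mult_cross[of w y 1 x]
    by (simp add: polar_add_left polar_scale_left polar_adjoint_right[of _ "alg_conj _"]
        alg_conj_conj alg_one_left polar_sym[of 1 w] polar_sym[of x "w * y"] polar_sym[of y "w * x"]
        polar_sym[of y x])
qed

lemma conj_mult_polar: "alg_conj x * y + alg_conj y * x = (2 * polar x y) *\<^sub>R 1"
  using mult_conj_polar[of "alg_conj x" "alg_conj y"] by (simp add: alg_conj_conj polar_conj)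

lemma conj_fixed: "alg_conj d = d \<longleftrightarrow> (\<exists>r. d = r *\<^sub>R 1)"
proof
  assume "alg_conj d = d"
  then have "2 *\<^sub>R d = 2 *\<^sub>R (alg_re d *\<^sub>R 1)"
    by (simp add: alg_conj_eq scaleR_2 algebra_simps)
  then show "\<exists>r. d = r *\<^sub>R 1" by (metis scaleR_cancel_left zero_neq_numeral)
qed (auto simp: alg_conj_scale alg_conj_one)

lemma alg_re_one: "alg_re 1 = 1"
  by (simp add: alg_re_def polar_self qf_one)

lemma alg_re_scale: "alg_re (r *\<^sub>R x) = r * alg_re x"
  by (simp add: alg_re_def polar_scale_left)

lemma alg_re_add: "alg_re (x + y) = alg_re x + alg_re y"
  by (simp add: alg_re_def polar_add_left)

text \<open>This is (xu)(vx) = x(uv)x, with xwx expanded as 2<w, conj x> x - |x|^2 conj w. Tested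
  against w, the left side is changed by one application of the exchange law
  \<open>polar_mult_cross\<close>, after which \<open>mult_conj_mult\<close> applies.\<close>

lemma middle_moufang: "(x * u) * (v * x) = (2 * polar (u * v) (alg_conj x)) *\<^sub>R x
    - qf x *\<^sub>R alg_conj (u * v)"
proof (rule polar_eqI)
  fix w
  have "polar ((x * u) * (v * x)) w = polar (x * u) (w * (alg_conj x * alg_conj v))"
    by (simp add: polar_adjoint_right alg_conj_mult)
  also have "\<dots> = 2 * polar x w * polar u (alg_conj x * alg_conj v)
      - polar (x * (alg_conj x * alg_conj v)) (w * u)"
    using polar_mult_cross[of x u w "alg_conj x * alg_conj v"] by simp
  also have "polar u (alg_conj x * alg_conj v) = polar (u * v) (alg_conj x)"
    by (simp add: polar_adjoint_right)
  also have "polar (x * (alg_conj x * alg_conj v)) (w * u) = qf x * polar (alg_conj (u * v)) w"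
    by (simp add: mult_conj_mult polar_scale_left alg_conj_mult polar_adjoint_right alg_conj_conj)
  finally show "polar ((x * u) * (v * x)) w = polar ((2 * polar (u * v) (alg_conj x)) *\<^sub>R x
    - qf x *\<^sub>R alg_conj (u * v)) w"
    by (simp add: polar_simps)
qed

lemma middle_moufang_linearized:
  "(x * u) * (v * y) + (y * u) * (v * x) = (2 * polar (u * v) (alg_conj x)) *\<^sub>R y
    + (2 * polar (u * v) (alg_conj y)) *\<^sub>R x - (2 * polar x y) *\<^sub>R alg_conj (u * v)"
proof -
  have "((x + y) * u) * (v * (x + y)) = (x * u) * (v * x) + (y * u) * (v * y)
     + ((x * u) * (v * y) + (y * u) * (v * x))"
    by (simp add: alg_bilinear_simps algebra_simps)
  then show ?thesis
    unfolding middle_moufang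
    by (simp add: alg_conj_add polar_add_right qf_add algebra_simps)
qed

lemma conj_mult_mult_linearized:
  "alg_conj x * (y * w) + alg_conj y * (x * w) = (2 * polar x y) *\<^sub>R w"
  using arg_cong[OF conj_mult_polar[of x y], of "\<lambda>t. t * w"]
    conj_mult_mult[of "x + y" w] conj_mult_mult[of x w] conj_mult_mult[of y w]
  by (simp add: alg_conj_add alg_bilinear_simps qf_add algebra_simps)

lemma mult_mult_conj_linearized:
  "(w * x) * alg_conj y + (w * y) * alg_conj x = (2 * polar x y) *\<^sub>R w"
  using mult_mult_conj[of w "x + y"] mult_mult_conj[of w x] mult_mult_conj[of w y]
  by (simp add: alg_conj_add alg_bilinear_simps qf_add algebra_simps)

text \<open>The trilinear form Re((xy)z); twice its value on the off-diagonal entries is the last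
  term of the determinant.\<close>

definition tri :: "'a::composition_algebra \<Rightarrow> 'a \<Rightarrow> 'a \<Rightarrow> real" where
  "tri x y z = polar (x * y) (alg_conj z)"

lemma tri_cyclic: "tri x y z = tri y z x"
  by (simp add: tri_def polar_adjoint_left polar_sym[of y])
    (metis alg_conj_mult alg_conj_conj polar_conj polar_sym)

section \<open>Coordinates on hermitian matrices\<close>

text \<open>The entries x, y, z stand at (2,3), (3,1), (1,2). With this choice a cyclic shift of the
  indices permutes (a, b, c) and (x, y, z) cyclically without conjugations, so one diagonal and one
  off-diagonal computation cover all entries.\<close>

definition hmat :: "real \<Rightarrow> real \<Rightarrow> real \<Rightarrow> 'a \<Rightarrow> 'a \<Rightarrow> 'a::composition_algebra \<Rightarrow> 'a herm3" where
  "hmat a b c x y z = Herm3 (vector [vector [a *\<^sub>R 1, z, alg_conj y],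
     vector [alg_conj z, b *\<^sub>R 1, x], vector [y, alg_conj x, c *\<^sub>R 1]])"

lemma mat_of_hmat: "mat_of (hmat a b c x y z) = vector [vector [a *\<^sub>R 1, z, alg_conj y],
     vector [alg_conj z, b *\<^sub>R 1, x], vector [y, alg_conj x, c *\<^sub>R 1]]"
  unfolding hmat_def
  by (rule Herm3_inverse) (simp add: forall_3 alg_conj_conj alg_conj_scale alg_conj_one)

lemma hmat_eq_iff: "hmat a b c x y z = hmat a' b' c' x' y' z' \<longleftrightarrow>
    a = a' \<and> b = b' \<and> c = c' \<and> x = x' \<and> y = y' \<and> (z::'a::composition_algebra) = z'"
proof
  assume "hmat a b c x y z = hmat a' b' c' x' y' z'"
  then have "mat_of (hmat a b c x y z) $ i $ j = mat_of (hmat a' b' c' x' y' z') $ i $ j" for i j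
    by simp
  from this[of 1 1] this[of 2 2] this[of 3 3] this[of 2 3] this[of 3 1] this[of 1 2]
  show "a = a' \<and> b = b' \<and> c = c' \<and> x = x' \<and> y = y' \<and> z = z'"
    by (simp add: mat_of_hmat alg_one_neq_zero)
qed simp

lemma hmat_cases:
  obtains a b c x y z where "A = hmat a b c x y (z::'a::composition_algebra)"
proof -
  have h: "alg_conj (mat_of A $ i $ j) = mat_of A $ j $ i" for i j
    using mat_of[of A] by simp
  obtain a b c where d: "mat_of A $ 1 $ 1 = a *\<^sub>R 1" "mat_of A $ 2 $ 2 = b *\<^sub>R 1"
    "mat_of A $ 3 $ 3 = c *\<^sub>R 1"
    using h[of 1 1] h[of 2 2] h[of 3 3] unfolding conj_fixed by blast
  have "mat_of A = mat_of (hmat a b c (mat_of A $ 2 $ 3) (mat_of A $ 3 $ 1) (mat_of A $ 1 $ 2))"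
    by (simp add: vec_eq_iff forall_3 mat_of_hmat d h)
  then have "A = hmat a b c (mat_of A $ 2 $ 3) (mat_of A $ 3 $ 1) (mat_of A $ 1 $ 2)"
    by (simp add: mat_of_inject)
  then show thesis by (rule that)
qed

lemma hmat_add: "hmat a b c x y z + hmat a' b' c' x' y' z'
    = hmat (a + a') (b + b') (c + c') (x + x') (y + y') (z + (z'::'a::composition_algebra))"
  by (simp add: mat_of_inject[symmetric] plus_herm3.rep_eq mat_of_hmat vec_eq_iff forall_3
      alg_conj_add scaleR_add_left)

lemma hmat_scale: "r *\<^sub>R hmat a b c x y z
    = hmat (r * a) (r * b) (r * c) (r *\<^sub>R x) (r *\<^sub>R y) (r *\<^sub>R (z::'a::composition_algebra))"
  by (simp add: mat_of_inject[symmetric] scaleR_herm3.rep_eq mat_of_hmat vec_eq_iff forall_3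
      alg_conj_scale)

lemma hmat_minus: "- hmat a b c x y z = hmat (- a) (- b) (- c) (- x) (- y) (- z)"
  using hmat_scale[of "- 1" a b c x y z] by simp

lemma hmat_diff: "hmat a b c x y z - hmat a' b' c' x' y' z'
    = hmat (a - a') (b - b') (c - c') (x - x') (y - y') (z - (z'::'a::composition_algebra))"
  unfolding diff_conv_add_uminus hmat_minus hmat_add ..

lemma hmat_zero: "hmat 0 0 0 0 0 0 = 0"
  using hmat_scale[of 0 0 0 0 0 0 0] by simp

lemma herm_id_hmat: "herm_id = hmat 1 1 1 0 0 0"
  by (simp add: mat_of_inject[symmetric] herm_id.rep_eq mat_of_hmat vec_eq_iff forall_3
      mat_def alg_conj_zero)

lemma herm_trace_hmat: "herm_trace (hmat a b c x y z) = a + b + c"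
  by (simp add: herm_trace_def mat_of_hmat sum_3 alg_re_add alg_re_scale alg_re_one)

lemma hmat_mult: "hmat a b c x y z * hmat a' b' c' x' y' (z'::'a::composition_algebra) =
  hmat (2 * (a * a' + polar y y' + polar z z')) (2 * (b * b' + polar z z' + polar x x'))
    (2 * (c * c' + polar x x' + polar y y'))
    ((b + c) *\<^sub>R x' + (b' + c') *\<^sub>R x + alg_conj (y * z' + y' * z))
    ((c + a) *\<^sub>R y' + (c' + a') *\<^sub>R y + alg_conj (z * x' + z' * x))
    ((a + b) *\<^sub>R z' + (a' + b') *\<^sub>R z + alg_conj (x * y' + x' * y))"
proof -
  \<comment> \<open>The three diagonal entries differ only in where the real product stands in the
    sum over the inner index.\<close>
  have diag1: "(p *\<^sub>R 1) * (q *\<^sub>R 1) + u * alg_conj u' + alg_conj v * v'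
      + ((q *\<^sub>R 1) * (p *\<^sub>R 1) + u' * alg_conj u + alg_conj v' * v)
    = (2 * (p * q) + 2 * polar v v' + 2 * polar u u') *\<^sub>R (1::'a)" for p q u u' v v'
    by (simp only: scaleR_add_left mult_conj_polar[symmetric, of u] conj_mult_polar[symmetric, of v])
      (simp only: alg_scale_left alg_scale_right alg_one_left scaleR_scaleR scaleR_add_left mult_2
        mult.commute[of q p] add_ac)
  have diag2: "alg_conj v * v' + (p *\<^sub>R 1) * (q *\<^sub>R 1) + u * alg_conj u'
      + (alg_conj v' * v + (q *\<^sub>R 1) * (p *\<^sub>R 1) + u' * alg_conj u)
    = (2 * (p * q) + 2 * polar v v' + 2 * polar u u') *\<^sub>R (1::'a)" for p q u u' v v'
    using diag1[of p q u u' v v'] by (simp add: add_ac)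
  have diag3: "u * alg_conj u' + alg_conj v * v' + (p *\<^sub>R 1) * (q *\<^sub>R 1)
      + (u' * alg_conj u + alg_conj v' * v + (q *\<^sub>R 1) * (p *\<^sub>R 1))
    = (2 * (p * q) + 2 * polar v v' + 2 * polar u u') *\<^sub>R (1::'a)" for p q u u' v v'
    using diag1[of p q u u' v v'] by (simp add: add_ac)
  show ?thesis
    unfolding mat_of_inject[symmetric] times_herm3.rep_eq vec_eq_iff forall_3
      plus_vec_def nmat_mult_def sum_3 mat_of_hmat
    by (simp, intro conjI diag1 diag2 diag3)
      (simp_all add: alg_bilinear_simps alg_one_left alg_one_right alg_conj_add
        alg_conj_mult alg_conj_conj alg_conj_scale scaleR_add_left add_ac)
qed

section \<open>The Jordan identity for hermitian matrices\<close>

lemma polar_tri: "polar (x * y) (alg_conj z) = tri x y z" "polar (alg_conj (x * y)) z = tri x y z"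
  "polar z (alg_conj (x * y)) = tri x y z"
  by (simp_all add: tri_def polar_conj polar_sym[of z])

text \<open>The factor 1/2 compensates the doubled product AB + BA, leaving the usual trace form Re
  tr(AB).\<close>

definition herm_form :: "'a::composition_algebra herm3 \<Rightarrow> 'a herm3 \<Rightarrow> real" where
  "herm_form A B = herm_trace (A * B) / 2"

text \<open>The Freudenthal cross product, that is, the polarization of the adjoint
  \<open>A\<^sup>2 - tr(A) A + (tr(A)\<^sup>2 - tr(A\<^sup>2)) / 2\<close> (matrix square).\<close>

definition herm_cross :: "'a::composition_algebra herm3 \<Rightarrow> 'a herm3 \<Rightarrow> 'a herm3" where
  "herm_cross A B = A * B - herm_trace A *\<^sub>R B - herm_trace B *\<^sub>R A
     + (herm_trace A * herm_trace B - herm_form A B) *\<^sub>R herm_id"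

lemma herm_form_hmat: "herm_form (hmat a b c x y z) (hmat a' b' c' x' y' z')
    = a * a' + b * b' + c * c' + 2 * (polar x x' + polar y y' + polar z z')"
  by (simp add: herm_form_def hmat_mult herm_trace_hmat field_simps)

lemma herm_cross_hmat: "herm_cross (hmat a b c x y z) (hmat a' b' c' x' y' z')
    = hmat (b * c' + b' * c - 2 * polar x x') (c * a' + c' * a - 2 * polar y y')
        (a * b' + a' * b - 2 * polar z z')
        (alg_conj (y * z' + y' * z) - a *\<^sub>R x' - a' *\<^sub>R x)
        (alg_conj (z * x' + z' * x) - b *\<^sub>R y' - b' *\<^sub>R y)
        (alg_conj (x * y' + x' * y) - c *\<^sub>R z' - c' *\<^sub>R z)"
  by (simp add: herm_cross_def hmat_mult herm_trace_hmat herm_form_hmat herm_id_hmat hmat_scale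
      hmat_add hmat_diff hmat_eq_iff algebra_simps)

lemma herm_mult_comm: "A * B = B * (A::'a::composition_algebra herm3)"
  by transfer (rule add.commute)

lemma herm_form_sym: "herm_form A B = herm_form B A"
  by (simp add: herm_form_def herm_mult_comm)

lemma herm_trace_add: "herm_trace (A + B) = herm_trace A + herm_trace B"
  by (cases A rule: hmat_cases, cases B rule: hmat_cases) (simp add: hmat_add herm_trace_hmat)

lemma herm_trace_scale: "herm_trace (r *\<^sub>R A) = r * herm_trace A"
  by (cases A rule: hmat_cases) (simp add: hmat_scale herm_trace_hmat algebra_simps)

lemma herm_trace_id: "herm_trace herm_id = 3"
  by (simp add: herm_id_hmat herm_trace_hmat)

lemma herm_id_mult: "herm_id * A = 2 *\<^sub>R A"
  by (cases A rule: hmat_cases)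
    (simp add: herm_id_hmat hmat_mult hmat_scale hmat_eq_iff alg_bilinear_simps alg_conj_zero
      polar_def qf_zero scaleR_2)

lemma herm_form_simps:
  "herm_form (A + B) C = herm_form A C + herm_form B C"
  "herm_form A (B + C) = herm_form A B + herm_form A C"
  "herm_form (r *\<^sub>R A) B = r * herm_form A B" "herm_form A (r *\<^sub>R B) = r * herm_form A B"
  "herm_form (A - B) C = herm_form A C - herm_form B C"
  "herm_form A (B - C) = herm_form A B - herm_form A C"
  "herm_form herm_id A = herm_trace A" "herm_form A herm_id = herm_trace A"
proof -
  have diff: "herm_trace (A - B) = herm_trace A - herm_trace B" for A B :: "'a herm3"
    using herm_trace_add[of A "(- 1) *\<^sub>R B"] herm_trace_scale[of "- 1" B] by simp
  show "herm_form (A + B) C = herm_form A C + herm_form B C"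
    "herm_form A (B + C) = herm_form A B + herm_form A C"
    "herm_form (r *\<^sub>R A) B = r * herm_form A B" "herm_form A (r *\<^sub>R B) = r * herm_form A B"
    "herm_form (A - B) C = herm_form A C - herm_form B C"
    "herm_form A (B - C) = herm_form A B - herm_form A C"
    "herm_form herm_id A = herm_trace A" "herm_form A herm_id = herm_trace A"
    by (simp_all add: herm_form_def alg_bilinear_simps herm_trace_add herm_trace_scale diff
        herm_id_mult herm_mult_comm[of A herm_id] diff_divide_distrib add_divide_distrib)
qed

lemma herm_form_eqI:
  assumes "\<And>C. herm_form A C = herm_form B C"
  shows "A = B"
proof -
  obtain a b c x y z where A: "A = hmat a b c x y z" by (rule hmat_cases)
  obtain a' b' c' x' y' z' where B: "B = hmat a' b' c' x' y' z'" by (rule hmat_cases)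
  have z: "polar v 0 = 0" for v :: 'a using polar_scale_right[of v 0 0] by simp
  have "a = a'" "b = b'" "c = c'"
    using assms[of "hmat 1 0 0 0 0 0"] assms[of "hmat 0 1 0 0 0 0"] assms[of "hmat 0 0 1 0 0 0"]
    by (simp_all add: A B herm_form_hmat z)
  moreover have "x = x'" "y = y'" "z = z'"
    using assms[of "hmat 0 0 0 _ 0 0"] assms[of "hmat 0 0 0 0 _ 0"] assms[of "hmat 0 0 0 0 0 _"]
    by (auto simp: A B herm_form_hmat z intro: polar_eqI)
  ultimately show ?thesis by (simp add: A B)
qed

text \<open>Both sides are the full polarization of the determinant, a symmetric trilinear form; in
  coordinates the symmetry comes down to the cyclicity of \<open>tri\<close>.\<close>

lemma herm_form_cross: "herm_form (herm_cross A B) C = herm_form A (herm_cross B C)"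
proof -
  obtain a b c x y z where A: "A = hmat a b c x y z" by (rule hmat_cases)
  obtain a' b' c' x' y' z' where B: "B = hmat a' b' c' x' y' z'" by (rule hmat_cases)
  obtain a'' b'' c'' x'' y'' z'' where C: "C = hmat a'' b'' c'' x'' y'' z''" by (rule hmat_cases)
  show ?thesis
    by (simp add: A B C herm_cross_hmat herm_form_hmat polar_simps alg_conj_add polar_tri
        tri_cyclic[of x'' y z', symmetric] tri_cyclic[of x'' y' z, symmetric]
        tri_cyclic[of z x' y''] tri_cyclic[of z' x y''] tri_cyclic[of x y' z'', symmetric]
        tri_cyclic[of x y'' z', symmetric] tri_cyclic[of z' x'' y] tri_cyclic[of z'' x' y]
        algebra_simps)
qed

lemma herm_cross_sym: "herm_cross A B = herm_cross B A"
  by (simp add: herm_cross_def herm_mult_comm[of A] herm_form_sym[of A] mult.commute algebra_simps)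

section \<open>The adjoint and its linearized identity\<close>

definition herm_sharp :: "'a::composition_algebra herm3 \<Rightarrow> 'a herm3" where
  "herm_sharp A = (1/2) *\<^sub>R herm_cross A A"

lemma herm_sharp_hmat: "herm_sharp (hmat a b c x y z)
    = hmat (b * c - qf x) (c * a - qf y) (a * b - qf z)
        (alg_conj (y * z) - a *\<^sub>R x) (alg_conj (z * x) - b *\<^sub>R y) (alg_conj (x * y) - c *\<^sub>R z)"
  by (simp add: herm_sharp_def herm_cross_hmat hmat_scale hmat_eq_iff polar_self alg_conj_add
      scaleR_diff_right scaleR_2[symmetric] diff_diff_eq flip: scaleR_add_left)
    (simp add: scaleR_2[symmetric] alg_conj_scale)

definition herm_det_coord :: "real \<Rightarrow> real \<Rightarrow> real \<Rightarrow> 'a \<Rightarrow> 'a \<Rightarrow> 'a::composition_algebra \<Rightarrow> real" where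
  "herm_det_coord a b c x y z
     = a * b * c - a * qf x - b * qf y - c * qf z + 2 * tri x y z"

lemma alg_conj_diff: "alg_conj (x - y) = alg_conj x - alg_conj y"
  by (simp only: diff_conv_add_uminus alg_conj_add alg_conj_minus)

text \<open>The (1,1) entry of the identity in \<open>sharp_cross\<close>; the others arise by
  cyclic shifts.\<close>

lemma sharp_cross_diagonal:
  fixes x y z :: "'a::composition_algebra"
  shows "(c * a - qf y) * (a * b' + a' * b - 2 * polar z z')
      + (c * a' + c' * a - 2 * polar y y') * (a * b - qf z)
      - 2 * polar (alg_conj (y * z) - a *\<^sub>R x) (alg_conj (y * z' + y' * z) - a *\<^sub>R x' - a' *\<^sub>R x)
    = herm_det_coord a b c x y z * a'
      + ((b * c - qf x) * a' + (c * a - qf y) * b' + (a * b - qf z) * c'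
        + 2 * (tri x' y z - a * polar x x' + (tri x y' z - b * polar y y')
        + (tri x y z' - c * polar z z'))) * a"
proof -
  have 1: "polar (alg_conj (y * z)) (alg_conj (y * z' + y' * z)) = qf y * polar z z' + qf z * polar y y'"
    by (simp add: polar_conj alg_conj_conj polar_add_right polar_mult_same polar_mult_same_right)
  have 2: "polar (alg_conj (y * z)) x' = tri x' y z" "polar x (alg_conj (y * z' + y' * z)) = tri x y z' + tri x y' z"
    "polar (alg_conj (y * z)) x = tri x y z"
    by (simp_all add: alg_conj_add polar_simps polar_tri tri_cyclic[of x' y z] tri_cyclic[of x y z]
        tri_cyclic[of x y z'] tri_cyclic[of x y' z])
  show ?thesis
    by (simp add: polar_simps 1 2 polar_self
        herm_det_coord_def algebra_simps)
qed

text \<open>The (2,3) entry. Fourfold products of entries occur only in the shape (xu)(vy) +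
  (yu)(vx) or (xu)(vx), where the Moufang identity removes them; threefold products contain an
  element next to its conjugate.\<close>

lemma sharp_cross_offdiagonal:
  fixes x y z :: "'a::composition_algebra"
  shows "alg_conj ((alg_conj (z * x) - b *\<^sub>R y) * (alg_conj (x * y' + x' * y) - c *\<^sub>R z' - c' *\<^sub>R z)
        + (alg_conj (z * x' + z' * x) - b *\<^sub>R y' - b' *\<^sub>R y) * (alg_conj (x * y) - c *\<^sub>R z))
      - (b * c - qf x) *\<^sub>R (alg_conj (y * z' + y' * z) - a *\<^sub>R x' - a' *\<^sub>R x)
      - (b * c' + b' * c - 2 * polar x x') *\<^sub>R (alg_conj (y * z) - a *\<^sub>R x)
    = herm_det_coord a b c x y z *\<^sub>R x'
      + ((b * c - qf x) * a' + (c * a - qf y) * b' + (a * b - qf z) * c'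
        + 2 * (tri x' y z - a * polar x x' + (tri x y' z - b * polar y y')
        + (tri x y z' - c * polar z z'))) *\<^sub>R x"
    (is "alg_conj ?P - ?Q - ?R = ?S")
proof -
  \<comment> \<open>The summands are grouped so that each group is literally the left side of one of
    the identities applied next.\<close>
  have "alg_conj ?P = (x * y') * (z * x) + ((x * y) * (z * x') + (x' * y) * (z * x))
      + (x * y) * (z' * x) - c *\<^sub>R (alg_conj z' * (z * x) + alg_conj z * (z' * x))
      - c' *\<^sub>R (alg_conj z * (z * x)) - b *\<^sub>R ((x * y') * alg_conj y + (x * y) * alg_conj y')
      - b *\<^sub>R ((x' * y) * alg_conj y) - b' *\<^sub>R ((x * y) * alg_conj y)
      - c *\<^sub>R (alg_conj z * (z * x')) + (b * c) *\<^sub>R alg_conj (y * z') + (b * c') *\<^sub>R alg_conj (y * z)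
      + (b * c) *\<^sub>R alg_conj (y' * z) + (b' * c) *\<^sub>R alg_conj (y * z)"
    by (rule polar_eqI) (simp add: alg_bilinear_simps alg_conj_add alg_conj_mult alg_conj_conj alg_conj_scale
        alg_conj_diff polar_simps algebra_simps)
  also have "\<dots> = (2 * tri y' z x) *\<^sub>R x - qf x *\<^sub>R alg_conj (y' * z)
      + ((2 * tri y z x) *\<^sub>R x' + (2 * tri y z x') *\<^sub>R x - (2 * polar x x') *\<^sub>R alg_conj (y * z))
      + ((2 * tri y z' x) *\<^sub>R x - qf x *\<^sub>R alg_conj (y * z')) - c *\<^sub>R ((2 * polar z' z) *\<^sub>R x)
      - c' *\<^sub>R (qf z *\<^sub>R x) - b *\<^sub>R ((2 * polar y' y) *\<^sub>R x)
      - b *\<^sub>R (qf y *\<^sub>R x') - b' *\<^sub>R (qf y *\<^sub>R x)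
      - c *\<^sub>R (qf z *\<^sub>R x') + (b * c) *\<^sub>R alg_conj (y * z') + (b * c') *\<^sub>R alg_conj (y * z)
      + (b * c) *\<^sub>R alg_conj (y' * z) + (b' * c) *\<^sub>R alg_conj (y * z)"
    unfolding middle_moufang middle_moufang_linearized conj_mult_mult conj_mult_mult_linearized
      mult_mult_conj mult_mult_conj_linearized polar_tri ..
  finally have P: "alg_conj ?P = \<dots>" .
  show ?thesis
    unfolding P
    by (rule polar_eqI)
      (simp add: polar_simps alg_conj_add herm_det_coord_def tri_cyclic[of x y' z, symmetric]
        tri_cyclic[of x y z, symmetric] tri_cyclic[of x' y z, symmetric]
        tri_cyclic[of x y z', symmetric] polar_sym[of y' y] polar_sym[of z' z] algebra_simps)
qed

text \<open>The scalar \<open>n\<close> is the determinant of \<open>A\<close>. What matters later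
  is only that it does not depend on \<open>B\<close>.\<close>

lemma sharp_cross:
  "\<exists>n. \<forall>B. herm_cross (herm_sharp A) (herm_cross A B) = n *\<^sub>R B + herm_form (herm_sharp A) B *\<^sub>R A"
proof -
  obtain a b c x y z where A: "A = hmat a b c x y z" by (rule hmat_cases)
  have "herm_cross (herm_sharp A) (herm_cross A B)
      = herm_det_coord a b c x y z *\<^sub>R B + herm_form (herm_sharp A) B *\<^sub>R A" for B
  proof -
    obtain a' b' c' x' y' z' where B: "B = hmat a' b' c' x' y' z'" by (rule hmat_cases)
    \<comment> \<open>Cyclic invariance of the determinant lets the shifted instances of the two
      coordinate lemmas share one scalar.\<close>
    have cyc: "herm_det_coord c a b z x y = herm_det_coord a b c x y z"
      "herm_det_coord b c a y z x = herm_det_coord a b c x y z"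
      by (simp_all add: herm_det_coord_def tri_cyclic[of z x y] tri_cyclic[of x y z] algebra_simps)
    have form: "herm_form (herm_sharp A) B = (b * c - qf x) * a' + (c * a - qf y) * b' + (a * b - qf z) * c'
        + 2 * (tri x' y z - a * polar x x' + (tri x y' z - b * polar y y')
        + (tri x y z' - c * polar z z'))"
      by (simp add: A B herm_sharp_hmat herm_form_hmat polar_simps polar_tri
        tri_cyclic[of x' y z, symmetric] tri_cyclic[of x y' z] tri_cyclic[of y' z x])
    show ?thesis
      unfolding form
      using sharp_cross_diagonal[of c a y b' a' b z z' c' y' x x']
        sharp_cross_diagonal[of a b z c' b' c x x' a' z' y y']
        sharp_cross_diagonal[of b c x a' c' a y y' b' x' z z']
        sharp_cross_offdiagonal[of z x b y y' x' c z' c' b' a a']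
        sharp_cross_offdiagonal[of x y c z z' y' a x' a' c' b b']
        sharp_cross_offdiagonal[of y z a x x' z' b y' b' a' c c']
      by (simp add: A B herm_sharp_hmat herm_cross_hmat hmat_add hmat_scale hmat_eq_iff cyc
        tri_cyclic[of x' y z, symmetric] tri_cyclic[of z x' y] tri_cyclic[of x y' z, symmetric]
        tri_cyclic[of x y z', symmetric] tri_cyclic[of z' x y] tri_cyclic[of z x y'])
  qed
  then show ?thesis by blast
qed

lemma herm_trace_diff: "herm_trace (A - B) = herm_trace A - herm_trace B"
  using herm_form_simps(5)[of A B herm_id] by (simp add: herm_form_simps)

lemma herm_trace_mult: "herm_trace (A * B) = 2 * herm_form A B"
  by (simp add: herm_form_def)

lemma herm_trace_cross: "herm_trace (herm_cross A B) = herm_trace A * herm_trace B - herm_form A B"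
  by (simp add: herm_cross_def herm_trace_add herm_trace_diff herm_trace_scale herm_trace_mult
      herm_trace_id algebra_simps)

lemma herm_mult_eq: "A * B = herm_cross A B + herm_trace A *\<^sub>R B + herm_trace B *\<^sub>R A
    - (herm_trace A * herm_trace B - herm_form A B) *\<^sub>R herm_id"
  by (simp add: herm_cross_def)

lemma herm_form_assoc: "herm_form (A * B) C = herm_form A (B * C)"
  unfolding herm_mult_eq[of A B] herm_mult_eq[of B C]
  by (simp add: herm_form_simps herm_form_cross herm_form_sym[of B A] herm_form_sym[of C A]
      herm_form_sym[of C B] algebra_simps)

text \<open>Associativity of the form turns the claim into symmetry of a bilinear form in \<open>B\<close> and \<open>C\<close>, which
  follows because \<open>sharp_cross\<close> evaluates the only term of the product that is not visibly symmetric.\<close>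

lemma herm_sharp_commute: "(A * B) * herm_sharp A = A * (B * herm_sharp A)"
proof (rule herm_form_eqI)
  fix C
  define S where "S = herm_sharp A"
  obtain n where n: "herm_cross S (herm_cross A B) = n *\<^sub>R B + herm_form S B *\<^sub>R A" for B
    unfolding S_def using sharp_cross[of A] by blast
  have c1: "herm_form (herm_cross A X) (herm_cross S Y)
      = n * herm_form X Y + herm_form S X * herm_form A Y" for X Y
    using arg_cong[OF n[of X], of "\<lambda>t. herm_form t Y"]
    by (simp add: herm_form_simps herm_form_cross herm_cross_sym[of _ Y] herm_form_sym[of S])
      (metis herm_cross_sym herm_form_cross herm_form_sym)
  have c2: "herm_form (herm_cross S B) (herm_cross A C)
      = n * herm_form B C + herm_form S C * herm_form A B"
    using c1[of C B] by (simp add: herm_form_sym)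
  have c3: "herm_form B (herm_cross S C) = herm_form (herm_cross S B) C"
    "herm_form B (herm_cross A C) = herm_form (herm_cross A B) C"
    "herm_form S (herm_cross A C) = herm_form A (herm_cross S C)"
    "herm_form (herm_cross S B) A = herm_form (herm_cross A B) S"
    by (metis herm_cross_sym herm_form_cross)+
  have "herm_form ((A * B) * S) C = herm_form (A * B) (S * C)"
    by (rule herm_form_assoc)
  \<comment> \<open>Here \<open>c1\<close> yields \<open>herm_form S B * herm_form A C\<close>,
    while the multiples of \<open>herm_id\<close> contribute
    \<open>herm_form A B * herm_form S C\<close>; only the sum is unchanged when \<open>A\<close>
    and \<open>S\<close> are exchanged.\<close>
  also have "\<dots> = herm_form (S * B) (A * C)"
    unfolding herm_mult_eq[of A] herm_mult_eq[of S]
    by (simp add: herm_form_simps herm_trace_cross herm_trace_add herm_trace_diff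
        herm_trace_scale herm_trace_id c1 c2 c3 herm_form_sym[of B S]
        herm_form_sym[of B A] herm_form_sym[of A S] algebra_simps)
  also have "\<dots> = herm_form (A * (B * S)) C"
    by (metis herm_form_assoc herm_form_sym herm_mult_comm)
  finally show "herm_form ((A * B) * herm_sharp A) C = herm_form (A * (B * herm_sharp A)) C"
    by (simp add: S_def)
qed

text \<open>The square of \<open>A\<close> is a combination of its adjoint, \<open>A\<close> and the
  identity. Multiplications by the last two commute with that by \<open>A\<close> for trivial
  reasons, so the adjoint carries the whole content.\<close>

lemma herm_jordan: "(A * B) * (A * A) = A * (B * (A * (A::'a::composition_algebra herm3)))"
proof -
  have "A * A = 2 *\<^sub>R herm_sharp A + (2 * herm_trace A) *\<^sub>R A
      - (herm_trace A * herm_trace A - herm_form A A) *\<^sub>R herm_id"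
    by (simp add: herm_mult_eq[of A A] herm_sharp_def scaleR_2 flip: scaleR_add_left)
  moreover have "(A * B) * A = A * (B * A)" "X * herm_id = 2 *\<^sub>R X" for X :: "'a herm3"
    by (simp_all add: herm_mult_comm herm_id_mult herm_mult_comm[of X])
  ultimately show ?thesis
    by (simp add: alg_bilinear_simps herm_sharp_commute)
qed

instance herm3 :: (composition_algebra) unital_jordan_algebra
proof
  fix A B :: "'a herm3"
  show "A * B = B * A" by (rule herm_mult_comm)
  show "(A * B) * (A * A) = A * (B * (A * A))" by (rule herm_jordan)
  have "\<forall>A. ((1/2) *\<^sub>R herm_id) * A = (A :: 'a herm3)"
    by (simp add: alg_scale_left herm_id_mult)
  then show "\<exists>e. \<forall>A. e * A = (A :: 'a herm3)" by blast
qed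

section \<open>Derivations preserve the trace\<close>

lemma derivation_herm_id:
  assumes "D \<in> derivations"
  shows "D (herm_id :: 'a::composition_algebra herm3) = 0"
proof -
  have "D ((1/2) *\<^sub>R herm_id) = 0"
    by (rule derivation_unit[OF assms]) (simp add: alg_scale_left herm_id_mult)
  then show ?thesis by (simp add: linear_scale[OF derivation_linear[OF assms]])
qed

text \<open>Differentiating A . A = rA gives 2 A . DA = r DA. Paired with A, associativity of the
  form makes the left side twice the right side, so A is orthogonal to DA; paired with the identity,
  the same equation then gives trace 0.\<close>

lemma derivation_trace_multiple_idempotent:
  fixes A :: "'a::composition_algebra herm3"
  assumes D: "D \<in> derivations" and A: "A * A = r *\<^sub>R A" and r: "r \<noteq> 0"
  shows "herm_trace (D A) = 0"
proof -
  have "D (A * A) = r *\<^sub>R D A" by (simp add: A linear_scale[OF derivation_linear[OF D]])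
  then have "2 *\<^sub>R (A * D A) = r *\<^sub>R D A"
    by (simp add: derivation_mult[OF D] herm_mult_comm[of "D A"] scaleR_2)
  then have AD: "2 * herm_form B (A * D A) = r * herm_form B (D A)" for B
    by (metis herm_form_simps(4))
  have "2 * (r * herm_form A (D A)) = r * herm_form A (D A)"
    using AD[of A] herm_form_assoc[of A A "D A"] by (simp add: A herm_form_simps)
  then have "herm_form A (D A) = 0" using r by simp
  with AD[of herm_id] r show ?thesis by (simp add: herm_form_simps herm_trace_mult)
qed

lemma derivation_trace:
  fixes A :: "'a::composition_algebra herm3"
  assumes D: "D \<in> derivations"
  shows "herm_trace (D A) = 0"
proof -
  note lin = derivation_linear[OF D]
  have p0: "polar v 0 = 0" "polar 0 v = 0" for v :: 'a
    using polar_scale_right[of v 0 0] polar_scale_left[of 0 0 v] by simp_all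
  note mult = hmat_mult p0 hmat_scale hmat_eq_iff alg_bilinear_simps alg_conj_zero polar_self qf_zero
  have E: "herm_trace (D (hmat 1 0 0 0 0 0)) = 0" "herm_trace (D (hmat 0 1 0 0 0 0)) = 0"
    "herm_trace (D (hmat 0 0 1 0 0 0)) = 0"
    by (intro derivation_trace_multiple_idempotent[OF D, of _ 2]; simp add: mult)+
  text \<open>An off-diagonal matrix is the difference of a multiple of an idempotent and a diagonal matrix.\<close>
  have X: "herm_trace (D (hmat 0 0 0 x 0 0)) = 0" "herm_trace (D (hmat 0 0 0 0 x 0)) = 0"
    "herm_trace (D (hmat 0 0 0 0 0 x)) = 0" for x
  proof -
    \<comment> \<open>With diagonal entries b and k, bk = \<open>qf x\<close>, the 2 x 2 block has
      determinant 0, so its Jordan square is 2(b + k) times itself. The size of k ensures k^2 +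
      \<open>qf x\<close> > 0 for either sign of \<open>qf x\<close>, hence b + k is
      nonzero.\<close>
    define k where "k = 1 + \<bar>qf x\<bar>"
    have k: "k > 0" by (simp add: k_def)
    have kk: "k * k + qf x \<noteq> 0"
    proof -
      have "k * k \<ge> k * 1" using k by (intro mult_left_mono) (simp_all add: k_def)
      then have "k * k + qf x > 0" using abs_ge_minus_self[of "qf x"] by (simp add: k_def)
      then show ?thesis by simp
    qed
    define b where "b = qf x / k"
    have bk: "b * k = qf x" using k by (simp add: b_def)
    have r: "2 * (b + k) \<noteq> 0"
    proof
      assume "2 * (b + k) = 0"
      then have "(b + k) * k = 0" by simp
      then show False using kk bk by (simp add: algebra_simps)
    qed
    have dec: "hmat 0 0 0 x 0 0 = hmat 0 b k x 0 0 - b *\<^sub>R hmat 0 1 0 0 0 0 - k *\<^sub>R hmat 0 0 1 0 0 0"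
      "hmat 0 0 0 0 x 0 = hmat k 0 b 0 x 0 - b *\<^sub>R hmat 0 0 1 0 0 0 - k *\<^sub>R hmat 1 0 0 0 0 0"
      "hmat 0 0 0 0 0 x = hmat b k 0 0 0 x - b *\<^sub>R hmat 1 0 0 0 0 0 - k *\<^sub>R hmat 0 1 0 0 0 0"
      by (simp_all add: hmat_diff hmat_scale)
    have "herm_trace (D (hmat 0 b k x 0 0)) = 0" "herm_trace (D (hmat k 0 b 0 x 0)) = 0"
      "herm_trace (D (hmat b k 0 0 0 x)) = 0"
      by (intro derivation_trace_multiple_idempotent[OF D _ r];
          simp add: mult bk[symmetric] algebra_simps;
          simp only: mult_2_right scaleR_add_left add_ac)+
    then show "herm_trace (D (hmat 0 0 0 x 0 0)) = 0" "herm_trace (D (hmat 0 0 0 0 x 0)) = 0"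
      "herm_trace (D (hmat 0 0 0 0 0 x)) = 0"
      unfolding dec
      by (simp_all add: linear_diff[OF lin] linear_scale[OF lin] herm_trace_diff herm_trace_scale E)
  qed
  obtain a b c x y z where A: "A = hmat a b c x y z" by (rule hmat_cases)
  have "A = a *\<^sub>R hmat 1 0 0 0 0 0 + b *\<^sub>R hmat 0 1 0 0 0 0 + c *\<^sub>R hmat 0 0 1 0 0 0
      + hmat 0 0 0 x 0 0 + hmat 0 0 0 0 y 0 + hmat 0 0 0 0 0 z"
    by (simp add: A hmat_add hmat_scale)
  then show ?thesis
    by (simp add: linear_add[OF lin] linear_scale[OF lin] herm_trace_add herm_trace_scale E X)
qed

text \<open>Commuting with the diagonal matrix units forces the off-diagonal entries to vanish,
  commuting with off-diagonal units forces equal diagonal entries. This determines the centre of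
  \<open>Str\<close>.\<close>

lemma lmul_comm_traceless:
  fixes A :: "'a::composition_algebra herm3"
  assumes c: "\<And>B C. lmul_comm A B C = 0" and t: "herm_trace A = 0"
  shows "A = 0"
proof -
  obtain a b c x y z where A: "A = hmat a b c x y z" by (rule hmat_cases)
  have p0: "polar v 0 = 0" "polar 0 v = 0" for v :: 'a
    using polar_scale_right[of v 0 0] polar_scale_left[of 0 0 v] by simp_all
  note mult = A hmat_mult p0 hmat_diff hmat_eq_iff alg_bilinear_simps alg_conj_zero lmul_comm_def
    hmat_zero[symmetric]
  have "x = 0" "y = 0" "z = 0"
    using assms(1)[of "hmat 0 1 0 0 0 0" "hmat 0 0 1 0 0 0"]
      assms(1)[of "hmat 1 0 0 0 0 0" "hmat 0 1 0 0 0 0"]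
      assms(1)[of "hmat 0 0 1 0 0 0" "hmat 1 0 0 0 0 0"]
    by (simp_all add: mult)
  moreover have "b = c" "c = a"
    using assms(1)[of "hmat 0 0 0 1 0 0" "hmat 0 1 0 0 0 0"]
      assms(1)[of "hmat 0 0 0 0 1 0" "hmat 0 0 1 0 0 0"]
    by (simp_all add: mult \<open>x = 0\<close> \<open>y = 0\<close> \<open>z = 0\<close> alg_one_neq_zero flip: scaleR_add_left scaleR_diff_left)
  ultimately show ?thesis using t by (simp add: A herm_trace_hmat hmat_zero)
qed

section \<open>Tensor products\<close>

lemma pure_tensor_simps:
  "(a + a') \<otimes> b = a \<otimes> b + a' \<otimes> b" "a \<otimes> (b + b') = a \<otimes> b + a \<otimes> b'"
  "(r *\<^sub>R a) \<otimes> b = r *\<^sub>R (a \<otimes> b)" "a \<otimes> (r *\<^sub>R b) = r *\<^sub>R (a \<otimes> b)"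
  by (transfer, rule span_base, fastforce simp: tensor_relations_def diff_diff_eq)+

lemma bilinear_pure_tensor: "bilinear (\<otimes>)"
  by (simp add: bilinear_def linear_iff pure_tensor_simps)

lemma pure_tensor_more_simps:
  "0 \<otimes> b = 0" "a \<otimes> 0 = 0" "(- a) \<otimes> b = - (a \<otimes> b)" "a \<otimes> (- b) = - (a \<otimes> b)"
  "(a - a') \<otimes> b = a \<otimes> b - a' \<otimes> b" "a \<otimes> (b - b') = a \<otimes> b - a \<otimes> b'"
  by (simp_all add: bilinear_lzero bilinear_rzero bilinear_lneg bilinear_rneg bilinear_lsub
      bilinear_rsub bilinear_pure_tensor)

text \<open>Since \<open>tensor_lift\<close> is a definite description, its additivity in
  \<open>f\<close> is an instance of uniqueness. It is needed because the bracket of tensors is a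
  lift inside a lift.\<close>

lemma tensor_lift_add_fun:
  assumes f: "bilinear f" and g: "bilinear g"
  shows "tensor_lift (\<lambda>a b. f a b + g a b) t = tensor_lift f t + tensor_lift g t"
proof -
  have fg: "bilinear (\<lambda>a b. f a b + g a b)"
    using f g by (auto simp: bilinear_def intro: linear_compose_add)
  have "tensor_lift (\<lambda>a b. f a b + g a b) = (\<lambda>t. tensor_lift f t + tensor_lift g t)"
    by (rule tensor_linear_eqI)
      (simp_all add: tensor_lift[OF f] tensor_lift[OF g] tensor_lift[OF fg] linear_compose_add)
  then show ?thesis by (rule fun_cong)
qed

lemma tensor_lift_scale_fun:
  assumes f: "bilinear f"
  shows "tensor_lift (\<lambda>a b. r *\<^sub>R f a b) t = r *\<^sub>R tensor_lift f t"
proof -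
  have fg: "bilinear (\<lambda>a b. r *\<^sub>R f a b)"
    using f by (auto simp: bilinear_def intro: linear_compose_scale_right)
  have "tensor_lift (\<lambda>a b. r *\<^sub>R f a b) = (\<lambda>t. r *\<^sub>R tensor_lift f t)"
    by (rule tensor_linear_eqI)
      (simp_all add: tensor_lift[OF f] tensor_lift[OF fg] linear_compose_scale_right)
  then show ?thesis by (rule fun_cong)
qed

lemma linear_span_mem:
  assumes "linear f" "subspace S" "\<And>b. b \<in> B \<Longrightarrow> f b \<in> S" "x \<in> span B"
  shows "f x \<in> S"
  using linear_span_image[OF assms(1), of B] span_minimal[of "f ` B" S] assms by blast

section \<open>The brackets of \<open>L3\<close>\<close>

lemma inner_der_simps:
  "inner_der (x + x') y = inner_der x y + inner_der x' y"
  "inner_der x (y + y') = inner_der x y + inner_der x y'"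
  "inner_der (r *\<^sub>R x) y = r *\<^sub>R inner_der x y" "inner_der x (r *\<^sub>R y) = r *\<^sub>R inner_der x y"
  by (simp_all add: inner_der_def fun_simps commutator_apply lmul_def rmul_def alg_bilinear_simps
      algebra_simps)

lemma commutator_lmul_simps:
  "commutator (lmul (x + x')) (lmul y) = commutator (lmul x) (lmul y) + commutator (lmul x') (lmul y)"
  "commutator (lmul x) (lmul (y + y')) = commutator (lmul x) (lmul y) + commutator (lmul x) (lmul y')"
  "commutator (lmul (r *\<^sub>R x)) (lmul y) = r *\<^sub>R commutator (lmul x) (lmul y)"
  "commutator (lmul x) (lmul (r *\<^sub>R y)) = r *\<^sub>R commutator (lmul x) (lmul y)"
  by (simp_all add: fun_simps commutator_apply lmul_def alg_bilinear_simps algebra_simps)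

lemma alg_ip_simps:
  "alg_ip (x + x') y = alg_ip x y + alg_ip x' y" "alg_ip x (y + y') = alg_ip x y + alg_ip x y'"
  "alg_ip (r *\<^sub>R x) y = r * alg_ip x y" "alg_ip x (r *\<^sub>R y) = r * alg_ip x y"
  by (simp_all add: alg_ip_def alg_re_add alg_re_scale alg_bilinear_simps alg_conj_add
      alg_conj_scale)

lemma herm_ip_simps:
  "herm_ip (x + x') y = herm_ip x y + herm_ip x' y" "herm_ip x (y + y') = herm_ip x y + herm_ip x y'"
  "herm_ip (r *\<^sub>R x) y = r * herm_ip x y" "herm_ip x (r *\<^sub>R y) = r * herm_ip x y"
  by (simp_all add: herm_ip_def herm_trace_add herm_trace_scale alg_bilinear_simps)

lemma herm_star_simps:
  "herm_star (x + x') y = herm_star x y + herm_star x' y"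
  "herm_star x (y + y') = herm_star x y + herm_star x y'"
  "herm_star (r *\<^sub>R x) y = r *\<^sub>R herm_star x y" "herm_star x (r *\<^sub>R y) = r *\<^sub>R herm_star x y"
  by (simp_all add: herm_star_def herm_trace_add herm_trace_scale alg_bilinear_simps algebra_simps
      add_divide_distrib)

lemma bilinear_L3_pure_bracket_right: "bilinear (L3_pure_bracket A x)"
  unfolding bilinear_def linear_iff L3_pure_bracket_def
  by (simp add: inner_der_simps commutator_lmul_simps alg_ip_simps herm_ip_simps herm_star_simps
      alg_bilinear_simps pure_tensor_simps pure_tensor_more_simps algebra_simps)

lemma bilinear_L3_pure_bracket_left: "bilinear (\<lambda>A x. L3_pure_bracket A x B y)"
  unfolding bilinear_def linear_iff L3_pure_bracket_def
  by (simp add: inner_der_simps commutator_lmul_simps alg_ip_simps herm_ip_simps herm_star_simps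
      alg_bilinear_simps pure_tensor_simps pure_tensor_more_simps algebra_simps)

lemma bilinear_L3_partial_bracket:
  fixes t :: "('a::composition_algebra herm3, 'b::composition_algebra) tensor"
  shows "bilinear (\<lambda>A x. tensor_lift (L3_pure_bracket A x) t)"
proof -
  note l = bilinear_L3_pure_bracket_left and r = bilinear_L3_pure_bracket_right
  have "L3_pure_bracket A (x + x') = (\<lambda>B y. L3_pure_bracket A x B y + L3_pure_bracket A x' B y)"
    "L3_pure_bracket (A + A') x = (\<lambda>B y. L3_pure_bracket A x B y + L3_pure_bracket A' x B y)"
    "L3_pure_bracket A (c *\<^sub>R x) = (\<lambda>B y. c *\<^sub>R L3_pure_bracket A x B y)"
    "L3_pure_bracket (c *\<^sub>R A) x = (\<lambda>B y. c *\<^sub>R L3_pure_bracket A x B y)"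
    for A A' :: "'a herm3" and x x' :: 'b and c
    by (intro ext bilinear_ladd[OF l] bilinear_radd[OF l] bilinear_lmul[OF l] bilinear_rmul[OF l])+
  then show ?thesis
    unfolding bilinear_def linear_iff
    by (simp add: tensor_lift_add_fun[OF r r] tensor_lift_scale_fun[OF r])
qed

lemma L3_tensor_bracket_linear_left: "linear (\<lambda>s. L3_tensor_bracket s t)"
  unfolding L3_tensor_bracket_def by (rule tensor_lift(1)[OF bilinear_L3_partial_bracket])

lemma L3_tensor_bracket_pure_left:
  "L3_tensor_bracket (A \<otimes> x) t = tensor_lift (L3_pure_bracket A x) t"
  unfolding L3_tensor_bracket_def by (rule tensor_lift(2)[OF bilinear_L3_partial_bracket])

lemma L3_tensor_bracket_pure: "L3_tensor_bracket (A \<otimes> x) (B \<otimes> y) = L3_pure_bracket A x B y"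
  by (simp add: L3_tensor_bracket_pure_left tensor_lift(2)[OF bilinear_L3_pure_bracket_right])

text \<open>For pure \<open>s\<close> this is linearity of the inner lift. For general
  \<open>s\<close>, both sides of each law are linear in \<open>s\<close> and agree on pure
  tensors.\<close>

lemma L3_tensor_bracket_linear_right: "linear (L3_tensor_bracket s)"
proof -
  have "L3_tensor_bracket s (t + t') = L3_tensor_bracket s t + L3_tensor_bracket s t'" for t t'
    by (rule fun_cong[where f = "\<lambda>s. L3_tensor_bracket s (t + t')"], rule tensor_linear_eqI)
      (simp_all add: L3_tensor_bracket_linear_left linear_compose_add L3_tensor_bracket_pure_left
        linear_add[OF tensor_lift(1)[OF bilinear_L3_pure_bracket_right]])
  moreover have "L3_tensor_bracket s (r *\<^sub>R t) = r *\<^sub>R L3_tensor_bracket s t" for r t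
    by (rule fun_cong[where f = "\<lambda>s. L3_tensor_bracket s (r *\<^sub>R t)"], rule tensor_linear_eqI)
      (simp_all add: L3_tensor_bracket_linear_left linear_compose_scale_right
        L3_tensor_bracket_pure_left linear_scale[OF tensor_lift(1)[OF bilinear_L3_pure_bracket_right]])
  ultimately show ?thesis by (simp add: linear_iff)
qed

lemma bilinear_L3_action:
  assumes "linear D" "linear E"
  shows "bilinear (\<lambda>A x. D A \<otimes> x + A \<otimes> E x)"
  using assms unfolding bilinear_def linear_iff by (simp add: pure_tensor_simps algebra_simps)

lemma L3_action_linear: "linear D \<Longrightarrow> linear E \<Longrightarrow> linear (L3_action D E)"
  unfolding L3_action_def by (rule tensor_lift(1)[OF bilinear_L3_action])

lemma L3_action_pure:
  "linear D \<Longrightarrow> linear E \<Longrightarrow> L3_action D E (A \<otimes> x) = D A \<otimes> x + A \<otimes> E x"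
  unfolding L3_action_def by (rule tensor_lift(2)[OF bilinear_L3_action])

lemma L3_bracket_simps:
  "L3_bracket (D, s, E) (D', t, E') = (commutator D D', L3_action D E t - L3_action D' E' s,
     commutator E E') + L3_tensor_bracket s t"
  by (simp add: L3_bracket_def)

section \<open>Closure of L3 under its bracket\<close>

definition L3_carrier :: "('a::composition_algebra, 'b::composition_algebra) L3_space set" where
  "L3_carrier = derivations \<times> L3_tensors \<times> derivations"

lemma L3_eq: "L3 TYPE('a::composition_algebra) TYPE('b::composition_algebra)
    = lie_on L3_carrier L3_bracket"
  by (simp add: L3_def L3_carrier_def)

lemma subspace_L3_tensors: "subspace L3_tensors"
  unfolding L3_tensors_def by (rule subspace_span)

lemma subspace_L3_carrier: "subspace L3_carrier"
  unfolding L3_carrier_def by (intro subspace_Times subspace_derivations subspace_L3_tensors)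

lemma imag_part_commutator: "x * y - y * x \<in> imag_part"
proof -
  have "polar (x * y) 1 = polar (y * x) 1"
    by (metis polar_adjoint_right alg_one_left polar_conj polar_sym)
  then show ?thesis by (simp add: imag_part_def polar_simps)
qed

lemma subspace_imag_part: "subspace imag_part"
proof (rule subspaceI)
  have "polar 0 (1::'a) = 0" using polar_scale_left[of 0 0 "1::'a"] by simp
  then show "(0::'a) \<in> imag_part" by (simp add: imag_part_def)
qed (simp_all add: imag_part_def polar_simps)

lemma subspace_herm_traceless: "subspace herm_traceless"
proof (rule subspaceI)
  show "0 \<in> (herm_traceless :: 'a herm3 set)"
    using herm_trace_scale[of 0 "0 :: 'a herm3"] by (simp add: herm_traceless_def)
qed (simp_all add: herm_traceless_def herm_trace_add herm_trace_scale)

lemma herm_star_traceless: "herm_star A B \<in> herm_traceless"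
  by (simp add: herm_traceless_def herm_star_def herm_trace_diff herm_trace_scale herm_trace_id)

lemma derivation_traceless: "D \<in> derivations \<Longrightarrow> D A \<in> herm_traceless"
  by (simp add: herm_traceless_def derivation_trace)

lemma L3_tensors_pure: "A \<in> herm_traceless \<Longrightarrow> x \<in> imag_part \<Longrightarrow> A \<otimes> x \<in> L3_tensors"
  unfolding L3_tensors_def by (rule span_base) blast

text \<open>The two hypotheses concern the second algebra alone and are verified for each choice of
  it. From the first algebra come the tracelessness of D(A) and the fact that [L_A, L_B] is a
  derivation.\<close>

lemma L3_bracket_closed:
  fixes p q :: "('a::composition_algebra, 'b::composition_algebra) L3_space"
  assumes inner: "\<And>x y :: 'b. x \<in> imag_part \<Longrightarrow> y \<in> imag_part \<Longrightarrow> inner_der x y \<in> derivations"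
    and imag: "\<And>E (x :: 'b). E \<in> derivations \<Longrightarrow> x \<in> imag_part \<Longrightarrow> E x \<in> imag_part"
    and p: "p \<in> L3_carrier" and q: "q \<in> L3_carrier"
  shows "L3_bracket p q \<in> L3_carrier"
proof -
  obtain D s E where p': "p = (D, s, E)" "D \<in> derivations" "s \<in> L3_tensors" "E \<in> derivations"
    using p by (auto simp: L3_carrier_def)
  obtain D' t E' where q': "q = (D', t, E')" "D' \<in> derivations" "t \<in> L3_tensors" "E' \<in> derivations"
    using q by (auto simp: L3_carrier_def)
  have act: "L3_action D E t \<in> L3_tensors"
    if D: "D \<in> derivations" and E: "E \<in> derivations" and t: "t \<in> L3_tensors"
    for D :: "'a herm3 \<Rightarrow> 'a herm3" and E :: "'b \<Rightarrow> 'b" and t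
  proof (rule linear_span_mem[OF _ subspace_L3_tensors _ t[unfolded L3_tensors_def]])
    note lin = D[THEN derivation_linear] E[THEN derivation_linear]
    show "linear (L3_action D E)" by (rule L3_action_linear[OF lin])
    fix b :: "('a herm3, 'b) tensor"
    assume "b \<in> {A \<otimes> x |A x. A \<in> herm_traceless \<and> x \<in> imag_part}"
    then obtain A x where b: "b = A \<otimes> x" "A \<in> herm_traceless" "x \<in> imag_part" by blast
    show "L3_action D E b \<in> L3_tensors"
      unfolding b(1) L3_action_pure[OF lin]
      by (intro subspace_add[OF subspace_L3_tensors] L3_tensors_pure derivation_traceless[OF D]
          imag[OF E] b)
  qed
  have pure: "L3_pure_bracket A x B y \<in> L3_carrier"
    if xy: "x \<in> imag_part" "y \<in> imag_part" for A B :: "'a herm3" and x y :: 'b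
    unfolding L3_pure_bracket_def L3_carrier_def mem_Times_iff fst_conv snd_conv
    by (intro conjI L3_tensors_pure herm_star_traceless subspace_neg[OF subspace_derivations]
        subspace_scale[OF subspace_derivations] commutator_lmul_derivation inner[OF xy]
        subspace_scale[OF subspace_imag_part] imag_part_commutator)
  have "L3_tensor_bracket (A \<otimes> x) t \<in> L3_carrier"
    if x: "x \<in> imag_part" for A :: "'a herm3" and x :: 'b
    by (rule linear_span_mem[OF L3_tensor_bracket_linear_right subspace_L3_carrier _
          q'(3)[unfolded L3_tensors_def]])
      (auto simp: L3_tensor_bracket_pure intro: pure[OF x])
  then have "L3_tensor_bracket s t \<in> L3_carrier"
    by (intro linear_span_mem[OF L3_tensor_bracket_linear_left subspace_L3_carrier _
          p'(3)[unfolded L3_tensors_def]]) auto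
  moreover have "(commutator D D', L3_action D E t - L3_action D' E' s, commutator E E') \<in> L3_carrier"
    unfolding L3_carrier_def mem_Times_iff fst_conv snd_conv
    by (intro conjI derivations_commutator subspace_diff[OF subspace_L3_tensors] act p' q')
  ultimately show ?thesis
    unfolding p'(1) q'(1) L3_bracket_simps by (rule subspace_add[OF subspace_L3_carrier, rotated])
qed

section \<open>The second algebra is \<open>\<real>\<close>\<close>

lemma derivation_one:
  assumes "D \<in> derivations"
  shows "D (1::'a::composition_algebra) = 0"
  using derivation_mult[OF assms, of 1 1] by (simp add: alg_one_left alg_one_right)

lemma derivations_real: "derivations = {0 :: real \<Rightarrow> real}"
proof -
  have "E = 0" if E: "E \<in> derivations" for E :: "real \<Rightarrow> real"
  proof
    fix x
    show "E x = 0 x"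
      using linear_scale[OF derivation_linear[OF E], of x 1] derivation_one[OF E] by simp
  qed
  then show ?thesis using subspace_0[OF subspace_derivations] by blast
qed

lemma imag_part_real: "imag_part = {0 :: real}"
  by (auto simp: imag_part_def polar_def qf_real_def power2_eq_square algebra_simps)

lemma L3_real: "L3 TYPE('a::composition_algebra) TYPE(real) \<cong> Der TYPE('a herm3)"
proof -
  have "{A \<otimes> x |A x. A \<in> herm_traceless \<and> x \<in> {0::real}} \<subseteq> {0 :: ('a herm3, real) tensor}"
    by (auto simp: pure_tensor_more_simps)
  then have "L3_tensors \<subseteq> {0 :: ('a herm3, real) tensor}"
    unfolding L3_tensors_def imag_part_real by (rule span_minimal[OF _ subspace_single_0])
  then have t: "L3_tensors = {0 :: ('a herm3, real) tensor}"
    using subspace_0[OF subspace_L3_tensors] by blast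
  have car: "(L3_carrier :: ('a, real) L3_space set) = derivations \<times> {0} \<times> {0}"
    by (simp add: L3_carrier_def t derivations_real)
  have lie: "real_lie_algebra (lie_on (derivations :: ('a herm3 \<Rightarrow> 'a herm3) set) commutator)"
    using real_lie_algebra_Der[where 'j = "'a herm3"] by (simp add: Der_def)
  show ?thesis
    unfolding L3_eq Der_def
  proof (rule lie_isomorphic_lie_onI[OF lie subspace_L3_carrier, where f = fst])
    fix p q :: "('a, real) L3_space"
    assume pq: "p \<in> L3_carrier" "q \<in> L3_carrier"
    show "L3_bracket p q \<in> L3_carrier"
      by (rule L3_bracket_closed[OF _ _ pq])
        (auto simp: derivations_real imag_part_real inner_der_def fun_simps commutator_apply
          lmul_def rmul_def)
    show "fst (L3_bracket p q) = commutator (fst p) (fst q)"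
      using pq by (auto simp: car L3_bracket_simps linear_0[OF L3_tensor_bracket_linear_right])
  qed (auto simp: car bij_betw_def inj_on_def)
qed

section \<open>The second algebra is the split complex algebra\<close>

lemma alg_re_real: "alg_re (x::real) = x"
  by (simp add: alg_re_def polar_def qf_real_def power2_eq_square algebra_simps)

lemma alg_conj_real: "alg_conj (x::real) = x"
  by (simp add: alg_conj_eq alg_re_real)

abbreviation sc_unit :: split_complex where "sc_unit \<equiv> SCD 0 1"

lemma imag_part_split_complex: "(x::split_complex) \<in> imag_part \<longleftrightarrow> scd_fst x = 0"
  by (simp add: imag_part_def polar_def qf_scd_def one_scd_def plus_scd_def qf_real_def
      power2_eq_square algebra_simps)

lemma sc_mult: "SCD a b * SCD c d = SCD (a * c + d * b) (d * a + b * (c::real))"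
  by (simp add: times_scd_def alg_conj_real)

text \<open>Differentiating u^2 = 1 gives 2u E(u) = 0, and u is invertible.\<close>

lemma derivations_split_complex: "derivations = {0 :: split_complex \<Rightarrow> split_complex}"
proof -
  have "E = 0" if E: "E \<in> derivations" for E :: "split_complex \<Rightarrow> split_complex"
  proof
    fix x :: split_complex
    obtain p q where pq: "E sc_unit = SCD p q" by (cases "E sc_unit")
    have "E (sc_unit * sc_unit) = 0"
      using derivation_one[OF E] by (simp add: sc_mult one_scd_def)
    then have "E sc_unit * sc_unit + sc_unit * E sc_unit = 0"
      by (metis derivation_mult[OF E])
    then have "E sc_unit = 0"
      by (simp add: pq sc_mult scd_defs)
    moreover obtain a b where "x = a *\<^sub>R 1 + b *\<^sub>R sc_unit"
    proof
      show "x = scd_fst x *\<^sub>R 1 + scd_snd x *\<^sub>R sc_unit"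
        by (cases x) (simp add: scd_defs one_scd_def)
    qed
    ultimately show "E x = 0 x"
      using derivation_linear[OF E] by (simp add: linear_add linear_scale derivation_one[OF E])
  qed
  then show ?thesis using subspace_0[OF subspace_derivations] by blast
qed

lemma inner_der_split_complex: "inner_der x y = (0 :: split_complex \<Rightarrow> split_complex)"
proof
  fix z :: split_complex
  show "inner_der x y z = 0 z"
    by (cases x, cases y, cases z)
      (simp add: inner_der_def commutator_apply lmul_def rmul_def sc_mult scd_defs algebra_simps)
qed

lemma L3_tensors_split_complex:
  "L3_tensors = {A \<otimes> sc_unit | A :: 'a::composition_algebra herm3. A \<in> herm_traceless}" (is "_ = ?T")
proof
  have "subspace ?T"
  proof (rule subspaceI)
    show "0 \<in> ?T"
      using subspace_0[OF subspace_herm_traceless]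
      by (auto intro!: exI[of _ 0] simp: pure_tensor_more_simps)
  next
    fix s t :: "('a herm3, split_complex) tensor" and r
    assume "s \<in> ?T" "t \<in> ?T"
    then obtain A B :: "'a herm3" where
      "s = A \<otimes> sc_unit" "t = B \<otimes> sc_unit" "A \<in> herm_traceless" "B \<in> herm_traceless" by blast
    then show "s + t \<in> ?T" "r *\<^sub>R s \<in> ?T"
      by (auto simp: pure_tensor_simps(1,3)[symmetric] intro!: subspace_add subspace_scale
          subspace_herm_traceless exI)
  qed
  moreover have "A \<otimes> x \<in> ?T" if "A \<in> herm_traceless" "x \<in> imag_part"
    for A :: "'a herm3" and x :: split_complex
  proof -
    have "x = scd_snd x *\<^sub>R sc_unit"
      using that(2) by (cases x) (simp add: imag_part_split_complex scd_defs)
    then have "A \<otimes> x = (scd_snd x *\<^sub>R A) \<otimes> sc_unit"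
      by (metis pure_tensor_simps(3,4))
    then show ?thesis using subspace_scale[OF subspace_herm_traceless that(1)] by blast
  qed
  ultimately show "L3_tensors \<subseteq> ?T"
    unfolding L3_tensors_def by (intro span_minimal) auto
  show "?T \<subseteq> L3_tensors"
    by (auto intro!: L3_tensors_pure simp: imag_part_split_complex)
qed

text \<open>A linear left inverse of the map from A to A (x) u; taking it as a lift makes it
  independent of how a tensor is written.\<close>

definition sc_coord :: "('a::real_vector, split_complex) tensor \<Rightarrow> 'a" where
  "sc_coord = tensor_lift (\<lambda>A x. scd_snd x *\<^sub>R A)"

lemma bilinear_sc_coord: "bilinear (\<lambda>(A::'a::real_vector) (x::split_complex). scd_snd x *\<^sub>R A)"
  by (simp add: bilinear_def linear_iff scd_defs algebra_simps)

lemma linear_sc_coord: "linear sc_coord"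
  unfolding sc_coord_def by (rule tensor_lift(1)[OF bilinear_sc_coord])

lemma sc_coord_pure: "sc_coord (A \<otimes> SCD a b) = b *\<^sub>R A"
  unfolding sc_coord_def by (subst tensor_lift(2)[OF bilinear_sc_coord]) simp

text \<open>The sign comes from <u, u> = -1, the mark of the split form: it turns -<u, u> [L_A, L_B]
  into the commutator that \<open>Str\<close> requires.\<close>

lemma L3_tensor_bracket_split_complex:
  "L3_tensor_bracket (A \<otimes> sc_unit) (B \<otimes> sc_unit) = (commutator (lmul A) (lmul B), 0, 0)"
proof -
  have "alg_ip sc_unit sc_unit = - 1"
    by (simp add: alg_ip_def alg_conj_eq alg_re_def polar_def qf_scd_def one_scd_def
        scd_defs qf_real_def sc_mult)
  moreover have "(1/2) *\<^sub>R (sc_unit * sc_unit - sc_unit * sc_unit) = 0" by simp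
  ultimately show ?thesis
    by (simp add: L3_tensor_bracket_pure L3_pure_bracket_def inner_der_split_complex
        pure_tensor_more_simps)
qed

text \<open>If D + L_A commutes with every L_B, then [L_A, L_B] + L_{DB} = 0. The sum being direct,
  both terms vanish, so D = 0 and the traceless part of A is zero by
  \<open>lmul_comm_traceless\<close>.\<close>

lemma lie_centre_Str:
  "lie_centre (Str TYPE('a::composition_algebra herm3)) = {lmul (r *\<^sub>R herm_id) | r. True}" (is "_ = ?Z")
proof
  show "?Z \<subseteq> lie_centre (Str TYPE('a herm3))"
  proof clarify
    fix r
    have "0 + lmul (r *\<^sub>R herm_id) \<in> (structure_maps :: ('a herm3 \<Rightarrow> 'a herm3) set)"
      by (rule structure_mapsI[OF subspace_0[OF subspace_derivations]])
    moreover have "commutator (lmul (r *\<^sub>R herm_id)) T = 0"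
      if "T \<in> structure_maps" for T :: "'a herm3 \<Rightarrow> 'a herm3"
      using linear_scale[OF structure_maps_linear[OF that]]
      by (simp add: fun_simps commutator_apply lmul_def alg_scale_left herm_id_mult)
    ultimately show "lmul (r *\<^sub>R herm_id) \<in> lie_centre (Str TYPE('a herm3))"
      by (simp add: lie_centre_def Str_def)
  qed
  show "lie_centre (Str TYPE('a herm3)) \<subseteq> ?Z"
  proof
    fix T assume T: "T \<in> lie_centre (Str TYPE('a herm3))"
    then obtain D A where T': "T = D + lmul A" and D: "D \<in> derivations"
      by (auto simp: lie_centre_def Str_def structure_maps_def)
    note zero = subspace_0[OF subspace_derivations]
    have c: "commutator (lmul A) (lmul B) = 0 \<and> D B = 0" for B
    proof -
      have "commutator T (0 + lmul B) = 0"
        using T structure_mapsI[OF zero, of B] by (simp add: lie_centre_def Str_def)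
      then have "commutator (lmul A) (lmul B) + lmul (D B) = 0 + lmul 0"
        using commutator_structure_map[OF D zero, of A B]
        by (simp add: T' commutator_def[of D 0] linear_0[OF derivation_linear[OF D]] lmul_zero
            zero_fun_def[symmetric])
      from structure_map_eqD[OF commutator_lmul_derivation zero this] show ?thesis by simp
    qed
    then have "D = 0" by (simp add: fun_eq_iff)
    define A0 where "A0 = A - (herm_trace A / 3) *\<^sub>R herm_id"
    have "lmul_comm A0 B C = 0" for B C
    proof -
      have "lmul_comm A B C = 0" using c[of B] by (metis commutator_lmul zero_fun_apply)
      then show ?thesis
        by (simp add: A0_def lmul_comm_def alg_bilinear_simps herm_id_mult)
    qed
    then have "A0 = 0"
      by (rule lmul_comm_traceless)
        (simp add: A0_def herm_trace_diff herm_trace_scale herm_trace_id)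
    then have "A = (herm_trace A / 3) *\<^sub>R herm_id" by (simp add: A0_def)
    then have "T = lmul ((herm_trace A / 3) *\<^sub>R herm_id)" using T' \<open>D = 0\<close> by simp
    then show "T \<in> ?Z" by blast
  qed
qed

lemma L3_split_complex:
  "L3 TYPE('a::composition_algebra) TYPE(split_complex) \<cong> Str' TYPE('a herm3)"
proof -
  let ?Z = "lie_centre (Str TYPE('a herm3))"
  let ?S = "structure_maps :: ('a herm3 \<Rightarrow> 'a herm3) set"
  have lie: "real_lie_algebra (lie_on ?S commutator)"
    using real_lie_algebra_Str[where 'j = "'a herm3"] by (simp add: Str_def)
  have Zmem: "T \<in> ?Z \<longleftrightarrow> T \<in> ?S \<and> (\<forall>U\<in>?S. commutator T U = 0)" for T
    by (simp add: lie_centre_def Str_def)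
  interpret I: lie_ideal ?S ?Z commutator
  proof (rule lie_ideal.intro)
    show "real_lie_algebra (lie_on ?S commutator)" by (rule lie)
    show "subspace ?Z"
      unfolding lie_centre_Str
      by (rule subspaceI)
        (auto simp: lmul_scale scaleR_add_left[symmetric] intro: exI[of _ 0])
    show "?Z \<subseteq> ?S" using Zmem by blast
    then have 0: "0 \<in> ?Z" using subspace_0[OF \<open>subspace ?Z\<close>] by blast
    fix x i assume x: "x \<in> ?S" "i \<in> ?Z"
    show "commutator i x \<in> ?Z" using x Zmem[of i] 0 by simp
    then show "commutator x i \<in> ?Z" using x Zmem[of i] 0 commutator_anti[of x i] by simp
  qed
  \<comment> \<open>The map goes to \<open>Str\<close> itself, so that the Jacobi identity can be
    taken from there before the centre is divided out.\<close>
  define g :: "('a, split_complex) L3_space \<Rightarrow> 'a herm3 \<Rightarrow> 'a herm3"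
    where "g = (\<lambda>(D, t, E). D + lmul (sc_coord t))"
  have car: "p \<in> L3_carrier \<longleftrightarrow> (\<exists>D\<in>derivations. \<exists>A\<in>herm_traceless. p = (D, A \<otimes> sc_unit, 0))"
    for p :: "('a, split_complex) L3_space"
    by (auto simp: L3_carrier_def L3_tensors_split_complex derivations_split_complex)
  have g: "g (D, A \<otimes> sc_unit, 0) = D + lmul A" for D A
    by (simp add: g_def sc_coord_pure)
  have gadd: "g (p + q) = g p + g q" "g (r *\<^sub>R p) = r *\<^sub>R g p" for p q r
    by (simp_all add: g_def split_beta linear_add[OF linear_sc_coord] linear_scale[OF linear_sc_coord]
        lmul_add lmul_scale scaleR_add_right)
  have closed: "L3_bracket p q \<in> L3_carrier" if "p \<in> L3_carrier" "q \<in> L3_carrier"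
    for p q :: "('a, split_complex) L3_space"
    by (rule L3_bracket_closed[OF _ _ that])
      (auto simp: inner_der_split_complex derivations_split_complex imag_part_split_complex scd_defs)
  have gbr: "g (L3_bracket p q) = commutator (g p) (g q)"
    if pL: "p \<in> L3_carrier" and qL: "q \<in> L3_carrier" for p q
  proof -
    obtain D A where p: "p = (D, A \<otimes> sc_unit, 0)" and D: "D \<in> derivations"
      using pL unfolding car by blast
    obtain D' A' where q: "q = (D', A' \<otimes> sc_unit, 0)" and D': "D' \<in> derivations"
      using qL unfolding car by blast
    have E: "linear (0 :: split_complex \<Rightarrow> split_complex)"
      by (simp add: linear_iff)
    have "L3_bracket p q = (commutator D D' + commutator (lmul A) (lmul A'),
        (D A' - D' A) \<otimes> sc_unit, 0)"
      by (simp add: p q L3_bracket_simps L3_action_pure[OF derivation_linear[OF D] E]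
          L3_action_pure[OF derivation_linear[OF D'] E] L3_tensor_bracket_split_complex
          pure_tensor_more_simps)
        (simp add: fun_simps commutator_apply)
    then show ?thesis
      by (simp add: g p q commutator_structure_map[OF D D'])
  qed
  have gS: "g p \<in> ?S" if "p \<in> L3_carrier" for p
    using that by (auto simp: car g intro: structure_mapsI)
  have gZ: "p = 0" if p: "p \<in> L3_carrier" and z: "g p \<in> ?Z" for p
  proof -
    obtain D A where p': "p = (D, A \<otimes> sc_unit, 0)" and D: "D \<in> derivations" and A: "A \<in> herm_traceless"
      using p unfolding car by blast
    obtain r where "D + lmul A = 0 + lmul (r *\<^sub>R herm_id)"
      using z unfolding lie_centre_Str by (auto simp: p' g)
    from structure_map_eqD[OF D subspace_0[OF subspace_derivations] this]
    have "D = 0" "A = r *\<^sub>R herm_id" by auto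
    with A have "r = 0" by (simp add: herm_traceless_def herm_trace_scale herm_trace_id)
    then show "p = 0"
      by (simp add: p' \<open>D = 0\<close> \<open>A = _\<close> pure_tensor_more_simps zero_prod_def)
  qed
  have gdiff: "g (p - q) = g p - g q" for p q
    using gadd(1)[of "p - q" q] by (simp add: algebra_simps)
  \<comment> \<open>Injectivity modulo the centre serves twice: for \<open>g\<close> and for its
    composition with the projection.\<close>
  have inj: "p = q" if "p \<in> L3_carrier" "q \<in> L3_carrier" "g p - g q \<in> ?Z" for p q
    using gZ[OF subspace_diff[OF subspace_L3_carrier that(1,2)]] that(3) by (simp add: gdiff)
  have "real_lie_algebra (lie_on L3_carrier L3_bracket :: ('a, split_complex) L3_space lie_struct)"
  proof (rule real_lie_algebra_inj[OF lie subspace_L3_carrier closed])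
    show "inj_on g L3_carrier"
    proof (rule inj_onI)
      fix p q assume pq: "p \<in> L3_carrier" "q \<in> L3_carrier" "g p = g q"
      then have "g p - g q \<in> ?Z" using subspace_0[OF I.I] by simp
      with pq show "p = q" by (intro inj)
    qed
  qed (auto simp: gS gadd gbr)
  moreover have "real_lie_algebra (Str' TYPE('a herm3))"
    using I.real_lie_algebra_quotient by (simp add: Str'_def Str_def)
  moreover have "lie_iso (lie_on L3_carrier L3_bracket) I.Q (I.proj \<circ> g)"
    unfolding lie_iso_def
  proof (intro conjI ballI allI)
    show "bij_betw (I.proj \<circ> g) (lcarrier (lie_on L3_carrier L3_bracket)) (lcarrier I.Q)"
      unfolding bij_betw_def
    proof
      show "inj_on (I.proj \<circ> g) (lcarrier (lie_on L3_carrier L3_bracket))"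
        by (rule inj_onI, rule inj) (simp_all add: I.proj_eq_iff)
      have "I.proj T \<in> I.proj ` g ` L3_carrier" if T: "T \<in> ?S" for T
      proof -
        obtain D A where T': "T = D + lmul A" and D: "D \<in> derivations"
          using T by (auto simp: structure_maps_def)
        \<comment> \<open>The traceless part of \<open>A\<close> represents the same coset, because
          multiplication by the removed multiple of \<open>herm_id\<close> is central.\<close>
        define B where "B = A - (herm_trace A / 3) *\<^sub>R herm_id"
        have B: "B \<in> herm_traceless"
          by (simp add: B_def herm_traceless_def herm_trace_diff herm_trace_scale herm_trace_id)
        have "T - g (D, B \<otimes> sc_unit, 0) = lmul ((herm_trace A / 3) *\<^sub>R herm_id)"
          by (simp add: T' g B_def lmul_diff)
        then have "T - g (D, B \<otimes> sc_unit, 0) \<in> ?Z"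
          unfolding lie_centre_Str by blast
        then have "I.proj T = I.proj (g (D, B \<otimes> sc_unit, 0))"
          unfolding I.proj_eq_iff .
        moreover have "(D, B \<otimes> sc_unit, 0) \<in> L3_carrier"
          unfolding car using D B by blast
        ultimately show ?thesis by blast
      qed
      then show "(I.proj \<circ> g) ` lcarrier (lie_on L3_carrier L3_bracket) = lcarrier I.Q"
        by (auto simp: lie_quotient_def gS)
    qed
  qed (simp_all add: I.proj_add I.proj_scale I.proj_bracket gadd gbr gS)
  ultimately show ?thesis
    unfolding L3_eq lie_isomorphic_def by (auto simp: Str'_def Str_def)
qed

section \<open>The second algebra is the split quaternion algebra\<close>

lemma alg_re_complex: "alg_re (z::complex) = Re z"
  unfolding alg_re_def polar_def qf_complex_def cmod_power2
  by (simp add: power2_eq_square algebra_simps)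

lemma alg_conj_complex: "alg_conj (z::complex) = cnj z"
  by (simp add: alg_conj_eq alg_re_complex complex_eq_iff)

lemma sq_mult: "SCD a b * SCD c d = SCD (a * c + cnj d * b) (d * a + b * cnj (c::complex))"
  by (simp add: times_scd_def alg_conj_complex)

lemma sq_assoc: "(x * y) * z = x * (y * (z::split_quaternion))"
  by (cases x, cases y, cases z) (simp add: sq_mult algebra_simps)

text \<open>\<open>sq a b c\<close> is \<open>a h + b e + c f\<close> for the imaginary units \<open>h, e, f\<close> of an \<open>sl\<^sub>2\<close>-triple:
  \<open>[h, e] = 2 e\<close>, \<open>[h, f] = - 2 f\<close>, \<open>[e, f] = h\<close>.\<close>

definition sq :: "real \<Rightarrow> real \<Rightarrow> real \<Rightarrow> split_quaternion" where
  "sq a b c = SCD (Complex 0 ((c - b) / 2)) (Complex a ((b + c) / 2))"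

definition sq_ad :: "real \<Rightarrow> real \<Rightarrow> real \<Rightarrow> split_quaternion \<Rightarrow> split_quaternion" where
  "sq_ad a b c = (\<lambda>z. sq a b c * z - z * sq a b c)"

lemma sq_simps:
  "sq a b c + sq a' b' c' = sq (a + a') (b + b') (c + c')"
  "r *\<^sub>R sq a b c = sq (r * a) (r * b) (r * c)"
  "sq a b c - sq a' b' c' = sq (a - a') (b - b') (c - c')"
  "- sq a b c = sq (- a) (- b) (- c)" "sq 0 0 0 = 0"
  by (simp_all add: sq_def scd_defs complex_eq_iff field_simps)

lemma sq_commutator: "sq a b c * sq a' b' c' - sq a' b' c' * sq a b c
    = sq (b * c' - c * b') (2 * (a * b' - b * a')) (2 * (c * a' - a * c'))"
  by (simp add: sq_def sq_mult scd_defs complex_eq_iff field_simps)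

lemma sq_ad_sq: "sq_ad a b c (sq a' b' c')
    = sq (b * c' - c * b') (2 * (a * b' - b * a')) (2 * (c * a' - a * c'))"
  by (simp add: sq_ad_def sq_commutator)

lemma sq_ad_simps:
  "sq_ad a b c + sq_ad a' b' c' = sq_ad (a + a') (b + b') (c + c')"
  "r *\<^sub>R sq_ad a b c = sq_ad (r * a) (r * b) (r * c)"
  by (simp_all add: fun_simps sq_ad_def sq_simps(1,2)[symmetric] alg_bilinear_simps
      scaleR_diff_right)

lemma sq_ad_derivation: "sq_ad a b c \<in> derivations"
  by (simp add: derivations_def sq_ad_def linear_iff alg_bilinear_simps sq_assoc algebra_simps)

lemma sq_ad_commutator: "commutator (sq_ad a b c) (sq_ad a' b' c')
    = sq_ad (b * c' - c * b') (2 * (a * b' - b * a')) (2 * (c * a' - a * c'))"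
  unfolding sq_ad_def sq_commutator[symmetric]
  by (simp add: fun_simps commutator_apply alg_bilinear_simps sq_assoc algebra_simps)

text \<open>In an associative algebra left and right multiplications commute, [L_x, L_y] = L_{[x,y]}
  and [R_x, R_y] = -R_{[x,y]}; so D_{x,y} = ad [x, y].\<close>

lemma inner_der_sq: "inner_der (sq a b c) (sq a' b' c')
    = sq_ad (b * c' - c * b') (2 * (a * b' - b * a')) (2 * (c * a' - a * c'))"
  unfolding sq_ad_def sq_commutator[symmetric]
  by (simp add: fun_simps inner_der_def commutator_apply lmul_def rmul_def alg_bilinear_simps
      sq_assoc algebra_simps)

lemma polar_one_sq: "polar (x::split_quaternion) 1 = Re (scd_fst x)"
  unfolding polar_def qf_scd_def qf_complex_def cmod_power2
  by (simp add: one_scd_def plus_scd_def power2_eq_square algebra_simps)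

lemma imag_part_sq: "imag_part = {sq a b c | a b c. True}"
proof -
  have "x \<in> {sq a b c | a b c. True}" if "x \<in> imag_part" for x
  proof -
    obtain u v where x: "x = SCD u v" by (cases x)
    have "Re u = 0" using that by (simp add: x imag_part_def polar_one_sq)
    then have "x = sq (Re v) (Im v - Im u) (Im v + Im u)"
      by (simp add: x sq_def complex_eq_iff)
    then show ?thesis by blast
  qed
  moreover have "sq a b c \<in> imag_part" for a b c
    by (simp add: imag_part_def polar_one_sq sq_def)
  ultimately show ?thesis by blast
qed

lemma alg_re_sq: "alg_re (x::split_quaternion) = Re (scd_fst x)"
  by (simp add: alg_re_def polar_one_sq)

lemma alg_ip_sq: "alg_ip (sq a b c) (sq a' b' c') = - a * a' - (b * c' + c * b') / 2"
  by (simp add: alg_ip_def alg_conj_eq alg_re_sq sq_def sq_mult scd_defs one_scd_def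
      field_simps)

definition sq_h :: "split_quaternion \<Rightarrow> real" where "sq_h x = Re (scd_snd x)"
definition sq_e :: "split_quaternion \<Rightarrow> real" where "sq_e x = Im (scd_snd x) - Im (scd_fst x)"
definition sq_f :: "split_quaternion \<Rightarrow> real" where "sq_f x = Im (scd_snd x) + Im (scd_fst x)"

lemma sq_coords: "sq_h (sq a b c) = a" "sq_e (sq a b c) = b" "sq_f (sq a b c) = c"
  by (simp_all add: sq_h_def sq_e_def sq_f_def sq_def field_simps)

lemma sq_coords_linear: "linear sq_h" "linear sq_e" "linear sq_f"
  by (simp_all add: linear_iff sq_h_def sq_e_def sq_f_def scd_defs algebra_simps)

text \<open>The coordinates of a derivation \<open>E\<close>, found by comparing \<open>E h\<close> and \<open>E e\<close> with \<open>sq_ad_sq\<close>.\<close>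

definition der_h :: "(split_quaternion \<Rightarrow> split_quaternion) \<Rightarrow> real" where
  "der_h E = sq_e (E (sq 0 1 0)) / 2"
definition der_e :: "(split_quaternion \<Rightarrow> split_quaternion) \<Rightarrow> real" where
  "der_e E = - sq_e (E (sq 1 0 0)) / 2"
definition der_f :: "(split_quaternion \<Rightarrow> split_quaternion) \<Rightarrow> real" where
  "der_f E = sq_f (E (sq 1 0 0)) / 2"

lemma der_coords:
  "der_h (sq_ad a b c) = a" "der_e (sq_ad a b c) = b" "der_f (sq_ad a b c) = c"
  by (simp_all add: der_h_def der_e_def der_f_def sq_ad_sq sq_coords)

lemma der_coords_simps:
  "der_h (E + E') = der_h E + der_h E'" "der_e (E + E') = der_e E + der_e E'"
  "der_f (E + E') = der_f E + der_f E'" "der_h (r *\<^sub>R E) = r * der_h E"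
  "der_e (r *\<^sub>R E) = r * der_e E" "der_f (r *\<^sub>R E) = r * der_f E"
  by (simp_all add: der_h_def der_e_def der_f_def scaleR_fun_apply
      sq_coords_linear[THEN linear_add] sq_coords_linear[THEN linear_scale] add_divide_distrib)

text \<open>A derivation is fixed by its values on i and j. Differentiating i^2 = -1, j^2 = 1 and ij
  + ji = 0 leaves three free real parameters, as many as \<open>sq_ad\<close> has.\<close>

lemma derivation_split_quaternion:
  assumes E: "E \<in> derivations"
  shows "E = sq_ad (der_h E) (der_e E) (der_f E)"
proof -
  note lin = derivation_linear[OF E]
  define i where "i = SCD \<i> 0"
  define j where "j = SCD 0 (1::complex)"
  obtain p q where i: "E i = SCD p q" by (cases "E i")
  obtain s t where j: "E j = SCD s t" by (cases "E j")
  have "i * i = - 1" "j * j = 1" "i * j + j * i = 0"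
    by (simp_all add: i_def j_def sq_mult one_scd_def scd_defs)
  then have "E (i * i) = 0" "E (j * j) = 0" "E (i * j + j * i) = 0"
    by (simp_all add: linear_neg[OF lin] linear_0[OF lin] derivation_one[OF E])
  then have ii: "E i * i + i * E i = 0" and jj: "E j * j + j * E j = 0"
    and ji: "(E i * j + i * E j) + (E j * i + j * E i) = 0"
    by (simp_all only: linear_add[OF lin] derivation_mult[OF E])
  have p: "p = 0" using ii unfolding i by (simp add: i_def sq_mult scd_defs complex_eq_iff)
  have st: "Re s = 0" "Re t = 0" using jj unfolding j by (simp_all add: j_def sq_mult scd_defs complex_eq_iff)
  have q: "Re q = Im s"
    using ji unfolding i j p by (simp add: i_def j_def sq_mult scd_defs complex_eq_iff)
  have ij: "E (SCD 0 \<i>) = E i * j + i * E j"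
    using derivation_mult[OF E, of i j] by (simp add: i_def j_def sq_mult)
  have dec: "SCD u v = Re u *\<^sub>R 1 + Im u *\<^sub>R i + Re v *\<^sub>R j + Im v *\<^sub>R SCD 0 \<i>" for u v
    by (simp add: i_def j_def one_scd_def scd_defs complex_eq_iff)
  have EE: "E (SCD u v) = Im u *\<^sub>R SCD p q + Re v *\<^sub>R SCD s t
      + Im v *\<^sub>R (SCD p q * j + i * SCD s t)" for u v
    unfolding dec[of u v]
    by (simp add: linear_add[OF lin] linear_scale[OF lin] derivation_one[OF E] i j ij)
  show ?thesis
  proof
    fix x :: split_quaternion
    obtain u v where x: "x = SCD u v" by (cases x)
    show "E x = sq_ad (der_h E) (der_e E) (der_f E) x"
      unfolding sq_ad_def der_h_def der_e_def der_f_def x sq_def EE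
      using p st q
      by (simp add: sq_e_def sq_f_def i_def j_def sq_mult scd_defs complex_eq_iff field_simps)
  qed
qed

section \<open>The bracket of L3 in the basis h, e, f\<close>

definition sq_tensor :: "'a::composition_algebra herm3 \<Rightarrow> 'a herm3 \<Rightarrow> 'a herm3
    \<Rightarrow> ('a herm3, split_quaternion) tensor" where
  "sq_tensor A B C = A \<otimes> sq 1 0 0 + B \<otimes> sq 0 1 0 + C \<otimes> sq 0 0 1"

lemma pure_tensor_sq: "A \<otimes> sq a b c = sq_tensor (a *\<^sub>R A) (b *\<^sub>R A) (c *\<^sub>R A)"
proof -
  have "sq a b c = a *\<^sub>R sq 1 0 0 + b *\<^sub>R sq 0 1 0 + c *\<^sub>R sq 0 0 1"
    by (simp add: sq_simps)
  then show ?thesis by (simp add: sq_tensor_def pure_tensor_simps)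
qed

lemma sq_tensor_simps:
  "sq_tensor A B C + sq_tensor A' B' C' = sq_tensor (A + A') (B + B') (C + C')"
  "sq_tensor A B C - sq_tensor A' B' C' = sq_tensor (A - A') (B - B') (C - C')"
  "r *\<^sub>R sq_tensor A B C = sq_tensor (r *\<^sub>R A) (r *\<^sub>R B) (r *\<^sub>R C)"
  "sq_tensor 0 0 0 = 0"
  by (simp_all add: sq_tensor_def pure_tensor_simps pure_tensor_more_simps algebra_simps)

lemma L3_tensors_split_quaternion:
  "L3_tensors = {sq_tensor A B C | A B C :: 'a::composition_algebra herm3.
     A \<in> herm_traceless \<and> B \<in> herm_traceless \<and> C \<in> herm_traceless}" (is "_ = ?T")
proof
  note sub = subspace_herm_traceless
  have "subspace ?T"
  proof (rule subspaceI)
    show "0 \<in> ?T"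
      using subspace_0[OF sub] sq_tensor_simps(4)[symmetric] by blast
  next
    fix s t :: "('a herm3, split_quaternion) tensor" and r
    assume "s \<in> ?T" "t \<in> ?T"
    then obtain A B C A' B' C' :: "'a herm3" where s: "s = sq_tensor A B C" "t = sq_tensor A' B' C'"
      and mem: "A \<in> herm_traceless" "B \<in> herm_traceless" "C \<in> herm_traceless"
      "A' \<in> herm_traceless" "B' \<in> herm_traceless" "C' \<in> herm_traceless" by blast
    show "s + t \<in> ?T" "r *\<^sub>R s \<in> ?T"
      unfolding s sq_tensor_simps using mem subspace_add[OF sub] subspace_scale[OF sub] by blast+
  qed
  moreover have "A \<otimes> x \<in> ?T" if A: "A \<in> herm_traceless" and x: "x \<in> imag_part"
    for A :: "'a herm3" and x :: split_quaternion
  proof -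
    obtain a b c where "x = sq a b c" using x unfolding imag_part_sq by blast
    then show ?thesis
      using subspace_scale[OF sub A] by (auto simp: pure_tensor_sq)
  qed
  ultimately show "L3_tensors \<subseteq> ?T"
    unfolding L3_tensors_def by (intro span_minimal) auto
  have im: "sq a b c \<in> imag_part" for a b c unfolding imag_part_sq by blast
  show "?T \<subseteq> L3_tensors"
    by (auto simp: sq_tensor_def intro!: subspace_add[OF subspace_L3_tensors] L3_tensors_pure im)
qed

definition sq_coord :: "(split_quaternion \<Rightarrow> real) \<Rightarrow> ('a::real_vector, split_quaternion) tensor \<Rightarrow> 'a"
  where "sq_coord l = tensor_lift (\<lambda>A x. l x *\<^sub>R A)"

lemma bilinear_sq_coord: "linear l \<Longrightarrow> bilinear (\<lambda>(A::'a::real_vector) x. l x *\<^sub>R A)"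
  by (simp add: bilinear_def linear_iff algebra_simps)

lemma linear_sq_coord: "linear l \<Longrightarrow> linear (sq_coord l)"
  unfolding sq_coord_def by (rule tensor_lift(1)[OF bilinear_sq_coord])

lemma sq_coord_pure: "linear l \<Longrightarrow> sq_coord l (A \<otimes> x) = l x *\<^sub>R A"
  unfolding sq_coord_def by (rule tensor_lift(2)[OF bilinear_sq_coord])

lemma sq_coord_sq_tensor:
  "sq_coord sq_h (sq_tensor A B C) = A" "sq_coord sq_e (sq_tensor A B C) = B"
  "sq_coord sq_f (sq_tensor A B C) = C"
  by (simp_all add: sq_tensor_def sq_coords_linear linear_add[OF linear_sq_coord] sq_coord_pure
      sq_coords)

text \<open>The coefficients record <h, h> = -1 and <e, f> = -1/2, the other inner products of basis
  elements being 0, and the halved commutators [h, e]/2 = e, [e, f]/2 = h/2, [f, h]/2 = f. Those of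
  \<open>sq_ad\<close> come from ad [x, y] / 6.\<close>

lemma L3_tensor_bracket_sq_tensor:
  "L3_tensor_bracket (sq_tensor A B C) (sq_tensor A' B' C') =
   (commutator (lmul A) (lmul A') + (1/2) *\<^sub>R commutator (lmul B) (lmul C')
      + (1/2) *\<^sub>R commutator (lmul C) (lmul B'),
    sq_tensor ((1/2) *\<^sub>R (herm_star B C' - herm_star C B')) (herm_star A B' - herm_star B A')
      (herm_star C A' - herm_star A C'),
    sq_ad ((herm_ip B C' - herm_ip C B') / 6) ((herm_ip A B' - herm_ip B A') / 3)
      ((herm_ip C A' - herm_ip A C') / 3))"
proof -
  have pure: "L3_tensor_bracket (A \<otimes> sq a b c) (A' \<otimes> sq a' b' c') =
      ((a * a' + (b * c' + c * b') / 2) *\<^sub>R commutator (lmul A) (lmul A'),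
       sq_tensor (((b * c' - c * b') / 2) *\<^sub>R herm_star A A') ((a * b' - b * a') *\<^sub>R herm_star A A')
         ((c * a' - a * c') *\<^sub>R herm_star A A'),
       sq_ad (herm_ip A A' * (b * c' - c * b') / 6) (herm_ip A A' * (a * b' - b * a') / 3)
         (herm_ip A A' * (c * a' - a * c') / 3))"
    for A A' :: "'a herm3" and a b c a' b' c'
    unfolding L3_tensor_bracket_pure L3_pure_bracket_def
    by (simp add: alg_ip_sq sq_commutator inner_der_sq sq_simps sq_ad_simps pure_tensor_sq
        del: scaleR_minus_left flip: scaleR_minus_left)
      (simp add: diff_divide_distrib right_diff_distrib mult_ac)
  show ?thesis
    unfolding sq_tensor_def[of A B C] sq_tensor_def[of A' B' C']
    by (simp add: linear_add[OF L3_tensor_bracket_linear_left]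
        linear_add[OF L3_tensor_bracket_linear_right] pure sq_tensor_simps sq_ad_simps)
      (simp add: algebra_simps diff_divide_distrib)
qed

lemma L3_action_sq_tensor:
  assumes D: "D \<in> derivations"
  shows "L3_action D (sq_ad a b c) (sq_tensor A B C) = sq_tensor (D A - c *\<^sub>R B + b *\<^sub>R C)
    (D B - (2 * b) *\<^sub>R A + (2 * a) *\<^sub>R B) (D C + (2 * c) *\<^sub>R A - (2 * a) *\<^sub>R C)"
proof -
  note lin = derivation_linear[OF D] derivation_linear[OF sq_ad_derivation]
  show ?thesis
    unfolding sq_tensor_def[of A B C] linear_add[OF L3_action_linear[OF lin]] L3_action_pure[OF lin]
      sq_ad_sq
    by (simp add: pure_tensor_sq sq_tensor_simps) (simp add: algebra_simps)
qed

text \<open>A derivation \<open>ad u\<close> of the split quaternions plays the role of the missing tensor \<open>I \<otimes> u\<close>, so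
  that \<open>L3\<close> becomes the sum of the derivations of \<open>J\<close> and \<open>J \<otimes> sl\<^sub>2\<close>. The triple \<open>h, e, f\<close> provides the three
  copies of \<open>J\<close> in \<open>Con\<close>; the factor \<open>1/2\<close> matches \<open>[e, f] = h\<close> with the factor \<open>2\<close> in \<open>con_pairing\<close>.\<close>

definition L3_to_Con :: "('a::composition_algebra, split_quaternion) L3_space
    \<Rightarrow> ('a herm3 \<Rightarrow> 'a herm3) \<times> 'a herm3 \<times> 'a herm3" where
  "L3_to_Con = (\<lambda>(D, t, E). (D + lmul (sq_coord sq_h t + der_h E *\<^sub>R herm_id),
     (1/2) *\<^sub>R (sq_coord sq_e t + der_e E *\<^sub>R herm_id),
     (1/2) *\<^sub>R (sq_coord sq_f t + der_f E *\<^sub>R herm_id)))"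

lemma L3_to_Con_sq: "L3_to_Con (D, sq_tensor A B C, sq_ad a b c) =
    (D + lmul (A + a *\<^sub>R herm_id), (1/2) *\<^sub>R (B + b *\<^sub>R herm_id), (1/2) *\<^sub>R (C + c *\<^sub>R herm_id))"
  by (simp add: L3_to_Con_def sq_coord_sq_tensor der_coords)

lemma L3_to_Con_add: "L3_to_Con (p + q) = L3_to_Con p + L3_to_Con q"
  by (simp add: L3_to_Con_def split_beta sq_coords_linear linear_add[OF linear_sq_coord]
      der_coords_simps scaleR_add_left scaleR_add_right lmul_add add_ac add_divide_distrib)

lemma L3_to_Con_scale: "L3_to_Con (r *\<^sub>R p) = r *\<^sub>R L3_to_Con p"
  by (simp add: L3_to_Con_def split_beta sq_coords_linear linear_scale[OF linear_sq_coord]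
      der_coords_simps scaleR_add_right lmul_add lmul_scale)

lemma L3_carrier_sq: "p \<in> L3_carrier \<longleftrightarrow> (\<exists>D A B C a b c. p = (D, sq_tensor A B C, sq_ad a b c)
    \<and> D \<in> derivations \<and> A \<in> herm_traceless \<and> B \<in> herm_traceless \<and> C \<in> herm_traceless)"
proof
  assume "p \<in> L3_carrier"
  then obtain D t E where p: "p = (D, t, E)" "D \<in> derivations" "t \<in> L3_tensors" "E \<in> derivations"
    by (auto simp: L3_carrier_def)
  from p(3) obtain A B C where "t = sq_tensor A B C"
    "A \<in> herm_traceless" "B \<in> herm_traceless" "C \<in> herm_traceless"
    unfolding L3_tensors_split_quaternion by blast
  moreover from derivation_split_quaternion[OF p(4)] obtain a b c where "E = sq_ad a b c" by blast
  ultimately show "\<exists>D A B C a b c. p = (D, sq_tensor A B C, sq_ad a b c)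
    \<and> D \<in> derivations \<and> A \<in> herm_traceless \<and> B \<in> herm_traceless \<and> C \<in> herm_traceless"
    using p by blast
qed (auto simp: L3_carrier_def L3_tensors_split_quaternion sq_ad_derivation)

lemma commutator_lmul_herm_id:
  "commutator (lmul (A + a *\<^sub>R herm_id)) (lmul (B + b *\<^sub>R herm_id)) = commutator (lmul A) (lmul B)"
  by (simp add: fun_simps commutator_apply lmul_def alg_bilinear_simps herm_id_mult
      scaleR_add_right mult_ac)

lemma L3_to_Con_bracket:
  assumes "p \<in> L3_carrier" "q \<in> L3_carrier"
  shows "L3_to_Con (L3_bracket p q) = con_bracket (L3_to_Con p) (L3_to_Con q)"
proof -
  obtain D A B C a b c where p: "p = (D, sq_tensor A B C, sq_ad a b c)" and D: "D \<in> derivations"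
    using assms(1) unfolding L3_carrier_sq by blast
  obtain D' A' B' C' a' b' c' where q: "q = (D', sq_tensor A' B' C', sq_ad a' b' c')"
    and D': "D' \<in> derivations"
    using assms(2) unfolding L3_carrier_sq by blast
  let ?I = "herm_id :: 'a herm3"
  \<comment> \<open>The six matrices with their traces restored. Both sides are brought to one
    expression in these, with ordinary Jordan products in place of \<open>herm_star\<close>.\<close>
  define P where "P = A + a *\<^sub>R ?I" define P' where "P' = A' + a' *\<^sub>R ?I"
  define Q where "Q = B + b *\<^sub>R ?I" define Q' where "Q' = B' + b' *\<^sub>R ?I"
  define R where "R = C + c *\<^sub>R ?I" define R' where "R' = C' + c' *\<^sub>R ?I"
  note PQR = P_def P'_def Q_def Q'_def R_def R'_def
  define H where "H = commutator D D' + (commutator (lmul A) (lmul A')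
     + (1/2) *\<^sub>R commutator (lmul B) (lmul C') + (1/2) *\<^sub>R commutator (lmul C) (lmul B'))"
  have lin: "D (X + Y) = D X + D Y" "D (r *\<^sub>R X) = r *\<^sub>R D X" "D ?I = 0"
    "D' (X + Y) = D' X + D' Y" "D' (r *\<^sub>R X) = r *\<^sub>R D' X" "D' ?I = 0" for X Y r
    using D[THEN derivation_linear] D'[THEN derivation_linear] D D'
    by (simp_all add: linear_add linear_scale derivation_herm_id)
  have id: "X * ?I = 2 *\<^sub>R X" "?I * X = 2 *\<^sub>R X" for X
    using herm_id_mult[of X] herm_mult_comm[of X ?I] by simp_all
  have star: "herm_star X Y = X * Y - (herm_ip X Y / 3) *\<^sub>R ?I" for X Y
    by (simp add: herm_star_def herm_ip_def)
  have src: "L3_to_Con (L3_bracket p q) = (H + lmul (D P' - D' P + (1/2) *\<^sub>R (Q * R' - R * Q')),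
     (1/2) *\<^sub>R (D Q' - D' Q + P * Q' - P' * Q), (1/2) *\<^sub>R (D R' - D' R - P * R' + P' * R))"
  proof -
    have 1: "L3_bracket p q = (H,
        sq_tensor ((D A' - c *\<^sub>R B' + b *\<^sub>R C') - (D' A - c' *\<^sub>R B + b' *\<^sub>R C)
            + (1/2) *\<^sub>R (herm_star B C' - herm_star C B'))
          ((D B' - (2 * b) *\<^sub>R A' + (2 * a) *\<^sub>R B') - (D' B - (2 * b') *\<^sub>R A + (2 * a') *\<^sub>R B)
            + (herm_star A B' - herm_star B A'))
          ((D C' + (2 * c) *\<^sub>R A' - (2 * a) *\<^sub>R C') - (D' C + (2 * c') *\<^sub>R A - (2 * a') *\<^sub>R C)
            + (herm_star C A' - herm_star A C')),
        sq_ad (b * c' - c * b' + (herm_ip B C' - herm_ip C B') / 6)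
          (2 * (a * b' - b * a') + (herm_ip A B' - herm_ip B A') / 3)
          (2 * (c * a' - a * c') + (herm_ip C A' - herm_ip A C') / 3))"
      unfolding p q L3_bracket_simps L3_action_sq_tensor[OF D] L3_action_sq_tensor[OF D']
        L3_tensor_bracket_sq_tensor sq_ad_commutator
      by (simp add: sq_tensor_simps sq_ad_simps H_def)
    show ?thesis
      \<comment> \<open>The \<open>herm_ip\<close> terms in \<open>sq_ad\<close> cancel those in
        \<open>herm_star\<close>. The terms with a, b, c are the products with multiples of the
        identity, which acts as 2.\<close>
      unfolding 1 L3_to_Con_sq prod.inject PQR lin alg_bilinear_simps star id
      by (intro conjI arg_cong[where f = "\<lambda>X. H + lmul X"]
          arg_cong[where f = "scaleR (1/2)"]; simp add: algebra_simps herm_mult_comm[of C B'] 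
           herm_mult_comm[of B A'] herm_mult_comm[of C A'] diff_divide_distrib)
  qed
  have "con_bracket (L3_to_Con p) (L3_to_Con q)
    = (H + lmul (D P' - D' P + (1/2) *\<^sub>R (Q * R' - R * Q')),
     (1/2) *\<^sub>R (D Q' - D' Q + P * Q' - P' * Q), (1/2) *\<^sub>R (D R' - D' R - P * R' + P' * R))"
  proof -
    have "commutator (D + lmul P) (D' + lmul P') + con_pairing ((1/2) *\<^sub>R Q) ((1/2) *\<^sub>R R')
        - con_pairing ((1/2) *\<^sub>R Q') ((1/2) *\<^sub>R R)
      = H + lmul (D P' - D' P + (1/2) *\<^sub>R (Q * R' - R * Q'))"
    proof -
      have "commutator (lmul P) (lmul P') = commutator (lmul A) (lmul A')"
        "commutator (lmul Q) (lmul R') = commutator (lmul B) (lmul C')"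
        "commutator (lmul Q') (lmul R) = - commutator (lmul C) (lmul B')"
        unfolding PQR commutator_lmul_herm_id by (simp_all add: commutator_anti[of "lmul B'"])
      then show ?thesis
        unfolding commutator_structure_map[OF D D'] con_pairing_scale
        by (simp add: con_pairing_eq H_def scaleR_add_right scaleR_diff_right lmul_add lmul_diff lmul_scale herm_mult_comm[of R Q'])
    qed
    moreover have "(D + lmul P) ((1/2) *\<^sub>R Q') - (D' + lmul P') ((1/2) *\<^sub>R Q)
        = (1/2) *\<^sub>R (D Q' - D' Q + P * Q' - P' * Q)"
      by (simp add: lin lmul_apply alg_scale_right scaleR_add_right scaleR_diff_right)
    moreover have "str_involution (D + lmul P) ((1/2) *\<^sub>R R') - str_involution (D' + lmul P') ((1/2) *\<^sub>R R)
        = (1/2) *\<^sub>R (D R' - D' R - P * R' + P' * R)"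
      by (simp add: str_involution_eq[OF D] str_involution_eq[OF D'] lin lmul_apply alg_scale_right
          scaleR_add_right scaleR_diff_right)
    ultimately show ?thesis
      unfolding p q L3_to_Con_sq con_bracket_simps PQR[symmetric] prod.inject by blast
  qed
  with src show ?thesis by simp
qed

text \<open>Every matrix is uniquely a traceless one plus a multiple of the identity, and every
  structure map uniquely a derivation plus a multiplication; three splittings of the first kind and
  one of the second recover all coordinates.\<close>

lemma bij_betw_L3_to_Con: "bij_betw L3_to_Con L3_carrier (structure_maps \<times> UNIV \<times> UNIV)"
  unfolding bij_betw_def
proof
  have split: "A = A' \<and> a = a'"
    if "A + a *\<^sub>R herm_id = A' + a' *\<^sub>R herm_id" "A \<in> herm_traceless" "A' \<in> herm_traceless"
    for A A' :: "'a herm3" and a a'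
  proof -
    have "a = a'"
      using arg_cong[OF that(1), of herm_trace] that(2,3)
      by (simp add: herm_traceless_def herm_trace_add herm_trace_scale herm_trace_id)
    then show ?thesis using that(1) by simp
  qed
  show "inj_on L3_to_Con (L3_carrier :: ('a, split_quaternion) L3_space set)"
  proof (rule inj_onI)
    fix p q :: "('a, split_quaternion) L3_space"
    assume "p \<in> L3_carrier" and "q \<in> L3_carrier" and eq: "L3_to_Con p = L3_to_Con q"
    then obtain D A B C a b c D' A' B' C' a' b' c' where
      p: "p = (D, sq_tensor A B C, sq_ad a b c)" "D \<in> derivations" and
      q: "q = (D', sq_tensor A' B' C', sq_ad a' b' c')" "D' \<in> derivations" and
      t: "A \<in> herm_traceless" "B \<in> herm_traceless" "C \<in> herm_traceless"
      "A' \<in> herm_traceless" "B' \<in> herm_traceless" "C' \<in> herm_traceless"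
      unfolding L3_carrier_sq by blast
    have e: "D + lmul (A + a *\<^sub>R herm_id) = D' + lmul (A' + a' *\<^sub>R herm_id)"
      "B + b *\<^sub>R herm_id = B' + b' *\<^sub>R herm_id" "C + c *\<^sub>R herm_id = C' + c' *\<^sub>R herm_id"
      using eq unfolding p q L3_to_Con_sq prod.inject by simp_all
    show "p = q"
      using structure_map_eqD[OF p(2) q(2) e(1)] split[of A a A' a'] split[OF e(2) t(2,5)]
        split[OF e(3) t(3,6)] t by (simp add: p q)
  qed
  have onto: "A \<in> {B + b *\<^sub>R herm_id | B b. B \<in> herm_traceless}" for A :: "'a herm3"
  proof -
    have "A - (herm_trace A / 3) *\<^sub>R herm_id \<in> herm_traceless"
      by (simp add: herm_traceless_def herm_trace_diff herm_trace_scale herm_trace_id)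
    moreover have "A = (A - (herm_trace A / 3) *\<^sub>R herm_id) + (herm_trace A / 3) *\<^sub>R herm_id"
      by simp
    ultimately show ?thesis by blast
  qed
  have "(T, X, Y) \<in> L3_to_Con ` L3_carrier" if T: "T \<in> structure_maps"
    for T and X Y :: "'a herm3"
  proof -
    obtain D P where T': "T = D + lmul P" "D \<in> derivations" using T by (auto simp: structure_maps_def)
    obtain A a where A: "P = A + a *\<^sub>R herm_id" "A \<in> herm_traceless" using onto[of P] by blast
    obtain B b where B: "2 *\<^sub>R X = B + b *\<^sub>R herm_id" "B \<in> herm_traceless"
      using onto[of "2 *\<^sub>R X"] by blast
    obtain C c where C: "2 *\<^sub>R Y = C + c *\<^sub>R herm_id" "C \<in> herm_traceless"
      using onto[of "2 *\<^sub>R Y"] by blast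
    have "(D, sq_tensor A B C, sq_ad a b c) \<in> L3_carrier"
      unfolding L3_carrier_sq using T' A B C by blast
    moreover have "(T, X, Y) = L3_to_Con (D, sq_tensor A B C, sq_ad a b c)"
      unfolding L3_to_Con_sq A(1)[symmetric] B(1)[symmetric] C(1)[symmetric] by (simp add: T')
    ultimately show ?thesis by blast
  qed
  moreover have "L3_to_Con p \<in> structure_maps \<times> UNIV \<times> UNIV" if "p \<in> L3_carrier"
    for p :: "('a, split_quaternion) L3_space"
    using that unfolding L3_carrier_sq by (auto simp: L3_to_Con_sq structure_mapsI)
  ultimately show "L3_to_Con ` L3_carrier
      = (structure_maps :: ('a herm3 \<Rightarrow> 'a herm3) set) \<times> UNIV \<times> UNIV"
    by (intro equalityI image_subsetI subsetI) (auto simp del: UNIV_Times_UNIV)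
qed

lemma L3_split_quaternion:
  "L3 TYPE('a::composition_algebra) TYPE(split_quaternion) \<cong> Con TYPE('a herm3)"
  unfolding L3_eq Con_def
proof (rule lie_isomorphic_lie_onI[OF real_lie_algebra_Con[unfolded Con_def] subspace_L3_carrier _
      bij_betw_L3_to_Con])
  fix p q :: "('a, split_quaternion) L3_space"
  assume pq: "p \<in> L3_carrier" "q \<in> L3_carrier"
  show "L3_bracket p q \<in> L3_carrier"
  proof (rule L3_bracket_closed[OF _ _ pq])
    fix x y :: split_quaternion assume "x \<in> imag_part" "y \<in> imag_part"
    then show "inner_der x y \<in> derivations"
      unfolding imag_part_sq by (auto simp: inner_der_sq sq_ad_derivation)
  next
    fix E :: "split_quaternion \<Rightarrow> split_quaternion" and x :: split_quaternion
    assume "E \<in> derivations"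
    then show "E x \<in> imag_part"
      by (subst derivation_split_quaternion) (simp_all add: sq_ad_def imag_part_commutator)
  qed
  show "L3_to_Con (L3_bracket p q) = con_bracket (L3_to_Con p) (L3_to_Con q)"
    by (rule L3_to_Con_bracket[OF pq])
qed (simp_all add: L3_to_Con_add L3_to_Con_scale)

theorem theorem7:
  shows "L3 TYPE(real) TYPE(real) \<cong> Der TYPE(real herm3)
       \<and> L3 TYPE(complex) TYPE(real) \<cong> Der TYPE(complex herm3)
       \<and> L3 TYPE(quaternion) TYPE(real) \<cong> Der TYPE(quaternion herm3)
       \<and> L3 TYPE(octonion) TYPE(real) \<cong> Der TYPE(octonion herm3)
       \<and> L3 TYPE(real) TYPE(split_complex) \<cong> Str' TYPE(real herm3)
       \<and> L3 TYPE(complex) TYPE(split_complex) \<cong> Str' TYPE(complex herm3)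
       \<and> L3 TYPE(quaternion) TYPE(split_complex) \<cong> Str' TYPE(quaternion herm3)
       \<and> L3 TYPE(octonion) TYPE(split_complex) \<cong> Str' TYPE(octonion herm3)
       \<and> L3 TYPE(real) TYPE(split_quaternion) \<cong> Con TYPE(real herm3)
       \<and> L3 TYPE(complex) TYPE(split_quaternion) \<cong> Con TYPE(complex herm3)
       \<and> L3 TYPE(quaternion) TYPE(split_quaternion) \<cong> Con TYPE(quaternion herm3)
       \<and> L3 TYPE(octonion) TYPE(split_quaternion) \<cong> Con TYPE(octonion herm3)"
  by (intro conjI L3_real L3_split_complex L3_split_quaternion)

end
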